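(* Assume that $(ME)_{\mathrm c}<M[Q]E[Q]$. Let $u_{\mathrm c}$ be a global solution ($u_{\mathrm c}\in C([0,+\infty);H^1(\mathbb{R}^3))$) of $i\partial_tu+\Delta u+|u|^2u=0$ with initial data $u_{\mathrm c,0}\in H^1$ such that $\|u_{\mathrm c,0}\|_{L^2}=1$, $E[u_{\mathrm c}]=(ME)_{\mathrm c}<M[Q]E[Q]$, $\|\nabla u_{\mathrm c}(t)\|_{L^2}<\|Q\|_{L^2}\|\nabla Q\|_{L^2}$ for all $0\le t<+\infty$, and $\|u_{\mathrm c}\|_{S(\dot H^{1/2})}=+\infty$. Then its conserved momentum $P[u_{\mathrm c}]=\operatorname{Im}\int\bar u_{\mathrm c}\nabla u_{\mathrm c}\,dx$ is zero.
   Context: Functions are complex-valued on $\mathbb{R}^3$. The equation is the focusing cubic NLS $i\partial_tu+\Delta u+|u|^2u=0$ on $\mathbb{R}^3$, locally well-posed in $H^1$; solutions are strong $H^1$ solutions (Duhamel sense). Mass $M[u]=\int|u|^2dx$, energy $E[u]=\frac12\int|\nabla u|^2dx-\frac14\int|u|^4dx$ and momentum $P[u]=\operatorname{Im}\int\bar u\nabla u\,dx\in\mathbb{R}^3$ are conserved. $Q$ is the ground state: the nonzero $H^1$ solution of minimal mass of $-Q+\Delta Q+|Q|^2Q=0$ (positive, radial, exponentially decaying). A pair $(q,r)$ is $\dot H^{1/2}$ admissible if $\frac2q+\frac3r=1$. Fix numbers $6^-<6$ and $4^+>4$ (arbitrarily preselected, close to $6$ and $4$), and set $$\|u\|_{S(\dot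 H^{1/2})}=\sup\left\{\|u\|_{L_t^qL_x^r}:\ (q,r)\ \dot H^{1/2}\text{ admissible},\ 3\le r\le 6^-,\ 4^+\le q\le\infty\right\},$$ with time ranging over $[0,+\infty)$ for solutions of the nonlinear equation. For $u_0\in H^1$, say that $\mathrm{SC}(u_0)$ holds if the solution $u$ with data $u_0$ exists on $[0,+\infty)$ and $\|u\|_{S(\dot H^{1/2})}<\infty$. For $\delta>0$ let $$S_\delta=\{u_0\in H^1:\ M[u_0]E[u_0]<\delta\ \text{ and }\ \|u_0\|_{L^2}\|\nabla u_0\|_{L^2}<\|Q\|_{L^2}\|\nabla Q\|_{L^2}\},$$ and define $(ME)_{\mathrm c}=\sup\{\delta>0:\ u_0\in S_\delta\Rightarrow \mathrm{SC}(u_0)\text{ holds}\}$. *)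

theory Defs
  imports "HOL-Analysis.Analysis" "HOL-Probability.Essential_Supremum"
begin

text \<open>
  Elements of \<open>L\<^sup>2\<close> and \<open>H\<^sup>1\<close> are represented by Borel functions on \<open>real ^ 3\<close>; almost everywhere
  equal functions represent the same element.
\<close>

section \<open>Lebesgue and Sobolev spaces\<close>

definition L2 :: "(real ^ 3 \<Rightarrow> 'b::real_normed_vector) set" where
  "L2 = {f \<in> borel_measurable borel. integrable lborel (\<lambda>x. norm (f x) ^ 2)}"

definition L2_norm :: "(real ^ 3 \<Rightarrow> 'b::real_normed_vector) \<Rightarrow> real" where
  "L2_norm f = sqrt (LINT x|lborel. norm (f x) ^ 2)"

definition L2_inner :: "(real ^ 3 \<Rightarrow> complex) \<Rightarrow> (real ^ 3 \<Rightarrow> complex) \<Rightarrow> complex" where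
  "L2_inner f g = (LINT x|lborel. f x * cnj (g x))"

text \<open>
  \<open>D [j\<^sub>1, \<dots>, j\<^sub>k]\<close> is an iterated partial derivative of \<open>f\<close>; each of them is required to be
  (Frechet) differentiable everywhere.
\<close>
definition smooth_fun :: "(real ^ 3 \<Rightarrow> complex) \<Rightarrow> bool" where
  "smooth_fun f \<longleftrightarrow>
     (\<exists>D :: 3 list \<Rightarrow> real ^ 3 \<Rightarrow> complex. D [] = f \<and>
        (\<forall>\<alpha> x. (D \<alpha> has_derivative (\<lambda>h. \<Sum>j\<in>UNIV. h $ j *\<^sub>R D (j # \<alpha>) x)) (at x)))"

definition test_function :: "(real ^ 3 \<Rightarrow> complex) \<Rightarrow> bool" where
  "test_function \<phi> \<longleftrightarrow> smooth_fun \<phi> \<and> compact (closure {x. \<phi> x \<noteq> 0})"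

definition partial :: "3 \<Rightarrow> (real ^ 3 \<Rightarrow> complex) \<Rightarrow> real ^ 3 \<Rightarrow> complex" where
  "partial j \<phi> x = frechet_derivative \<phi> (at x) (axis j 1)"

definition weak_gradient :: "(real ^ 3 \<Rightarrow> complex) \<Rightarrow> (real ^ 3 \<Rightarrow> complex ^ 3) \<Rightarrow> bool" where
  "weak_gradient f g \<longleftrightarrow>
     (\<forall>\<phi>. test_function \<phi> \<longrightarrow>
        (\<forall>j. (LINT x|lborel. f x * partial j \<phi> x) = - (LINT x|lborel. g x $ j * \<phi> x)))"

definition H1 :: "(real ^ 3 \<Rightarrow> complex) set" where
  "H1 = {f \<in> L2. \<exists>g\<in>L2. weak_gradient f g}"

definition grad :: "(real ^ 3 \<Rightarrow> complex) \<Rightarrow> real ^ 3 \<Rightarrow> complex ^ 3" where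
  "grad f = (SOME g. g \<in> L2 \<and> weak_gradient f g)"

definition H1_norm :: "(real ^ 3 \<Rightarrow> complex) \<Rightarrow> real" where
  "H1_norm f = sqrt (L2_norm f ^ 2 + L2_norm (grad f) ^ 2)"

definition continuous_in_H1 :: "real set \<Rightarrow> (real \<Rightarrow> real ^ 3 \<Rightarrow> complex) \<Rightarrow> bool" where
  "continuous_in_H1 I u \<longleftrightarrow>
     (\<forall>t\<in>I. u t \<in> H1) \<and>
     (\<forall>t\<in>I. ((\<lambda>s. H1_norm (\<lambda>x. u s x - u t x)) \<longlongrightarrow> 0) (at t within I))"

section \<open>Mass, energy and momentum\<close>

definition mass :: "(real ^ 3 \<Rightarrow> complex) \<Rightarrow> real" where
  "mass f = (LINT x|lborel. norm (f x) ^ 2)"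

definition energy :: "(real ^ 3 \<Rightarrow> complex) \<Rightarrow> real" where
  "energy f = 1/2 * (LINT x|lborel. norm (grad f x) ^ 2) - 1/4 * (LINT x|lborel. norm (f x) ^ 4)"

definition momentum :: "(real ^ 3 \<Rightarrow> complex) \<Rightarrow> real ^ 3" where
  "momentum f = (\<chi> j. Im (LINT x|lborel. cnj (f x) * grad f x $ j))"

section \<open>The free evolution and strong solutions\<close>

definition fourier :: "(real ^ 3 \<Rightarrow> complex) \<Rightarrow> real ^ 3 \<Rightarrow> complex" where
  "fourier f \<xi> = of_real ((2 * pi) powr (- 3/2)) * (LINT x|lborel. cis (- (x \<bullet> \<xi>)) * f x)"

text \<open>
  Extension of \<open>fourier\<close> from \<open>L\<^sup>1 \<inter> L\<^sup>2\<close> to \<open>L\<^sup>2\<close> by density. The condition \<open>fourier (h n) \<in> L2\<close>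
  always holds (Plancherel); it is there because \<open>L2_norm\<close> is meaningful only on \<open>L2\<close>.
\<close>
definition L2_fourier :: "(real ^ 3 \<Rightarrow> complex) \<Rightarrow> (real ^ 3 \<Rightarrow> complex) \<Rightarrow> bool" where
  "L2_fourier f g \<longleftrightarrow> f \<in> L2 \<and> g \<in> L2 \<and>
     (\<exists>h :: nat \<Rightarrow> real ^ 3 \<Rightarrow> complex.
        (\<forall>n. integrable lborel (h n) \<and> h n \<in> L2 \<and> fourier (h n) \<in> L2) \<and>
        (\<lambda>n. L2_norm (\<lambda>x. h n x - f x)) \<longlonglongrightarrow> 0 \<and>
        (\<lambda>n. L2_norm (\<lambda>\<xi>. fourier (h n) \<xi> - g \<xi>)) \<longlonglongrightarrow> 0)"

text \<open>\<open>g\<close> represents \<open>e\<^bsup>it\<Delta>\<^esup>f\<close>, the Fourier multiplier with symbol \<open>e\<^bsup>-it|\<xi>|\<^sup>2\<^esup>\<close>.\<close>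
definition free_evolution :: "real \<Rightarrow> (real ^ 3 \<Rightarrow> complex) \<Rightarrow> (real ^ 3 \<Rightarrow> complex) \<Rightarrow> bool" where
  "free_evolution t f g \<longleftrightarrow>
     (\<exists>F. L2_fourier f F \<and> L2_fourier g (\<lambda>\<xi>. cis (- t * norm \<xi> ^ 2) * F \<xi>))"

text \<open>
  \<open>V\<close> is the Bochner integral of the \<open>L\<^sup>2\<close>-valued function \<open>G\<close> over \<open>[a, b]\<close>. As \<open>L\<^sup>2\<close> is a separable
  Hilbert space, weak measurability and integrability of the norm amount to Bochner
  integrability (Pettis), and the integral is determined by its pairings with elements of \<open>L\<^sup>2\<close>.
\<close>
definition has_L2_integral ::
    "(real \<Rightarrow> real ^ 3 \<Rightarrow> complex) \<Rightarrow> real \<Rightarrow> real \<Rightarrow> (real ^ 3 \<Rightarrow> complex) \<Rightarrow> bool" where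
  "has_L2_integral G a b V \<longleftrightarrow>
     V \<in> L2 \<and> (\<forall>s\<in>{a..b}. G s \<in> L2) \<and>
     set_integrable lborel {a..b} (\<lambda>s. L2_norm (G s)) \<and>
     (\<forall>\<phi>\<in>L2. set_integrable lborel {a..b} (\<lambda>s. L2_inner (G s) \<phi>) \<and>
        L2_inner V \<phi> = (LINT s:{a..b}|lborel. L2_inner (G s) \<phi>))"

text \<open>
  Strong \<open>H\<^sup>1\<close> solutions of \<open>i\<partial>\<^sub>tu + \<Delta>u + |u|\<^sup>2u = 0\<close> on \<open>[0, \<infinity>)\<close> with data \<open>u0\<close>:
  \<open>u \<in> C([0, \<infinity>); H\<^sup>1)\<close> and \<open>u(t) = e\<^bsup>it\<Delta>\<^esup>u0 + i \<integral>\<^sub>0\<^sup>t e\<^bsup>i(t-s)\<Delta>\<^esup>(|u|\<^sup>2u)(s) ds\<close>. The integral is taken in \<open>L\<^sup>2\<close>,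
  where \<open>|u|\<^sup>2u\<close> lies because \<open>H\<^sup>1\<close> embeds into \<open>L\<^sup>6\<close>. The values of \<open>u\<close> at negative times are
  irrelevant here and below.
\<close>
definition global_solution ::
    "(real ^ 3 \<Rightarrow> complex) \<Rightarrow> (real \<Rightarrow> real ^ 3 \<Rightarrow> complex) \<Rightarrow> bool" where
  "global_solution u0 u \<longleftrightarrow>
     u0 \<in> H1 \<and> continuous_in_H1 {0..} u \<and> (AE x in lborel. u 0 x = u0 x) \<and>
     (\<forall>t\<ge>0. \<exists>g G V. free_evolution t u0 g \<and>
        (\<forall>s\<in>{0..t}. free_evolution (t - s) (\<lambda>x. of_real (norm (u s x) ^ 2) * u s x) (G s)) \<and>
        has_L2_integral G 0 t V \<and>
        (AE x in lborel. u t x = g x + \<i> * V x))"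

section \<open>The Strichartz-type norm\<close>

text \<open>Used with positive finite exponents only.\<close>
definition ennpowr :: "ennreal \<Rightarrow> real \<Rightarrow> ennreal" where
  "ennpowr x p = (if x = top then top else ennreal (enn2real x powr p))"

definition Lp_enorm :: "'a measure \<Rightarrow> ereal \<Rightarrow> ('a \<Rightarrow> ennreal) \<Rightarrow> ennreal" where
  "Lp_enorm M p f =
     (if p = \<infinity> then esssup M f
      else ennpowr (\<integral>\<^sup>+ x. ennpowr (f x) (real_of_ereal p) \<partial>M) (1 / real_of_ereal p))"

definition mixed_norm :: "ereal \<Rightarrow> ereal \<Rightarrow> (real \<Rightarrow> real ^ 3 \<Rightarrow> complex) \<Rightarrow> ennreal" where
  "mixed_norm q r u =
     Lp_enorm (restrict_space lborel {0..}) q (\<lambda>t. Lp_enorm lborel r (\<lambda>x. ennreal (norm (u t x))))"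

definition H_half_admissible :: "ereal \<Rightarrow> ereal \<Rightarrow> bool" where
  "H_half_admissible q r \<longleftrightarrow> 2 / q + 3 / r = 1"

text \<open>The parameters \<open>r6\<close> and \<open>q4\<close> are the preselected numbers \<open>6\<^sup>- < 6\<close> and \<open>4\<^sup>+ > 4\<close>.\<close>
definition S_norm :: "real \<Rightarrow> real \<Rightarrow> (real \<Rightarrow> real ^ 3 \<Rightarrow> complex) \<Rightarrow> ennreal" where
  "S_norm r6 q4 u =
     (SUP (q, r) \<in> {(q, r). H_half_admissible q r \<and> 3 \<le> r \<and> r \<le> ereal r6 \<and> ereal q4 \<le> q}.
        mixed_norm q r u)"

section \<open>Ground state and critical threshold\<close>

text \<open>Weak formulation of \<open>- Q + \<Delta>Q + |Q|\<^sup>2Q = 0\<close>.\<close>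
definition elliptic_solution :: "(real ^ 3 \<Rightarrow> complex) \<Rightarrow> bool" where
  "elliptic_solution Q \<longleftrightarrow> Q \<in> H1 \<and>
     (\<forall>\<phi>. test_function \<phi> \<longrightarrow>
        - (LINT x|lborel. Q x * \<phi> x)
        - (LINT x|lborel. (\<Sum>j\<in>UNIV. grad Q x $ j * partial j \<phi> x))
        + (LINT x|lborel. of_real (norm (Q x) ^ 2) * Q x * \<phi> x) = 0)"

definition nonzero_elliptic_solution :: "(real ^ 3 \<Rightarrow> complex) \<Rightarrow> bool" where
  "nonzero_elliptic_solution Q \<longleftrightarrow> elliptic_solution Q \<and> \<not> (AE x in lborel. Q x = 0)"

text \<open>
  Minimality of the mass determines \<open>Q\<close> up to translation and phase; positivity and radial
  symmetry single out the usual representative.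
\<close>
definition ground_state :: "(real ^ 3 \<Rightarrow> complex) \<Rightarrow> bool" where
  "ground_state Q \<longleftrightarrow>
     nonzero_elliptic_solution Q \<and>
     (\<forall>R. nonzero_elliptic_solution R \<longrightarrow> mass Q \<le> mass R) \<and>
     (\<forall>x. Im (Q x) = 0 \<and> 0 < Re (Q x)) \<and>
     (\<forall>x y. norm x = norm y \<longrightarrow> Q x = Q y) \<and>
     (\<exists>C \<kappa>. 0 < \<kappa> \<and> (\<forall>x. norm (Q x) \<le> C * exp (- \<kappa> * norm x)))"

text \<open>
  ``The solution with data \<open>u0\<close>'' is rendered as a definite description: there is a solution, it
  is unique (up to null sets at each time), and its norm is finite. The uniqueness clause holds
  for every \<open>u0 \<in> H\<^sup>1\<close> by the well-posedness theory.
\<close>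
definition SC :: "real \<Rightarrow> real \<Rightarrow> (real ^ 3 \<Rightarrow> complex) \<Rightarrow> bool" where
  "SC r6 q4 u0 \<longleftrightarrow>
     (\<exists>u. global_solution u0 u \<and>
        (\<forall>v. global_solution u0 v \<longrightarrow> (\<forall>t\<ge>0. AE x in lborel. v t x = u t x)) \<and>
        S_norm r6 q4 u < \<infinity>)"

definition S_set :: "(real ^ 3 \<Rightarrow> complex) \<Rightarrow> real \<Rightarrow> (real ^ 3 \<Rightarrow> complex) set" where
  "S_set Q \<delta> = {u0 \<in> H1. mass u0 * energy u0 < \<delta> \<and>
     L2_norm u0 * L2_norm (grad u0) < L2_norm Q * L2_norm (grad Q)}"

text \<open>The supremum is taken in the extended reals, so no boundedness is presupposed.\<close>
definition ME_crit :: "real \<Rightarrow> real \<Rightarrow> (real ^ 3 \<Rightarrow> complex) \<Rightarrow> ereal" where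
  "ME_crit r6 q4 Q = Sup (ereal ` {\<delta>. 0 < \<delta> \<and> (\<forall>u0\<in>S_set Q \<delta>. SC r6 q4 u0)})"

end

theory Submission
  imports Defs "HOL-Probability.Characteristic_Functions" "HOL-Computational_Algebra.Polynomial"
begin

text \<open>
  If the momentum \<open>P\<close> of the data is not zero, the Galilean boost with velocity parameter \<open>- P\<close>
  lowers the energy by \<open>|P|\<^sup>2/2\<close> and the squared gradient norm by \<open>|P|\<^sup>2\<close>, keeps the mass, and does not
  change any norm \<open>L\<^sup>q\<^sub>tL\<^sup>r\<^sub>x\<close>. The boosted data are thus strictly below the critical threshold, so their
  solution scatters; by uniqueness it is the boosted solution, whose Strichartz norm is
  infinite: a contradiction. Boosts act on the Duhamel formula exactly, through the covariance of
  the Fourier transform under modulations and translations.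

  That the momentum is constant in time is shown for the profile \<open>F(t)\<close>, the Fourier transform of
  \<open>e\<^bsup>-it\<Delta>\<^esup>u(t)\<close>. It satisfies \<open>F(t) - F(s) = i\<integral>\<^sub>s\<^sup>t M\<close> with \<open>M(\<tau>)\<close> the Fourier transform of
  \<open>e\<^bsup>-i\<tau>\<Delta>\<^esup>(|u|\<^sup>2u)(\<tau>)\<close>, and \<open>P = \<langle>\<xi>F, F\<rangle>\<close>, so that
  \<open>P(t) - P(s) = Re (i\<integral>\<^sub>s\<^sup>t \<langle>M(\<tau>), \<xi>(F(t) + F(s) - 2F(\<tau>))\<rangle> d\<tau>)\<close>: the subtracted term vanishes because
  \<open>|u|\<^sup>2u\<close> is orthogonal to \<open>\<nabla>u\<close>. As \<open>\<xi>F\<close> is continuous in \<open>L\<^sup>2\<close>, the right-hand side is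
  \<open>o(1) \<integral>\<^sub>s\<^sup>t \<parallel>M\<parallel>\<close> as \<open>t - s \<rightarrow> 0\<close>, and summing over a fine partition gives \<open>P(t) = P(0)\<close>.
\<close>

text \<open>For H^1 data the time derivative of u lies only in H^-1, where it cannot be paired with
  the gradient of u, so the momentum is not differentiated directly. Finite increments take its
  place: multiplication by \<xi> is symmetric, hence P(t) - P(s) is the real part of <F(t) - F(s),
  \<xi> (F(t) + F(s))>, and Duhamel's integral meets one fixed element of L^2, which is exactly what
  an integral defined through its pairings provides. The increment of the profile is the integral of
  M alone; that of u itself would also contain the free flow, which for rough data is not bounded by
  the length of the interval. The integral of ||M|| is additive over intervals, so smallness on
  short intervals survives summation. The free evolution is a relation resting on approximating
  sequences in L^2. Working with it requires the L^2 Fourier transform, including surjectivity: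
  elements chosen on the frequency side have to be pulled back to elements against which the Duhamel
  integral may be tested.\<close>

section \<open>Translation and reflection invariance of Lebesgue measure\<close>

lemma nn_integral_lborel_shift:
  fixes a :: "'a::euclidean_space"
  assumes [measurable]: "f \<in> borel_measurable borel"
  shows "(\<integral>\<^sup>+x. f (x + a) \<partial>lborel) = (\<integral>\<^sup>+x. f x \<partial>lborel)"
proof -
  have "(\<integral>\<^sup>+x. f x \<partial>lborel) = (\<integral>\<^sup>+x. f x \<partial>distr lborel borel ((+) a))"
    by (simp add: lborel_distr_plus)
  also have "\<dots> = (\<integral>\<^sup>+x. f (x + a) \<partial>lborel)"
    by (subst nn_integral_distr) (auto simp: add.commute)
  finally show ?thesis ..
qed

lemma
  fixes f :: "'a::euclidean_space \<Rightarrow> 'b::{banach, second_countable_topology}"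
  assumes [measurable]: "f \<in> borel_measurable borel"
  shows integral_lborel_shift: "(LINT x|lborel. f (x + a)) = (LINT x|lborel. f x)"
    and integrable_lborel_shift: "integrable lborel (\<lambda>x. f (x + a)) \<longleftrightarrow> integrable lborel f"
proof -
  have "(LINT x|lborel. f x) = (LINT x|distr lborel borel ((+) a). f x)"
    by (simp add: lborel_distr_plus)
  also have "\<dots> = (LINT x|lborel. f (x + a))"
    by (subst integral_distr) (auto simp: add.commute)
  finally show "(LINT x|lborel. f (x + a)) = (LINT x|lborel. f x)" ..
  have "integrable lborel f \<longleftrightarrow> integrable (distr lborel borel ((+) a)) f"
    by (simp add: lborel_distr_plus)
  also have "\<dots> \<longleftrightarrow> integrable lborel (\<lambda>x. f (x + a))"
    by (subst integrable_distr_eq) (auto simp: add.commute)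
  finally show "integrable lborel (\<lambda>x. f (x + a)) \<longleftrightarrow> integrable lborel f" ..
qed

lemma
  fixes f :: "'a::euclidean_space \<Rightarrow> 'b::{banach, second_countable_topology}"
  assumes [measurable]: "f \<in> borel_measurable borel"
  shows integral_lborel_uminus: "(LINT x|lborel. f (- x)) = (LINT x|lborel. f x)"
    and integrable_lborel_uminus: "integrable lborel (\<lambda>x. f (- x)) \<longleftrightarrow> integrable lborel f"
proof -
  have *: "distr lborel borel uminus = (lborel :: 'a measure)"
    using lborel_affine[of "-1" "0::'a"] by (simp add: density_1 cong: distr_cong)
  have "(LINT x|lborel. f x) = (LINT x|distr lborel borel uminus. f x)"
    by (simp add: *)
  also have "\<dots> = (LINT x|lborel. f (- x))"
    by (subst integral_distr) auto
  finally show "(LINT x|lborel. f (- x)) = (LINT x|lborel. f x)" ..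
  have "integrable lborel f \<longleftrightarrow> integrable (distr lborel borel uminus) f"
    by (simp add: *)
  also have "\<dots> \<longleftrightarrow> integrable lborel (\<lambda>x. f (- x))"
    by (subst integrable_distr_eq) auto
  finally show "integrable lborel (\<lambda>x. f (- x)) \<longleftrightarrow> integrable lborel f" ..
qed

section \<open>The space L2\<close>

lemma L2I:
  "f \<in> borel_measurable borel \<Longrightarrow> integrable lborel (\<lambda>x. norm (f x) ^ 2) \<Longrightarrow> f \<in> L2"
  by (simp add: L2_def)

lemma L2_measurable: "f \<in> L2 \<Longrightarrow> f \<in> borel_measurable borel"
  by (simp add: L2_def)

lemma L2_integrable_norm: "f \<in> L2 \<Longrightarrow> integrable lborel (\<lambda>x. norm (f x) ^ 2)"
  by (simp add: L2_def)

lemma L2_bound: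
  assumes "f \<in> borel_measurable borel" "g \<in> L2" "\<And>x. norm (f x) \<le> c * norm (g x)"
  shows "f \<in> L2"
proof (rule L2I)
  show "integrable lborel (\<lambda>x. norm (f x) ^ 2)"
  proof (rule Bochner_Integration.integrable_bound)
    show "integrable lborel (\<lambda>x. c ^ 2 * norm (g x) ^ 2)"
      using L2_integrable_norm[OF assms(2)] by simp
    have "norm (f x) ^ 2 \<le> (c * norm (g x)) ^ 2" for x
      using assms(3) by (intro power_mono) auto
    then show "AE x in lborel. norm (norm (f x) ^ 2) \<le> norm (c ^ 2 * norm (g x) ^ 2)"
      by (simp add: power_mult_distrib)
  qed (use assms(1) in measurable)
qed (use assms in auto)

lemma L2_add:
  fixes f g :: "real ^ 3 \<Rightarrow> 'b::{real_normed_vector, second_countable_topology}"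
  assumes "f \<in> L2" "g \<in> L2"
  shows "(\<lambda>x. f x + g x) \<in> L2"
proof (rule L2I)
  have [measurable]: "f \<in> borel_measurable borel" "g \<in> borel_measurable borel"
    using assms by (auto dest: L2_measurable)
  show "(\<lambda>x. f x + g x) \<in> borel_measurable borel" by measurable
  show "integrable lborel (\<lambda>x. norm (f x + g x) ^ 2)"
  proof (rule Bochner_Integration.integrable_bound)
    show "integrable lborel (\<lambda>x. 2 * norm (f x) ^ 2 + 2 * norm (g x) ^ 2)"
      using L2_integrable_norm[OF assms(1)] L2_integrable_norm[OF assms(2)] by auto
    have "norm (f x + g x) ^ 2 \<le> 2 * norm (f x) ^ 2 + 2 * norm (g x) ^ 2" for x
    proof -
      have "norm (f x + g x) ^ 2 \<le> (norm (f x) + norm (g x)) ^ 2"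
        by (intro power_mono norm_triangle_ineq) auto
      also have "\<dots> \<le> 2 * norm (f x) ^ 2 + 2 * norm (g x) ^ 2"
        using sum_squares_bound[of "norm (f x)" "norm (g x)"] by (simp add: power2_sum)
      finally show ?thesis .
    qed
    then show "AE x in lborel. norm (norm (f x + g x) ^ 2) \<le> norm (2 * norm (f x) ^ 2 + 2 * norm (g x) ^ 2)"
      by simp
  qed measurable
qed

lemma L2_zero: "(\<lambda>x. 0) \<in> L2"
  by (rule L2I) auto

lemma L2_uminus:
  fixes f :: "real ^ 3 \<Rightarrow> 'b::{real_normed_vector, second_countable_topology}"
  assumes "f \<in> L2" shows "(\<lambda>x. - f x) \<in> L2"
  by (rule L2_bound[of _ f 1]) (use assms in \<open>auto dest: L2_measurable\<close>)

lemma L2_diff: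
  fixes f g :: "real ^ 3 \<Rightarrow> 'b::{real_normed_vector, second_countable_topology}"
  assumes "f \<in> L2" "g \<in> L2"
  shows "(\<lambda>x. f x - g x) \<in> L2"
  using L2_add[OF assms(1) L2_uminus[OF assms(2)]] by simp

lemma L2_mult_bounded:
  fixes f :: "real ^ 3 \<Rightarrow> complex"
  assumes "f \<in> L2" and [measurable]: "m \<in> borel_measurable borel" and "\<And>x. norm (m x) \<le> c"
  shows "(\<lambda>x. m x * f x) \<in> L2"
proof -
  have [measurable]: "f \<in> borel_measurable borel" using assms by (auto dest: L2_measurable)
  show ?thesis
    by (rule L2_bound[of _ f c]) (use assms in \<open>auto simp: norm_mult intro!: mult_right_mono\<close>)
qed

lemma L2_cmult: "f \<in> L2 \<Longrightarrow> (\<lambda>x. c * f x) \<in> L2" for f :: "real ^ 3 \<Rightarrow> complex"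
  by (rule L2_mult_bounded[where c="norm c"]) auto

lemma borel_measurable_cnj [measurable (raw)]:
  "f \<in> borel_measurable M \<Longrightarrow> (\<lambda>x. cnj (f x)) \<in> borel_measurable M"
  by (rule borel_measurable_continuous_onI[THEN measurable_compose_rev]) (auto intro: continuous_intros)

lemma L2_cnj: "f \<in> L2 \<Longrightarrow> (\<lambda>x. cnj (f x)) \<in> L2"
  by (rule L2_bound[of _ f 1]) (auto dest!: L2_measurable)

lemma L2_sum:
  fixes f :: "'i \<Rightarrow> real ^ 3 \<Rightarrow> 'b::{real_normed_vector, second_countable_topology}"
  shows "(\<And>i. i \<in> I \<Longrightarrow> f i \<in> L2) \<Longrightarrow> (\<lambda>x. \<Sum>i\<in>I. f i x) \<in> L2"
  by (induction I rule: infinite_finite_induct) (auto intro: L2_zero L2_add)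

lemma L2_shift:
  fixes f :: "real ^ 3 \<Rightarrow> complex"
  assumes "f \<in> L2" shows "(\<lambda>x. f (x + a)) \<in> L2"
proof (rule L2I)
  have [measurable]: "f \<in> borel_measurable borel" using assms by (auto dest: L2_measurable)
  show "(\<lambda>x. f (x + a)) \<in> borel_measurable borel" by measurable
  show "integrable lborel (\<lambda>x. norm (f (x + a)) ^ 2)"
    using L2_integrable_norm[OF assms] by (subst integrable_lborel_shift[of "\<lambda>x. norm (f x) ^ 2"]) auto
qed

abbreviation L2_dist :: "(real ^ 3 \<Rightarrow> 'b::real_normed_vector) \<Rightarrow> (real ^ 3 \<Rightarrow> 'b) \<Rightarrow> real" where
  "L2_dist f g \<equiv> L2_norm (\<lambda>x. f x - g x)"

lemma L2_norm_nonneg [simp]: "0 \<le> L2_norm f"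
  by (simp add: L2_norm_def)

lemma L2_norm_square: "L2_norm f ^ 2 = (LINT x|lborel. norm (f x) ^ 2)"
  by (simp add: L2_norm_def)

lemma L2_norm_shift:
  fixes f :: "real ^ 3 \<Rightarrow> complex"
  assumes [measurable]: "f \<in> borel_measurable borel"
  shows "L2_norm (\<lambda>x. f (x + a)) = L2_norm f"
  unfolding L2_norm_def by (subst integral_lborel_shift[of "\<lambda>x. norm (f x) ^ 2"]) auto

lemma L2_norm_cong: "(\<And>x. norm (f x) = norm (g x)) \<Longrightarrow> L2_norm f = L2_norm g"
  by (simp add: L2_norm_def)

lemma L2_norm_cong_AE:
  assumes [measurable]: "f \<in> borel_measurable borel" "g \<in> borel_measurable borel"
  assumes "AE x in lborel. norm (f x) = norm (g x)"
  shows "L2_norm f = L2_norm g"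
proof -
  have "(LINT x|lborel. norm (f x) ^ 2) = (LINT x|lborel. norm (g x) ^ 2)"
    by (rule integral_cong_AE) (use assms(3) in auto)
  then show ?thesis by (simp add: L2_norm_def)
qed

lemma L2_norm_cmult: "L2_norm (\<lambda>x. c * f x) = norm c * L2_norm f" for f :: "real ^ 3 \<Rightarrow> complex"
  by (simp add: L2_norm_def norm_mult power_mult_distrib real_sqrt_mult)

lemma L2_norm_minus_commute: "L2_dist f g = L2_dist g f"
  by (intro L2_norm_cong norm_minus_commute)

lemma L2_norm_eq_0_iff:
  assumes "f \<in> L2" shows "L2_norm f = 0 \<longleftrightarrow> (AE x in lborel. f x = 0)"
proof -
  have "L2_norm f = 0 \<longleftrightarrow> (LINT x|lborel. norm (f x) ^ 2) = 0"
    by (simp add: L2_norm_def)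
  also have "\<dots> \<longleftrightarrow> (AE x in lborel. norm (f x) ^ 2 = 0)"
    using L2_integrable_norm[OF assms] by (intro integral_nonneg_eq_0_iff_AE) auto
  finally show ?thesis by simp
qed

lemma L2_integrable_norm_mult:
  fixes f :: "real ^ 3 \<Rightarrow> 'b::{real_normed_vector, second_countable_topology}"
    and g :: "real ^ 3 \<Rightarrow> 'c::{real_normed_vector, second_countable_topology}"
  assumes "f \<in> L2" "g \<in> L2"
  shows "integrable lborel (\<lambda>x. norm (f x) * norm (g x))"
proof (rule Bochner_Integration.integrable_bound)
  have [measurable]: "f \<in> borel_measurable borel" "g \<in> borel_measurable borel"
    using assms by (auto dest: L2_measurable)
  show "integrable lborel (\<lambda>x. norm (f x) ^ 2 + norm (g x) ^ 2)"
    using assms by (auto dest: L2_integrable_norm)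
  have "norm (f x) * norm (g x) \<le> norm (f x) ^ 2 + norm (g x) ^ 2" for x
    using sum_squares_bound[of "norm (f x)" "norm (g x)"]
      mult_nonneg_nonneg[OF norm_ge_zero[of "f x"] norm_ge_zero[of "g x"]] by linarith
  then show "AE x in lborel. norm (norm (f x) * norm (g x)) \<le> norm (norm (f x) ^ 2 + norm (g x) ^ 2)"
    by simp
  show "(\<lambda>x. norm (f x) * norm (g x)) \<in> borel_measurable lborel" by measurable
qed

text \<open>The integral of (|f| - t |g|)^2 is nonnegative for every real t, and t = I / ||g||^2 is
  the optimal choice. If ||g|| = 0, a bound linear in t remains, which forces I = 0.\<close>

lemma L2_Cauchy_Schwarz_norm:
  fixes f :: "real ^ 3 \<Rightarrow> 'b::{real_normed_vector, second_countable_topology}"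
    and g :: "real ^ 3 \<Rightarrow> 'c::{real_normed_vector, second_countable_topology}"
  assumes f: "f \<in> L2" and g: "g \<in> L2"
  shows "(LINT x|lborel. norm (f x) * norm (g x)) \<le> L2_norm f * L2_norm g"
proof -
  define I where "I = (LINT x|lborel. norm (f x) * norm (g x))"
  have I: "2 * I * t \<le> L2_norm f ^ 2 + t ^ 2 * L2_norm g ^ 2" for t
  proof -
    have "(LINT x|lborel. 2 * t * (norm (f x) * norm (g x)))
      \<le> (LINT x|lborel. norm (f x) ^ 2 + t ^ 2 * norm (g x) ^ 2)"
      using L2_integrable_norm[OF f] L2_integrable_norm[OF g] L2_integrable_norm_mult[OF f g]
    proof (intro integral_mono)
      show "2 * t * (norm (f x) * norm (g x)) \<le> norm (f x) ^ 2 + t ^ 2 * norm (g x) ^ 2" for x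
        using sum_squares_bound[of "norm (f x)" "t * norm (g x)"]
        by (simp add: power_mult_distrib algebra_simps)
    qed auto
    then show ?thesis
      using L2_integrable_norm[OF f] L2_integrable_norm[OF g] L2_integrable_norm_mult[OF f g]
      by (simp add: I_def L2_norm_square algebra_simps)
  qed
  have I0: "0 \<le> I" unfolding I_def by (intro integral_nonneg_AE) auto
  have "I \<le> L2_norm f * L2_norm g"
  proof (cases "L2_norm g = 0")
    case True
    have "I = 0"
    proof (rule ccontr)
      assume "I \<noteq> 0"
      then have "2 * I * ((L2_norm f ^ 2 + 1) / (2 * I)) = L2_norm f ^ 2 + 1" by (simp add: field_simps)
      with I[of "(L2_norm f ^ 2 + 1) / (2 * I)"] True show False by simp
    qed
    with True show ?thesis by simp
  next
    case False
    have "2 * I * (I / L2_norm g ^ 2) \<le> L2_norm f ^ 2 + (I / L2_norm g ^ 2) ^ 2 * L2_norm g ^ 2"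
      by (rule I)
    also have "2 * I * (I / L2_norm g ^ 2) = 2 * (I ^ 2 / L2_norm g ^ 2)"
      by (simp add: power2_eq_square)
    also have "(I / L2_norm g ^ 2) ^ 2 * L2_norm g ^ 2 = I ^ 2 / L2_norm g ^ 2"
      using False by (simp add: power_divide power2_eq_square)
    finally have "I ^ 2 / L2_norm g ^ 2 \<le> L2_norm f ^ 2" by simp
    then have "I ^ 2 \<le> L2_norm f ^ 2 * L2_norm g ^ 2"
      using False by (simp add: divide_le_eq)
    then show ?thesis
      by (metis I0 L2_norm_nonneg mult_nonneg_nonneg power2_le_imp_le power_mult_distrib)
  qed
  then show ?thesis by (simp add: I_def)
qed

lemma L2_norm_triangle:
  fixes f g :: "real ^ 3 \<Rightarrow> 'b::{real_normed_vector, second_countable_topology}"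
  assumes f: "f \<in> L2" and g: "g \<in> L2"
  shows "L2_norm (\<lambda>x. f x + g x) \<le> L2_norm f + L2_norm g"
proof (rule power2_le_imp_le)
  have "L2_norm (\<lambda>x. f x + g x) ^ 2 \<le> (LINT x|lborel. norm (f x) ^ 2 + 2 * (norm (f x) * norm (g x)) + norm (g x) ^ 2)"
    unfolding L2_norm_square
  proof (intro integral_mono)
    show "norm (f x + g x) ^ 2 \<le> norm (f x) ^ 2 + 2 * (norm (f x) * norm (g x)) + norm (g x) ^ 2" for x
      using power_mono[OF norm_triangle_ineq[of "f x" "g x"], of 2] by (simp add: power2_sum algebra_simps)
  qed (use L2_integrable_norm[OF f] L2_integrable_norm[OF g] L2_integrable_norm_mult[OF f g] L2_integrable_norm[OF L2_add[OF f g]] in auto)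
  also have "\<dots> \<le> L2_norm f ^ 2 + 2 * (L2_norm f * L2_norm g) + L2_norm g ^ 2"
    using L2_integrable_norm[OF f] L2_integrable_norm[OF g] L2_integrable_norm_mult[OF f g]
      L2_Cauchy_Schwarz_norm[OF f g] by (simp add: L2_norm_square)
  finally show "L2_norm (\<lambda>x. f x + g x) ^ 2 \<le> (L2_norm f + L2_norm g) ^ 2"
    by (simp add: power2_sum algebra_simps)
qed auto

lemma L2_norm_triangle_diff:
  fixes f g h :: "real ^ 3 \<Rightarrow> 'b::{real_normed_vector, second_countable_topology}"
  assumes "f \<in> L2" "g \<in> L2" "h \<in> L2"
  shows "L2_dist f h \<le> L2_dist f g + L2_dist g h"
  using L2_norm_triangle[of "\<lambda>x. f x - g x" "\<lambda>x. g x - h x"] assms by (simp add: L2_diff)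

lemma L2_norm_diff_le:
  fixes f g :: "real ^ 3 \<Rightarrow> 'b::{real_normed_vector, second_countable_topology}"
  assumes "f \<in> L2" "g \<in> L2"
  shows "\<bar>L2_norm f - L2_norm g\<bar> \<le> L2_dist f g"
  using L2_norm_triangle[of "\<lambda>x. f x - g x" g] L2_norm_triangle[of "\<lambda>x. g x - f x" f] assms
    L2_norm_minus_commute[of f g]
  by (simp add: L2_diff)

lemma L2_norm_diff_triangle:
  fixes f g :: "real ^ 3 \<Rightarrow> 'b::{real_normed_vector, second_countable_topology}"
  assumes "f \<in> L2" "g \<in> L2"
  shows "L2_dist f g \<le> L2_norm f + L2_norm g"
proof -
  have "L2_norm (\<lambda>x. - g x) = L2_norm g" by (intro L2_norm_cong) simp
  then show ?thesis using L2_norm_triangle[OF assms(1) L2_uminus[OF assms(2)]] by simp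
qed

lemma L2_integrable_mult:
  fixes f g :: "real ^ 3 \<Rightarrow> complex"
  assumes "f \<in> L2" "g \<in> L2"
  shows "integrable lborel (\<lambda>x. f x * g x)"
  by (rule Bochner_Integration.integrable_bound[OF L2_integrable_norm_mult[OF assms]])
     (use assms in \<open>auto simp: norm_mult dest!: L2_measurable\<close>)

lemma L2_integrable_inner:
  assumes "f \<in> L2" "g \<in> L2"
  shows "integrable lborel (\<lambda>x. f x * cnj (g x))"
  using L2_integrable_mult[OF assms(1) L2_cnj[OF assms(2)]] .

lemma L2_Cauchy_Schwarz:
  assumes "f \<in> L2" "g \<in> L2"
  shows "norm (L2_inner f g) \<le> L2_norm f * L2_norm g"
proof -
  have "norm (L2_inner f g) \<le> (LINT x|lborel. norm (f x * cnj (g x)))"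
    unfolding L2_inner_def by (rule integral_norm_bound)
  also have "\<dots> \<le> L2_norm f * L2_norm g"
    using L2_Cauchy_Schwarz_norm[OF assms] by (simp add: norm_mult)
  finally show ?thesis .
qed

lemma L2_inner_add_left:
  "f \<in> L2 \<Longrightarrow> g \<in> L2 \<Longrightarrow> h \<in> L2 \<Longrightarrow> L2_inner (\<lambda>x. f x + g x) h = L2_inner f h + L2_inner g h"
  by (simp add: L2_inner_def distrib_right L2_integrable_inner)

lemma L2_inner_add_right:
  "f \<in> L2 \<Longrightarrow> g \<in> L2 \<Longrightarrow> h \<in> L2 \<Longrightarrow> L2_inner h (\<lambda>x. f x + g x) = L2_inner h f + L2_inner h g"
  by (simp add: L2_inner_def distrib_left L2_integrable_inner)

lemma L2_inner_diff_left:
  "f \<in> L2 \<Longrightarrow> g \<in> L2 \<Longrightarrow> h \<in> L2 \<Longrightarrow> L2_inner (\<lambda>x. f x - g x) h = L2_inner f h - L2_inner g h"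
  by (simp add: L2_inner_def left_diff_distrib L2_integrable_inner)

lemma L2_inner_diff_right:
  "f \<in> L2 \<Longrightarrow> g \<in> L2 \<Longrightarrow> h \<in> L2 \<Longrightarrow> L2_inner h (\<lambda>x. f x - g x) = L2_inner h f - L2_inner h g"
  by (simp add: L2_inner_def right_diff_distrib L2_integrable_inner)

lemma L2_inner_cmult_left: "L2_inner (\<lambda>x. c * f x) g = c * L2_inner f g"
  by (simp add: L2_inner_def mult.assoc)

lemma L2_inner_cmult_right: "L2_inner f (\<lambda>x. c * g x) = cnj c * L2_inner f g"
  by (simp add: L2_inner_def mult.left_commute)

lemma L2_inner_commute: "L2_inner g f = cnj (L2_inner f g)"
proof -
  have "cnj (L2_inner f g) = (LINT x|lborel. cnj (f x * cnj (g x)))"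
    unfolding L2_inner_def by (rule Bochner_Integration.integral_cnj[symmetric])
  then show ?thesis by (simp add: L2_inner_def mult.commute)
qed

lemma L2_inner_self: "L2_inner f f = of_real (L2_norm f ^ 2)"
proof -
  have "L2_inner f f = (LINT x|lborel. complex_of_real (norm (f x) ^ 2))"
    by (simp add: L2_inner_def complex_norm_square del: of_real_power)
  then show ?thesis by (simp only: L2_norm_square integral_complex_of_real)
qed

lemma L2_inner_cong_AE:
  assumes [measurable]: "f \<in> borel_measurable borel" "f' \<in> borel_measurable borel"
    "g \<in> borel_measurable borel" "g' \<in> borel_measurable borel"
  assumes "AE x in lborel. f x = f' x" "AE x in lborel. g x = g' x"
  shows "L2_inner f g = L2_inner f' g'"
  unfolding L2_inner_def
  by (rule integral_cong_AE) (use assms(5,6) in auto)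

lemma L2_norm_square_diff:
  assumes "f \<in> L2" "g \<in> L2"
  shows "L2_dist f g ^ 2 = L2_norm f ^ 2 + L2_norm g ^ 2 - 2 * Re (L2_inner f g)"
proof -
  have "complex_of_real (L2_dist f g ^ 2) =
      L2_inner f f - L2_inner f g - L2_inner g f + L2_inner g g"
    unfolding L2_inner_self[symmetric] using assms by (simp add: L2_inner_diff_left L2_inner_diff_right L2_diff)
  also have "Re \<dots> = L2_norm f ^ 2 + L2_norm g ^ 2 - 2 * Re (L2_inner f g)"
    unfolding L2_inner_self L2_inner_commute[of g f] by simp
  finally show ?thesis by simp
qed

lemma L2_norm_square_add:
  assumes "f \<in> L2" "g \<in> L2"
  shows "L2_norm (\<lambda>x. f x + g x) ^ 2 = L2_norm f ^ 2 + L2_norm g ^ 2 + 2 * Re (L2_inner f g)"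
proof -
  have "complex_of_real (L2_norm (\<lambda>x. f x + g x) ^ 2) =
      L2_inner f f + L2_inner f g + L2_inner g f + L2_inner g g"
    unfolding L2_inner_self[symmetric] using assms by (simp add: L2_inner_add_left L2_inner_add_right L2_add)
  also have "Re \<dots> = L2_norm f ^ 2 + L2_norm g ^ 2 + 2 * Re (L2_inner f g)"
    unfolding L2_inner_self L2_inner_commute[of g f] by simp
  finally show ?thesis by simp
qed

lemma L2_norm_tendsto_0_dominated:
  fixes f :: "nat \<Rightarrow> real ^ 3 \<Rightarrow> 'b::{real_normed_vector, second_countable_topology}"
    and g :: "real ^ 3 \<Rightarrow> 'c::{real_normed_vector, second_countable_topology}"
  assumes [measurable]: "\<And>n. f n \<in> borel_measurable borel" and g: "g \<in> L2"
    and lim: "AE x in lborel. (\<lambda>n. f n x) \<longlonglongrightarrow> 0"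
    and dom: "\<And>n x. norm (f n x) \<le> c * norm (g x)"
  shows "(\<lambda>n. L2_norm (f n)) \<longlonglongrightarrow> 0"
proof -
  have "(\<lambda>n. LINT x|lborel. norm (f n x) ^ 2) \<longlonglongrightarrow> (LINT x|(lborel :: (real ^ 3) measure). 0)"
  proof (rule integral_dominated_convergence)
    show "integrable lborel (\<lambda>x. c ^ 2 * norm (g x) ^ 2)"
      using L2_integrable_norm[OF g] by simp
    show "AE x in lborel. (\<lambda>n. norm (f n x) ^ 2) \<longlonglongrightarrow> 0"
      using lim
    proof eventually_elim
      fix x assume "(\<lambda>n. f n x) \<longlonglongrightarrow> 0"
      then show "(\<lambda>n. norm (f n x) ^ 2) \<longlonglongrightarrow> 0"
        by (auto intro!: tendsto_eq_intros)
    qed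
    have "norm (f n x) ^ 2 \<le> (c * norm (g x)) ^ 2" for n x
      using dom by (intro power_mono) auto
    then show "AE x in lborel. norm (norm (f n x) ^ 2) \<le> c ^ 2 * norm (g x) ^ 2" for n
      by (simp add: power_mult_distrib)
  qed auto
  from tendsto_real_sqrt[OF this] show ?thesis
    by (simp add: L2_norm_def)
qed

section \<open>Test functions\<close>

text \<open>The family \<open>D\<close> demanded by \<open>smooth_fun\<close> arises by choosing
  partial derivatives inside S once and for all and folding that choice along the multi-index.
  Smoothness proofs thus reduce to finding a class of functions closed under first partial
  derivatives.\<close>

lemma smooth_fun_coinduct:
  assumes "f \<in> S"
    and "\<And>g. g \<in> S \<Longrightarrow> \<exists>d. (\<forall>j. d j \<in> S) \<and>
           (\<forall>x. (g has_derivative (\<lambda>h. \<Sum>j\<in>UNIV. h $ j *\<^sub>R d j x)) (at x))"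
  shows "smooth_fun f"
proof -
  obtain d where d: "\<And>g j. g \<in> S \<Longrightarrow> d g j \<in> S"
    "\<And>g x. g \<in> S \<Longrightarrow> (g has_derivative (\<lambda>h. \<Sum>j\<in>UNIV. h $ j *\<^sub>R d g j x)) (at x)"
    using bchoice[of S "\<lambda>g d. (\<forall>j. d j \<in> S) \<and>
      (\<forall>x. (g has_derivative (\<lambda>h. \<Sum>j\<in>UNIV. h $ j *\<^sub>R d j x)) (at x))"] assms(2) by blast
  have S: "foldr (\<lambda>j g. d g j) \<alpha> f \<in> S" for \<alpha>
    by (induction \<alpha>) (use assms(1) d in auto)
  show ?thesis
    unfolding smooth_fun_def
    by (rule exI[of _ "\<lambda>\<alpha>. foldr (\<lambda>j g. d g j) \<alpha> f"]) (use d(2)[OF S] in auto)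
qed

lemma smooth_fun_derivative:
  assumes "smooth_fun f"
  obtains d where "\<And>j. smooth_fun (d j)"
    "\<And>x. (f has_derivative (\<lambda>h. \<Sum>j\<in>UNIV. h $ j *\<^sub>R d j x)) (at x)"
proof -
  obtain D where D: "D [] = f"
    "\<And>\<alpha> x. (D \<alpha> has_derivative (\<lambda>h. \<Sum>j\<in>UNIV. h $ j *\<^sub>R D (j # \<alpha>) x)) (at x)"
    using assms unfolding smooth_fun_def by blast
  \<comment> \<open>A list carries the latest derivative at its head, so the derivative taken first
    has to be appended at the end.\<close>
  have "smooth_fun (D [j])" for j
    unfolding smooth_fun_def
    by (rule exI[of _ "\<lambda>\<alpha>. D (\<alpha> @ [j])"]) (use D(2) in auto)
  then show thesis
    using that[of "\<lambda>j. D [j]"] D(2)[of "[]"] by (simp add: D(1))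
qed

lemma has_derivative_partials_unique:
  assumes "(f has_derivative (\<lambda>h. \<Sum>j\<in>UNIV. h $ j *\<^sub>R d j)) (at x)"
  shows "partial j f x = d j"
proof -
  have "partial j f x = (\<Sum>k\<in>UNIV. axis j (1::real) $ k *\<^sub>R d k)"
    unfolding partial_def by (subst frechet_derivative_at[OF assms, symmetric]) simp
  also have "\<dots> = d j"
    by (simp add: axis_def if_distrib[of "\<lambda>c. c *\<^sub>R _"] cong: if_cong)
  finally show ?thesis .
qed

lemma
  assumes "smooth_fun f"
  shows smooth_fun_partial: "smooth_fun (partial j f)"
    and smooth_fun_has_derivative:
      "(f has_derivative (\<lambda>h. \<Sum>j\<in>UNIV. h $ j *\<^sub>R partial j f x)) (at x)"
proof -
  obtain d where d: "\<And>j. smooth_fun (d j)"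
    "\<And>x. (f has_derivative (\<lambda>h. \<Sum>j\<in>UNIV. h $ j *\<^sub>R d j x)) (at x)"
    by (rule smooth_fun_derivative[OF assms]) blast
  have "partial j f = d j" for j
    using has_derivative_partials_unique[OF d(2)] by auto
  then show "smooth_fun (partial j f)"
    "(f has_derivative (\<lambda>h. \<Sum>j\<in>UNIV. h $ j *\<^sub>R partial j f x)) (at x)"
    using d by auto
qed

lemma smooth_fun_continuous: "smooth_fun f \<Longrightarrow> continuous_on UNIV f"
  using has_derivative_continuous[OF smooth_fun_has_derivative]
  by (auto simp: continuous_on_eq_continuous_at)

lemma smooth_fun_mult_has_derivative:
  assumes "smooth_fun f" "smooth_fun g"
  shows "((\<lambda>x. f x * g x) has_derivative
    (\<lambda>h. \<Sum>j\<in>UNIV. h $ j *\<^sub>R (f x * partial j g x + partial j f x * g x))) (at x)"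
proof -
  have eq: "(\<lambda>h. f x * (\<Sum>j\<in>UNIV. h $ j *\<^sub>R partial j g x) + (\<Sum>j\<in>UNIV. h $ j *\<^sub>R partial j f x) * g x) =
    (\<lambda>h. \<Sum>j\<in>UNIV. h $ j *\<^sub>R (f x * partial j g x + partial j f x * g x))"
    by (simp add: sum_distrib_left sum_distrib_right sum.distrib[symmetric] scaleR_add_right)
  show ?thesis
    using has_derivative_mult[OF smooth_fun_has_derivative[OF assms(1), of x]
        smooth_fun_has_derivative[OF assms(2), of x]] unfolding eq .
qed

lemma cis_has_derivative:
  "((\<lambda>x. c * cis (\<xi> \<bullet> x)) has_derivative
    (\<lambda>h. \<Sum>j\<in>UNIV. h $ j *\<^sub>R (\<i> * of_real (\<xi> $ j) * c * cis (\<xi> \<bullet> x)))) (at x)"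
proof -
  have "((\<lambda>x. c * cis (\<xi> \<bullet> x)) has_derivative (\<lambda>h. c * ((\<xi> \<bullet> h) *\<^sub>R (\<i> * cis (\<xi> \<bullet> x))))) (at x)"
    by (rule has_derivative_mult_right)
       (auto intro!: derivative_eq_intros simp: fun_eq_iff)
  also have "(\<lambda>h. c * ((\<xi> \<bullet> h) *\<^sub>R (\<i> * cis (\<xi> \<bullet> x)))) =
    (\<lambda>h. \<Sum>j\<in>UNIV. h $ j *\<^sub>R (\<i> * of_real (\<xi> $ j) * c * cis (\<xi> \<bullet> x)))"
    by (simp add: inner_vec_def scaleR_conv_of_real sum_distrib_left sum_distrib_right fun_eq_iff mult_ac)
  finally show ?thesis .
qed

lemma smooth_fun_shift_has_derivative:
  assumes "smooth_fun f"
  shows "((\<lambda>x. f (x + a)) has_derivative (\<lambda>h. \<Sum>j\<in>UNIV. h $ j *\<^sub>R partial j f (x + a))) (at x)"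
  by (rule has_derivative_compose[of "\<lambda>x. x + a" "\<lambda>x. x" x UNIV f, OF _ smooth_fun_has_derivative[OF assms]])
     (auto intro!: derivative_eq_intros)

lemma smooth_fun_cnj_has_derivative:
  assumes "smooth_fun f"
  shows "((\<lambda>x. cnj (f x)) has_derivative (\<lambda>h. \<Sum>j\<in>UNIV. h $ j *\<^sub>R cnj (partial j f x))) (at x)"
  using bounded_linear.has_derivative[OF bounded_linear_cnj smooth_fun_has_derivative[OF assms], of x] by simp

text \<open>Sums of products rather than products: the set has to be closed under partial derivatives.\<close>

inductive_set product_sums :: "(real ^ 3 \<Rightarrow> complex) set" where
  mult: "smooth_fun f \<Longrightarrow> smooth_fun g \<Longrightarrow> (\<lambda>x. f x * g x) \<in> product_sums"
| add: "f \<in> product_sums \<Longrightarrow> g \<in> product_sums \<Longrightarrow> (\<lambda>x. f x + g x) \<in> product_sums"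

lemma product_sums_smooth:
  assumes "f \<in> product_sums" shows "smooth_fun f"
proof (rule smooth_fun_coinduct[OF assms])
  fix g :: "real ^ 3 \<Rightarrow> complex" assume "g \<in> product_sums"
  then show "\<exists>d. (\<forall>j. d j \<in> product_sums) \<and>
           (\<forall>x. (g has_derivative (\<lambda>h. \<Sum>j\<in>UNIV. h $ j *\<^sub>R d j x)) (at x))"
  proof induction
    case (mult f g)
    note smooth_fun_mult_has_derivative[OF mult]
    moreover have "(\<lambda>x. f x * partial j g x + partial j f x * g x) \<in> product_sums" for j
      using mult by (intro product_sums.intros smooth_fun_partial)
    ultimately show ?case by (intro exI[of _ "\<lambda>j x. f x * partial j g x + partial j f x * g x"]) auto
  next
    case (add f g)
    obtain d1 where d1: "\<And>j. d1 j \<in> product_sums"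
      "\<And>x. (f has_derivative (\<lambda>h. \<Sum>j\<in>UNIV. h $ j *\<^sub>R d1 j x)) (at x)"
      using add.IH(1) by blast
    obtain d2 where d2: "\<And>j. d2 j \<in> product_sums"
      "\<And>x. (g has_derivative (\<lambda>h. \<Sum>j\<in>UNIV. h $ j *\<^sub>R d2 j x)) (at x)"
      using add.IH(2) by blast
    have "((\<lambda>x. f x + g x) has_derivative (\<lambda>h. \<Sum>j\<in>UNIV. h $ j *\<^sub>R (d1 j x + d2 j x))) (at x)" for x
      using has_derivative_add[OF d1(2)[of x] d2(2)[of x]]
      by (simp add: sum.distrib[symmetric] scaleR_add_right)
    moreover have "(\<lambda>x. d1 j x + d2 j x) \<in> product_sums" for j
      using d1 d2 by (intro product_sums.intros)
    ultimately show ?case by (intro exI[of _ "\<lambda>j x. d1 j x + d2 j x"]) auto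
  qed
qed

lemma smooth_fun_mult: "smooth_fun f \<Longrightarrow> smooth_fun g \<Longrightarrow> smooth_fun (\<lambda>x. f x * g x)"
  by (rule product_sums_smooth[OF product_sums.mult])

text \<open>The amplitude ranges over all constants because each partial derivative multiplies it by
  i \<xi>_j and leaves the exponential unchanged.\<close>

lemma smooth_fun_cis: "smooth_fun (\<lambda>x. c * cis (\<xi> \<bullet> x))"
proof (rule smooth_fun_coinduct[of _ "{\<lambda>x. c * cis (\<xi> \<bullet> x) | c. True}"])
  fix g assume "g \<in> {\<lambda>x. c * cis (\<xi> \<bullet> x) | c. True}"
  then obtain c where g: "g = (\<lambda>x. c * cis (\<xi> \<bullet> x))" by auto
  note cis_has_derivative[of c \<xi>, folded g]
  then show "\<exists>d. (\<forall>j. d j \<in> {\<lambda>x. c * cis (\<xi> \<bullet> x) | c. True}) \<and>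
           (\<forall>x. (g has_derivative (\<lambda>h. \<Sum>j\<in>UNIV. h $ j *\<^sub>R d j x)) (at x))"
    by (intro exI[of _ "\<lambda>j x. \<i> * of_real (\<xi> $ j) * c * cis (\<xi> \<bullet> x)"]) auto
qed auto

lemma smooth_fun_const: "smooth_fun (\<lambda>x. c)"
  using smooth_fun_cis[of c 0] by simp

lemma smooth_fun_add:
  assumes "smooth_fun f" "smooth_fun g" shows "smooth_fun (\<lambda>x. f x + g x)"
  using product_sums_smooth[OF product_sums.add[OF product_sums.mult[OF assms(1) smooth_fun_const[of 1]]
      product_sums.mult[OF assms(2) smooth_fun_const[of 1]]]] by simp

lemma smooth_fun_shift:
  assumes "smooth_fun f" shows "smooth_fun (\<lambda>x. f (x + a))"
proof (rule smooth_fun_coinduct[of _ "{\<lambda>x. f (x + a) | f. smooth_fun f}"])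
  fix g assume "g \<in> {\<lambda>x. f (x + a) | f. smooth_fun f}"
  then obtain f where g: "g = (\<lambda>x. f (x + a))" and f: "smooth_fun f" by auto
  note smooth_fun_shift_has_derivative[OF f, of a, folded g]
  then show "\<exists>d. (\<forall>j. d j \<in> {\<lambda>x. f (x + a) | f. smooth_fun f}) \<and>
           (\<forall>x. (g has_derivative (\<lambda>h. \<Sum>j\<in>UNIV. h $ j *\<^sub>R d j x)) (at x))"
    using smooth_fun_partial[OF f] by (intro exI[of _ "\<lambda>j x. partial j f (x + a)"]) auto
qed (use assms in auto)

lemma smooth_fun_cnj:
  assumes "smooth_fun f" shows "smooth_fun (\<lambda>x. cnj (f x))"
proof (rule smooth_fun_coinduct[of _ "{\<lambda>x. cnj (f x) | f. smooth_fun f}"])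
  fix g assume "g \<in> {\<lambda>x. cnj (f x) | f. smooth_fun f}"
  then obtain f where g: "g = (\<lambda>x. cnj (f x))" and f: "smooth_fun f" by auto
  note smooth_fun_cnj_has_derivative[OF f, folded g]
  then show "\<exists>d. (\<forall>j. d j \<in> {\<lambda>x. cnj (f x) | f. smooth_fun f}) \<and>
           (\<forall>x. (g has_derivative (\<lambda>h. \<Sum>j\<in>UNIV. h $ j *\<^sub>R d j x)) (at x))"
    using smooth_fun_partial[OF f] by (intro exI[of _ "\<lambda>j x. cnj (partial j f x)"]) auto
qed (use assms in auto)

lemma smooth_fun_prod:
  "finite I \<Longrightarrow> (\<And>i. i \<in> I \<Longrightarrow> smooth_fun (f i)) \<Longrightarrow> smooth_fun (\<lambda>x. \<Prod>i\<in>I. f i x)"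
  by (induction I rule: finite_induct) (auto intro: smooth_fun_const smooth_fun_mult)

section \<open>Flat functions and smooth approximations of boxes\<close>

text \<open>The classical function exp (- 1 / t), extended by 0, with a polynomial factor in 1 / t.
  The factor makes the family closed under differentiation.\<close>

definition flat_exp :: "real poly \<Rightarrow> real \<Rightarrow> real" where
  "flat_exp p t = (if 0 < t then poly p (1 / t) * exp (- (1 / t)) else 0)"

lemma poly_exp_tendsto_0: "((\<lambda>y::real. poly p y * exp (- y)) \<longlongrightarrow> 0) at_top"
proof -
  have "((\<lambda>y. \<Sum>i\<le>degree p. coeff p i * (y ^ i / exp y)) \<longlongrightarrow> (\<Sum>i\<le>degree p. coeff p i * 0)) at_top"
    by (intro tendsto_sum tendsto_mult tendsto_const tendsto_power_div_exp_0)
  then show ?thesis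
    by (simp add: poly_altdef exp_minus divide_inverse sum_distrib_right mult.assoc)
qed

lemma flat_exp_tendsto_0: "(flat_exp p \<longlongrightarrow> 0) (at 0)"
proof -
  have "((\<lambda>t. poly p (1 / t) * exp (- (1 / t))) \<longlongrightarrow> 0) (at_right 0)"
    using filterlim_compose[OF poly_exp_tendsto_0 filterlim_inverse_at_top_right]
    by (simp add: inverse_eq_divide)
  then have "(flat_exp p \<longlongrightarrow> 0) (at_right 0)"
    by (rule Lim_transform_eventually) (auto simp: flat_exp_def eventually_at_right_field intro!: exI[of _ 1])
  moreover have "(flat_exp p \<longlongrightarrow> 0) (at_left 0)"
    by (rule Lim_transform_eventually[OF tendsto_const])
       (auto simp: flat_exp_def eventually_at_left_field intro!: exI[of _ "-1"])
  ultimately show ?thesis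
    by (simp add: filterlim_split_at)
qed

text \<open>For t > 0 the product rule gives (p - p') (1 / t) exp (- 1 / t) / t^2, hence the
  polynomial y^2 (p - p') in y = 1 / t. At t = 0 the difference quotient is itself flat, with
  polynomial y p(y), and tends to 0.\<close>

lemma flat_exp_has_derivative:
  "(flat_exp p has_real_derivative flat_exp (monom 1 2 * (p - pderiv p)) t) (at t)"
proof -
  consider "t < 0" | "t = 0" | "0 < t" by linarith
  then show ?thesis
  proof cases
    assume t: "t < 0"
    have ev: "\<forall>\<^sub>F x in nhds t. flat_exp p x = 0"
      by (rule eventually_mono[OF eventually_nhds_in_open[of "{..<0}" t]]) (use t in \<open>auto simp: flat_exp_def\<close>)
    have "((\<lambda>x. 0) has_real_derivative 0) (at t)" by simp
    then show ?thesis
      using t ev by (simp add: flat_exp_def DERIV_cong_ev[OF refl ev refl])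
  next
    assume t: "0 < t"
    have ev: "\<forall>\<^sub>F x in nhds t. flat_exp p x = poly p (1 / x) * exp (- (1 / x))"
      by (intro eventually_mono[OF eventually_nhds_in_open[of "{0<..}" t]]) (use t in \<open>auto simp: flat_exp_def\<close>)
    have "((\<lambda>x. poly p (1 / x) * exp (- (1 / x))) has_real_derivative
        flat_exp (monom 1 2 * (p - pderiv p)) t) (at t)"
      using t
      by (auto intro!: derivative_eq_intros DERIV_chain2[OF poly_DERIV]
          simp: flat_exp_def poly_monom field_simps power2_eq_square)
    then show ?thesis
      by (simp add: DERIV_cong_ev[OF refl ev refl])
  next
    assume [simp]: "t = 0"
    have "((\<lambda>h. flat_exp p h / h) \<longlongrightarrow> 0) (at 0)"
    proof (rule Lim_transform_eventually[OF flat_exp_tendsto_0[of "pCons 0 p"]])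
      show "\<forall>\<^sub>F h in at 0. flat_exp (pCons 0 p) h = flat_exp p h / h"
        by (auto simp: flat_exp_def eventually_at_filter)
    qed
    then show ?thesis
      by (simp add: DERIV_def flat_exp_def)
  qed
qed

text \<open>The scalar k absorbs the chain rule factor s and, as k = 0, the partial derivatives in
  the other coordinate directions.\<close>

lemma smooth_fun_flat_exp: "smooth_fun (\<lambda>x. complex_of_real (k * flat_exp p (c + s * x $ i)))"
proof (rule smooth_fun_coinduct[of _ "{\<lambda>x. complex_of_real (k * flat_exp p (c + s * x $ i)) | k p. True}"])
  fix g :: "real ^ 3 \<Rightarrow> complex" assume "g \<in> {\<lambda>x. complex_of_real (k * flat_exp p (c + s * x $ i)) | k p. True}"
  then obtain k p where g: "g = (\<lambda>x. complex_of_real (k * flat_exp p (c + s * x $ i)))" by auto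
  define q where "q = monom 1 2 * (p - pderiv p)"
  define d where "d = (\<lambda>j (x :: real ^ 3). complex_of_real ((if j = i then k * s else 0) * flat_exp q (c + s * x $ i)))"
  have "(g has_derivative (\<lambda>h. \<Sum>j\<in>UNIV. h $ j *\<^sub>R d j x)) (at x)" for x
  proof -
    have "((\<lambda>x. k * flat_exp p (c + s * x $ i)) has_derivative
       (\<lambda>h. h $ i * (k * s * flat_exp q (c + s * x $ i)))) (at x)"
      by (auto intro!: derivative_eq_intros
          has_derivative_compose[of "\<lambda>x. c + s * x $ i" _ x UNIV "flat_exp p", OF _ flat_exp_has_derivative[unfolded has_field_derivative_def]]
          bounded_linear.has_derivative[OF bounded_linear_vec_nth]
          simp: q_def mult_ac)
    moreover have "(\<Sum>j\<in>UNIV. h $ j *\<^sub>R d j x) = of_real (h $ i * (k * s * flat_exp q (c + s * x $ i)))" for h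
    proof -
      have "(\<Sum>j\<in>UNIV. h $ j *\<^sub>R d j x) = (\<Sum>j\<in>UNIV. if j = i then h $ i *\<^sub>R d i x else 0)"
        by (intro sum.cong) (auto simp: d_def)
      then show ?thesis by (simp add: d_def scaleR_conv_of_real)
    qed
    ultimately show ?thesis
      unfolding g by (simp only: has_derivative_of_real)
  qed
  moreover have "\<forall>j. d j \<in> {\<lambda>x. complex_of_real (k * flat_exp p (c + s * x $ i)) | k p. True}"
    unfolding d_def by blast
  ultimately show "\<exists>d. (\<forall>j. d j \<in> {\<lambda>x. complex_of_real (k * flat_exp p (c + s * x $ i)) | k p. True}) \<and>
           (\<forall>x. (g has_derivative (\<lambda>h. \<Sum>j\<in>UNIV. h $ j *\<^sub>R d j x)) (at x))"
    by blast
qed auto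

lemma test_functionI:
  assumes "smooth_fun f" "compact K" "\<And>x. x \<notin> K \<Longrightarrow> f x = 0"
  shows "test_function f"
proof -
  have "closure {x. f x \<noteq> 0} \<subseteq> K"
    using assms(3) by (intro closure_minimal compact_imp_closed assms) auto
  then have "compact (closure {x. f x \<noteq> 0})"
    using compact_Int_closed[OF assms(2), of "closure {x. f x \<noteq> 0}"] by (simp add: Int_absorb1)
  with assms(1) show ?thesis by (simp add: test_function_def)
qed

lemma test_function_support:
  assumes "test_function f"
  shows "\<exists>K. compact K \<and> (\<forall>x. x \<notin> K \<longrightarrow> f x = 0)"
proof (intro exI conjI allI impI)
  show "compact (closure {x. f x \<noteq> 0})" using assms by (simp add: test_function_def)
  show "f x = 0" if "x \<notin> closure {x. f x \<noteq> 0}" for x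
    using that closure_subset[of "{x. f x \<noteq> 0}"] by blast
qed

lemma test_function_smooth: "test_function f \<Longrightarrow> smooth_fun f"
  by (simp add: test_function_def)

lemma test_function_mult:
  assumes "smooth_fun f" "test_function g" shows "test_function (\<lambda>x. f x * g x)"
proof -
  obtain K where K: "compact K" "\<forall>x. x \<notin> K \<longrightarrow> g x = 0" using test_function_support[OF assms(2)] by blast
  show ?thesis
    by (rule test_functionI[of _ K]) (use K in \<open>auto intro!: smooth_fun_mult assms test_function_smooth[OF assms(2)]\<close>)
qed

lemma test_function_add:
  assumes "test_function f" "test_function g" shows "test_function (\<lambda>x. f x + g x)"
proof -
  obtain K where K: "compact K" "\<forall>x. x \<notin> K \<longrightarrow> f x = 0" using test_function_support[OF assms(1)] by blast
  obtain L where L: "compact L" "\<forall>x. x \<notin> L \<longrightarrow> g x = 0" using test_function_support[OF assms(2)] by blast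
  show ?thesis
    by (rule test_functionI[of _ "K \<union> L"])
       (use K L in \<open>auto intro!: smooth_fun_add assms[THEN test_function_smooth]\<close>)
qed

lemma test_function_cmult: "test_function f \<Longrightarrow> test_function (\<lambda>x. c * f x)"
  by (intro test_function_mult smooth_fun_const)

lemma test_function_shift:
  assumes "test_function f" shows "test_function (\<lambda>x. f (x + a))"
proof -
  obtain K where K: "compact K" "\<forall>x. x \<notin> K \<longrightarrow> f x = 0" using test_function_support[OF assms] by blast
  show ?thesis
  proof (rule test_functionI)
    show "smooth_fun (\<lambda>x. f (x + a))" by (rule smooth_fun_shift[OF test_function_smooth[OF assms]])
    show "compact ((\<lambda>y. - a + y) ` K)" using K(1) by (rule compact_translation)
    fix x assume "x \<notin> (\<lambda>y. - a + y) ` K"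
    then have "x + a \<notin> K" by (auto simp: image_iff)
    with K(2) show "f (x + a) = 0" by blast
  qed
qed

lemma test_function_cnj:
  assumes "test_function f" shows "test_function (\<lambda>x. cnj (f x))"
proof -
  obtain K where K: "compact K" "\<forall>x. x \<notin> K \<longrightarrow> f x = 0" using test_function_support[OF assms] by blast
  show ?thesis
    by (rule test_functionI[of _ K]) (use K in \<open>auto intro!: smooth_fun_cnj test_function_smooth[OF assms]\<close>)
qed

lemma test_function_partial:
  assumes "test_function f" shows "test_function (partial j f)"
proof (rule test_functionI)
  show "smooth_fun (partial j f)" using assms by (intro smooth_fun_partial test_function_smooth)
  show "compact (closure {x. f x \<noteq> 0})" using assms by (simp add: test_function_def)
  fix x assume "x \<notin> closure {x. f x \<noteq> 0}"
  then have "\<forall>\<^sub>F y in nhds x. y \<in> - closure {x. f x \<noteq> 0}"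
    by (intro eventually_nhds_in_open) auto
  then have ev: "\<forall>\<^sub>F y in nhds x. 0 = f y"
    by eventually_elim (use closure_subset[of "{x. f x \<noteq> 0}"] in auto)
  have "(f has_derivative (\<lambda>h. \<Sum>j\<in>UNIV. h $ j *\<^sub>R 0)) (at x)"
  proof (rule has_derivative_transform_eventually)
    show "((\<lambda>x. 0) has_derivative (\<lambda>h. \<Sum>j\<in>UNIV. h $ j *\<^sub>R (0 :: complex))) (at x)" by simp
    show "\<forall>\<^sub>F y in at x. 0 = f y"
      using ev by (auto simp: eventually_at_filter elim: eventually_mono)
    show "0 = f x" using eventually_nhds_x_imp_x[OF ev] .
  qed simp
  then show "partial j f x = 0" by (rule has_derivative_partials_unique)
qed

lemma test_function_measurable: "test_function f \<Longrightarrow> f \<in> borel_measurable borel"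
  by (intro borel_measurable_continuous_onI smooth_fun_continuous test_function_smooth)

lemma test_function_bounded:
  assumes "test_function f"
  obtains B where "0 \<le> B" "\<And>x. norm (f x) \<le> B"
proof -
  have "compact (f ` closure {x. f x \<noteq> 0})"
    using assms unfolding test_function_def
    by (intro compact_continuous_image continuous_on_subset[OF smooth_fun_continuous]) auto
  then have "bounded (f ` closure {x. f x \<noteq> 0})" by (rule compact_imp_bounded)
  then obtain B where B: "\<And>x. x \<in> closure {x. f x \<noteq> 0} \<Longrightarrow> norm (f x) \<le> B" "0 < B"
    by (auto simp: bounded_pos)
  have "norm (f x) \<le> B" for x
    using B closure_subset[of "{x. f x \<noteq> 0}"] by (cases "f x = 0") auto
  with B(2) that[of B] show thesis by auto
qed

lemma test_function_ball_bound:
  assumes "test_function f"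
  obtains B R where "0 \<le> B" "\<And>x. norm (f x) \<le> B * indicator (cball 0 R) x"
proof -
  obtain B where B: "0 \<le> B" "\<And>x. norm (f x) \<le> B" using test_function_bounded[OF assms] by metis
  obtain K where K: "compact K" "\<forall>x. x \<notin> K \<longrightarrow> f x = 0" using test_function_support[OF assms] by blast
  obtain R where R: "K \<subseteq> cball 0 R"
    using compact_imp_bounded[OF K(1)] by (auto simp: bounded_pos subset_iff)
  have "norm (f x) \<le> B * indicator (cball 0 R) x" for x
    using B K R by (cases "x \<in> cball 0 R") auto
  with that B show thesis by blast
qed

lemma indicator_L2:
  assumes "A \<in> sets borel" "emeasure lborel A < \<infinity>"
  shows "(\<lambda>x. complex_of_real (indicator A x)) \<in> L2"
proof (rule L2I)
  have "(\<lambda>x. norm (complex_of_real (indicator A x)) ^ 2) = indicator A"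
    by (auto simp: indicator_def fun_eq_iff)
  then show "integrable lborel (\<lambda>x. norm (complex_of_real (indicator A x)) ^ 2)"
    using assms by (simp add: integrable_real_indicator)
qed (use assms in auto)

lemma test_function_L2:
  assumes "test_function f" shows "f \<in> L2"
proof -
  obtain B R where B: "0 \<le> B" "\<And>x. norm (f x) \<le> B * indicator (cball 0 R) x"
    using test_function_ball_bound[OF assms] by metis
  have fin: "emeasure lborel (cball (0 :: real ^ 3) R) < \<infinity>"
    by (intro emeasure_bounded_finite) auto
  show ?thesis
    using test_function_measurable[OF assms] B fin
    by (intro L2_bound[of f "\<lambda>x. complex_of_real (indicator (cball 0 R) x)" B] indicator_L2) auto
qed

text \<open>One factor exp (- 1 / t) per face of the box. Not the height but the argument is scaled
  by n: at distance d from a face exp (- 1 / (n d)) tends to 1, so the limit is the indicator of the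
  open box.\<close>

definition bump :: "real ^ 3 \<Rightarrow> real ^ 3 \<Rightarrow> nat \<Rightarrow> real ^ 3 \<Rightarrow> complex" where
  "bump a b n x = (\<Prod>i\<in>UNIV. of_real (flat_exp 1 (real n * (x $ i - a $ i))) * of_real (flat_exp 1 (real n * (b $ i - x $ i))))"

lemma flat_exp_1_bounds: "0 \<le> flat_exp 1 t" "flat_exp 1 t \<le> 1" "t \<le> 0 \<Longrightarrow> flat_exp 1 t = 0"
  by (auto simp: flat_exp_def)

lemma norm_bump_le: "norm (bump a b n x) \<le> indicator (box a b) x"
proof (cases "x \<in> box a b")
  case True
  have "norm (bump a b n x) \<le> (\<Prod>i\<in>(UNIV::3 set). 1)"
    unfolding bump_def prod_norm[symmetric]
    using flat_exp_1_bounds by (intro prod_mono) (auto simp: norm_mult intro!: mult_le_one)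
  with True show ?thesis by simp
next
  case False
  then obtain i where "\<not> (a $ i < x $ i \<and> x $ i < b $ i)" by (auto simp: mem_box_cart)
  then have "x $ i \<le> a $ i \<or> b $ i \<le> x $ i" by linarith
  then have "flat_exp 1 (real n * (x $ i - a $ i)) = 0 \<or> flat_exp 1 (real n * (b $ i - x $ i)) = 0"
    by (auto intro!: flat_exp_1_bounds(3) simp: mult_le_0_iff)
  then have "bump a b n x = 0" unfolding bump_def by (intro prod_zero) auto
  then show ?thesis by simp
qed

lemma test_function_bump: "test_function (bump a b n)"
proof (rule test_functionI)
  have "smooth_fun (\<lambda>x. of_real (flat_exp 1 (real n * (x $ i - a $ i))) * of_real (flat_exp 1 (real n * (b $ i - x $ i))))" for i
    using smooth_fun_mult[OF smooth_fun_flat_exp[of 1 1 "- real n * a $ i" "real n" i]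
        smooth_fun_flat_exp[of 1 1 "real n * b $ i" "- real n" i]]
    by (simp add: algebra_simps)
  then show "smooth_fun (bump a b n)" unfolding bump_def by (intro smooth_fun_prod) auto
  show "compact (cbox a b)" by simp
  show "bump a b n x = 0" if "x \<notin> cbox a b" for x
    using norm_bump_le[of a b n x] that box_subset_cbox[of a b] by (cases "x \<in> box a b") auto
qed

lemma bump_tendsto: "(\<lambda>n. bump a b n x) \<longlonglongrightarrow> of_real (indicator (box a b) x)"
proof (cases "x \<in> box a b")
  case True
  have lim: "(\<lambda>n. flat_exp 1 (real n * t)) \<longlonglongrightarrow> 1" if "0 < t" for t
  proof (rule Lim_transform_eventually)
    have "(\<lambda>n. exp (- (1 / t) * inverse (real n))) \<longlonglongrightarrow> exp (- (1 / t) * 0)"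
      by (intro tendsto_intros lim_inverse_n)
    then show "(\<lambda>n. exp (- (1 / t) * inverse (real n))) \<longlonglongrightarrow> 1" by simp
    show "\<forall>\<^sub>F n in sequentially. exp (- (1 / t) * inverse (real n)) = flat_exp 1 (real n * t)"
      using eventually_gt_at_top[of 0] by eventually_elim (use that in \<open>auto simp: flat_exp_def field_simps\<close>)
  qed
  have "(\<lambda>n. bump a b n x) \<longlonglongrightarrow> (\<Prod>i\<in>(UNIV::3 set). of_real 1 * of_real 1)"
    unfolding bump_def
    using True by (intro tendsto_intros lim) (auto simp: mem_box_cart)
  with True show ?thesis by simp
next
  case False
  then have "bump a b n x = 0" for n using norm_bump_le[of a b n x] by simp
  with False show ?thesis by simp
qed

section \<open>Density of the test functions\<close>

definition L2_closure_test :: "(real ^ 3 \<Rightarrow> complex) set" where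
  "L2_closure_test = {f \<in> L2. \<forall>e>0. \<exists>\<phi>. test_function \<phi> \<and> L2_dist f \<phi> < e}"

lemma L2_closure_testI:
  assumes "f \<in> L2" "\<And>n. g n \<in> L2_closure_test" "(\<lambda>n. L2_dist (g n) f) \<longlonglongrightarrow> 0"
  shows "f \<in> L2_closure_test"
  unfolding L2_closure_test_def
proof (intro CollectI conjI allI impI)
  fix e :: real assume "0 < e"
  then have "\<forall>\<^sub>F n in sequentially. L2_dist (g n) f < e / 2"
    using order_tendstoD(2)[OF assms(3), of "e / 2"] by simp
  then obtain n where n: "L2_dist (g n) f < e / 2"
    by (auto simp: eventually_sequentially)
  have g: "g n \<in> L2" using assms(2) by (simp add: L2_closure_test_def)
  obtain \<phi> where \<phi>: "test_function \<phi>" "L2_dist (g n) \<phi> < e / 2"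
    using assms(2)[of n] \<open>0 < e\<close> by (auto simp: L2_closure_test_def dest: spec[of _ "e / 2"])
  have "L2_dist f \<phi> \<le> L2_dist f (g n) + L2_dist (g n) \<phi>"
    by (rule L2_norm_triangle_diff[OF assms(1) g test_function_L2[OF \<phi>(1)]])
  with n \<phi>(2) have "L2_dist f \<phi> < e"
    by (simp add: L2_norm_minus_commute[of f])
  with \<phi>(1) show "\<exists>\<phi>. test_function \<phi> \<and> L2_dist f \<phi> < e" by blast
qed (rule assms(1))

lemma test_function_closure:
  assumes "test_function \<phi>" shows "\<phi> \<in> L2_closure_test"
  using test_function_L2[OF assms] assms
  by (auto simp: L2_closure_test_def L2_norm_def intro!: exI[of _ \<phi>])

lemma L2_closure_test_add:
  assumes "f \<in> L2_closure_test" "g \<in> L2_closure_test"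
  shows "(\<lambda>x. f x + g x) \<in> L2_closure_test"
  unfolding L2_closure_test_def
proof (intro CollectI conjI allI impI)
  have fg: "f \<in> L2" "g \<in> L2" using assms by (auto simp: L2_closure_test_def)
  then show "(\<lambda>x. f x + g x) \<in> L2" by (rule L2_add)
  fix e :: real assume "0 < e"
  then obtain \<phi> where \<phi>: "test_function \<phi>" "L2_dist f \<phi> < e / 2"
    using assms(1) by (auto simp: L2_closure_test_def dest: spec[of _ "e / 2"])
  obtain \<psi> where \<psi>: "test_function \<psi>" "L2_dist g \<psi> < e / 2"
    using assms(2) \<open>0 < e\<close> by (auto simp: L2_closure_test_def dest: spec[of _ "e / 2"])
  have "L2_norm (\<lambda>x. (f x - \<phi> x) + (g x - \<psi> x)) \<le> L2_dist f \<phi> + L2_dist g \<psi>"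
    by (intro L2_norm_triangle L2_diff fg test_function_L2 \<phi> \<psi>)
  then have "L2_norm (\<lambda>x. f x + g x - (\<phi> x + \<psi> x)) < e"
    using \<phi>(2) \<psi>(2) by (simp add: add_diff_add)
  then show "\<exists>\<phi>. test_function \<phi> \<and> L2_norm (\<lambda>x. f x + g x - \<phi> x) < e"
    using test_function_add[OF \<phi>(1) \<psi>(1)] by blast
qed

lemma L2_closure_test_cmult:
  assumes "f \<in> L2_closure_test"
  shows "(\<lambda>x. c * f x) \<in> L2_closure_test"
  unfolding L2_closure_test_def
proof (intro CollectI conjI allI impI)
  show "(\<lambda>x. c * f x) \<in> L2" using assms by (auto simp: L2_closure_test_def intro: L2_cmult)
  fix e :: real assume "0 < e"
  then have "0 < e / (norm c + 1)" by (simp add: add_nonneg_pos)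
  then obtain \<phi> where \<phi>: "test_function \<phi>" "L2_dist f \<phi> < e / (norm c + 1)"
    using assms by (auto simp: L2_closure_test_def)
  have "L2_norm (\<lambda>x. c * f x - c * \<phi> x) = norm c * L2_dist f \<phi>"
    using L2_norm_cmult[of c "\<lambda>x. f x - \<phi> x"] by (simp add: right_diff_distrib)
  also have "\<dots> \<le> norm c * (e / (norm c + 1))"
    using \<phi>(2) by (intro mult_left_mono) auto
  also have "\<dots> < e"
    using \<open>0 < e\<close> by (simp add: field_simps add_pos_nonneg)
  finally show "\<exists>\<phi>. test_function \<phi> \<and> L2_norm (\<lambda>x. c * f x - \<phi> x) < e"
    using test_function_cmult[OF \<phi>(1)] by blast
qed

lemma L2_closure_test_sum:
  "finite I \<Longrightarrow> (\<And>i. i \<in> I \<Longrightarrow> f i \<in> L2_closure_test) \<Longrightarrow> (\<lambda>x. \<Sum>i\<in>I. f i x) \<in> L2_closure_test"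
proof (induction I rule: finite_induct)
  case empty
  have "test_function (\<lambda>x. 0)" by (rule test_functionI[OF smooth_fun_const, of "{}"]) auto
  then show ?case using test_function_closure by simp
qed (auto intro: L2_closure_test_add)

lemma indicator_box_closure_test: "(\<lambda>x. complex_of_real (indicator (box a b) x)) \<in> L2_closure_test"
proof (rule L2_closure_testI)
  have fin: "emeasure lborel (box a b) < \<infinity>" by (intro emeasure_bounded_finite) auto
  show *: "(\<lambda>x. complex_of_real (indicator (box a b) x)) \<in> L2"
    by (rule indicator_L2) (use fin in auto)
  show "bump a b n \<in> L2_closure_test" for n by (rule test_function_closure[OF test_function_bump])
  show "(\<lambda>n. L2_norm (\<lambda>x. bump a b n x - complex_of_real (indicator (box a b) x))) \<longlonglongrightarrow> 0"
  proof (rule L2_norm_tendsto_0_dominated[OF _ *, where c = 2])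
    show "(\<lambda>x. bump a b n x - complex_of_real (indicator (box a b) x)) \<in> borel_measurable borel" for n
      using test_function_measurable[OF test_function_bump] by measurable
    show "AE x in lborel. (\<lambda>n. bump a b n x - complex_of_real (indicator (box a b) x)) \<longlonglongrightarrow> 0"
      using bump_tendsto by (intro AE_I2) (simp add: LIM_zero_iff)
    show "norm (bump a b n x - complex_of_real (indicator (box a b) x)) \<le> 2 * norm (complex_of_real (indicator (box a b) x))" for n x
      using norm_triangle_ineq4[of "bump a b n x" "complex_of_real (indicator (box a b) x)"] norm_bump_le[of a b n x]
      by (auto simp del: indicator_simps)
  qed
qed

text \<open>Induction over the boxes as an intersection-stable generator of the Borel sets. The
  fixed box keeps all measures finite, so that complements, taken within it, stay in
  \<open>L2\<close>.\<close>

lemma indicator_closure_test: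
  assumes "A \<in> sets borel"
  shows "(\<lambda>x. complex_of_real (indicator (A \<inter> box a b) x)) \<in> L2_closure_test"
proof -
  have fin: "emeasure lborel (A \<inter> box a b) < \<infinity>" for A
    by (intro emeasure_bounded_finite bounded_subset[OF bounded_box]) auto
  have stable: "Int_stable (range (\<lambda>(a, b). box a b :: (real ^ 3) set))"
    by (auto simp: Int_stable_def box_Int_box)
  have sub: "range (\<lambda>(a, b). box a b :: (real ^ 3) set) \<subseteq> Pow UNIV" by simp
  have "A \<in> sigma_sets UNIV (range (\<lambda>(a, b). box a b :: (real ^ 3) set))"
    using assms by (simp add: borel_eq_box)
  with stable sub show ?thesis
  proof (induction rule: sigma_sets_induct_disjoint)
    case (basic A)
    then obtain c d where "A = box c d" by auto
    then show ?case using indicator_box_closure_test by (simp add: box_Int_box)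
  next
    case empty
    then show ?case using indicator_box_closure_test[of 0 0] by simp
  next
    case (compl A)
    have "complex_of_real (indicator ((UNIV - A) \<inter> box a b) x) =
      complex_of_real (indicator (box a b) x) + (- 1) * complex_of_real (indicator (A \<inter> box a b) x)" for x
      by (auto simp: indicator_def)
    then show ?case
      using L2_closure_test_add[OF indicator_box_closure_test[of a b] L2_closure_test_cmult[OF compl.IH, of "-1"]]
      by simp
  next
    case (union A)
    have meas[measurable]: "A i \<in> sets borel" for i
      using union(2) by (auto simp: borel_eq_box)
    have ind: "complex_of_real (indicator (\<Union> (range A) \<inter> box a b) x) = (\<Sum>i. complex_of_real (indicator (A i \<inter> box a b) x))"
      and sum: "summable (\<lambda>i. complex_of_real (indicator (A i \<inter> box a b) x))" for x
    proof -
      have "(\<lambda>i. complex_of_real (indicator (A i \<inter> box a b) x)) sums complex_of_real (indicator (\<Union> (range A) \<inter> box a b) x)"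
      proof (cases "x \<in> \<Union> (range A) \<inter> box a b")
        case True
        then obtain i where i: "x \<in> A i" by auto
        have "complex_of_real (indicator (A j \<inter> box a b) x) = (if j = i then 1 else 0)" for j
          using union(1) i True by (auto simp: disjoint_family_on_def indicator_def)
        then show ?thesis using True sums_single[of i "\<lambda>_. 1 :: complex"] by simp
      qed (auto simp: indicator_def)
      then show "complex_of_real (indicator (\<Union> (range A) \<inter> box a b) x) = (\<Sum>i. complex_of_real (indicator (A i \<inter> box a b) x))"
        "summable (\<lambda>i. complex_of_real (indicator (A i \<inter> box a b) x))"
        by (auto simp: sums_iff)
    qed
    show ?case
    proof (rule L2_closure_testI)
      show *: "(\<lambda>x. complex_of_real (indicator (\<Union> (range A) \<inter> box a b) x)) \<in> L2"
        by (rule indicator_L2) (use fin in auto)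
      show "(\<lambda>x. \<Sum>i<n. complex_of_real (indicator (A i \<inter> box a b) x)) \<in> L2_closure_test" for n
        by (rule L2_closure_test_sum) (use union.IH in auto)
      show "(\<lambda>n. L2_norm (\<lambda>x. (\<Sum>i<n. complex_of_real (indicator (A i \<inter> box a b) x)) -
              complex_of_real (indicator (\<Union> (range A) \<inter> box a b) x))) \<longlonglongrightarrow> 0"
      proof (rule L2_norm_tendsto_0_dominated[OF _ *, where c = 1])
        show "AE x in lborel. (\<lambda>n. (\<Sum>i<n. complex_of_real (indicator (A i \<inter> box a b) x)) -
              complex_of_real (indicator (\<Union> (range A) \<inter> box a b) x)) \<longlonglongrightarrow> 0"
          using summable_LIMSEQ[OF sum] by (intro AE_I2) (simp add: LIM_zero_iff ind)
        fix n x
        have "(\<Sum>i<n. indicator (A i \<inter> box a b) x :: real) = indicator (\<Union>i<n. A i \<inter> box a b) x"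
          using union(1) by (subst indicator_UN_disjoint) (auto simp: disjoint_family_on_def)
        then have "(\<Sum>i<n. complex_of_real (indicator (A i \<inter> box a b) x)) = complex_of_real (indicator (\<Union>i<n. A i \<inter> box a b) x)"
          by (simp flip: of_real_sum)
        then show "norm ((\<Sum>i<n. complex_of_real (indicator (A i \<inter> box a b) x)) -
              complex_of_real (indicator (\<Union> (range A) \<inter> box a b) x)) \<le>
           1 * norm (complex_of_real (indicator (\<Union> (range A) \<inter> box a b) x))"
          by (auto simp: indicator_def)
      qed measurable
    qed
  qed
qed

theorem test_functions_dense:
  assumes "f \<in> L2" "0 < e"
  shows "\<exists>\<phi>. test_function \<phi> \<and> L2_dist f \<phi> < e"
proof -
  have [measurable]: "f \<in> borel_measurable borel" using assms by (auto dest: L2_measurable)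
  obtain s where s: "\<And>n. simple_function borel (s n)" "\<And>x. (\<lambda>n. s n x) \<longlonglongrightarrow> f x"
    "\<And>n x. dist (s n x) 0 \<le> 2 * dist (f x) 0"
    using borel_measurable_implies_sequence_metric[OF \<open>f \<in> borel_measurable borel\<close>, of 0]
    by (auto simp: space_borel)
  define B where "B = (\<lambda>n. box (- real n *\<^sub>R One) (real n *\<^sub>R One) :: (real ^ 3) set)"
  \<comment> \<open>Cutting off at a growing box gives the level sets the form required by
    \<open>indicator_closure_test\<close>. The bound |g n| \<le> 2 |f| persists, whence the constant
    3 for the difference to f.\<close>
  define g where "g = (\<lambda>n x. of_real (indicator (B n) x) * s n x)"
  have B: "B n \<in> sets borel" for n by (simp add: B_def)
  have g_eq: "g n x = (\<Sum>c\<in>range (s n). c * of_real (indicator (s n -` {c} \<inter> B n) x))" for n x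
  proof -
    have "finite (range (s n))" using s(1)[of n] by (auto simp: simple_function_def space_borel)
    then have "(\<Sum>c\<in>range (s n). c * of_real (indicator (s n -` {c} \<inter> B n) x)) =
      (\<Sum>c\<in>range (s n). if c = s n x then c * of_real (indicator (B n) x) else 0)"
      by (intro sum.cong) (auto simp: indicator_def)
    then show ?thesis using \<open>finite (range (s n))\<close> by (simp add: g_def mult.commute)
  qed
  have meas: "s n -` {c} \<in> sets borel" for n c
    using measurable_sets[OF borel_measurable_simple_function[OF s(1)], of "{c}" n] by (simp add: space_borel)
  have "f \<in> L2_closure_test"
  proof (rule L2_closure_testI[OF assms(1)])
    show "g n \<in> L2_closure_test" for n
      unfolding g_eq
      using s(1)[of n] unfolding B_def
      by (intro L2_closure_test_sum L2_closure_test_cmult indicator_closure_test meas)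
         (auto simp: simple_function_def space_borel)
    show "(\<lambda>n. L2_dist (g n) f) \<longlonglongrightarrow> 0"
    proof (rule L2_norm_tendsto_0_dominated[OF _ assms(1), where c = 3])
      show "(\<lambda>x. g n x - f x) \<in> borel_measurable borel" for n
        using borel_measurable_simple_function[OF s(1)[of n]] B unfolding g_def by measurable
      show "AE x in lborel. (\<lambda>n. g n x - f x) \<longlonglongrightarrow> 0"
      proof (intro AE_I2)
        fix x :: "real ^ 3"
        obtain N where N: "norm x < real N" using reals_Archimedean2 by blast
        have "\<forall>\<^sub>F n in sequentially. s n x - f x = g n x - f x"
          using eventually_ge_at_top[of N]
        proof eventually_elim
          case (elim n)
          have "x \<in> B n"
            unfolding B_def mem_box
          proof (intro ballI)
            fix i :: "real ^ 3" assume i: "i \<in> Basis"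
            have "\<bar>x \<bullet> i\<bar> < real n" using Basis_le_norm[OF i, of x] N elim by linarith
            then show "- real n *\<^sub>R One \<bullet> i < x \<bullet> i \<and> x \<bullet> i < real n *\<^sub>R One \<bullet> i"
              using i by (simp add: inner_sum_left_Basis abs_less_iff)
          qed
          then show ?case by (simp add: g_def)
        qed
        moreover have "(\<lambda>n. s n x - f x) \<longlonglongrightarrow> 0" using s(2) by (simp add: LIM_zero_iff)
        ultimately show "(\<lambda>n. g n x - f x) \<longlonglongrightarrow> 0" by (rule Lim_transform_eventually[rotated])
      qed
      fix n x
      have "norm (g n x) \<le> norm (s n x)" by (auto simp: g_def indicator_def norm_mult)
      then show "norm (g n x - f x) \<le> 3 * norm (f x)"
        using s(3)[of n x] norm_triangle_ineq4[of "g n x" "f x"] by simp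
    qed
  qed
  with assms(2) show ?thesis by (auto simp: L2_closure_test_def)
qed

text \<open>By orthogonality ||f||^2 = <f, f - \<phi>> for every test function, and density makes
  the right-hand side arbitrarily small. The 1 added to ||f|| in the denominators covers the case
  ||f|| = 0.\<close>

lemma L2_eq_0_if_orthogonal_test:
  assumes "f \<in> L2" "\<And>\<phi>. test_function \<phi> \<Longrightarrow> L2_inner f \<phi> = 0"
  shows "AE x in lborel. f x = 0"
proof -
  have *: "L2_norm f ^ 2 \<le> e" if "0 < e" for e
  proof -
    have "0 < e / (L2_norm f + 1)" using that by (simp add: add_nonneg_pos)
    then obtain \<phi> where \<phi>: "test_function \<phi>" "L2_dist f \<phi> < e / (L2_norm f + 1)"
      using test_functions_dense[OF assms(1)] by blast
    have "L2_inner f f = L2_inner f (\<lambda>x. f x - \<phi> x)"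
      using assms(2)[OF \<phi>(1)] by (simp add: L2_inner_diff_right assms(1) test_function_L2[OF \<phi>(1)])
    then have "L2_norm f ^ 2 = norm (L2_inner f (\<lambda>x. f x - \<phi> x))"
      by (metis L2_inner_self norm_of_real abs_power2)
    also have "\<dots> \<le> L2_norm f * L2_dist f \<phi>"
      by (intro L2_Cauchy_Schwarz assms L2_diff test_function_L2 \<phi>)
    also have "\<dots> \<le> L2_norm f * (e / (L2_norm f + 1))"
      using \<phi>(2) by (intro mult_left_mono) auto
    also have "\<dots> = e * (L2_norm f / (L2_norm f + 1))" by simp
    also have "\<dots> \<le> e * 1"
    proof (rule mult_left_mono)
      have "0 \<le> L2_norm f" by simp
      then show "L2_norm f / (L2_norm f + 1) \<le> 1" by (simp add: divide_le_eq_1_pos[of "L2_norm f + 1"] add_nonneg_pos)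
    qed (use that in simp)
    finally show ?thesis by simp
  qed
  have "L2_norm f ^ 2 \<le> 0"
  proof (rule field_le_epsilon)
    fix e :: real assume "0 < e"
    from *[OF this] show "L2_norm f ^ 2 \<le> 0 + e" by (simp only: add_0)
  qed
  then have "L2_norm f = 0" by simp
  then show ?thesis using L2_norm_eq_0_iff[OF assms(1)] by simp
qed

section \<open>Continuity of translations\<close>

text \<open>A convergent sequence of shifts is bounded by some r, so all translates are supported in
  one ball of radius R + r. Its indicator is the majorant for the pointwise convergence given by
  continuity.\<close>

lemma test_function_shift_tendsto:
  assumes \<phi>: "test_function \<phi>" and a: "a \<longlonglongrightarrow> 0"
  shows "(\<lambda>n. L2_norm (\<lambda>x. \<phi> (x + a n) - \<phi> x)) \<longlonglongrightarrow> 0"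
proof -
  obtain B R where B: "0 \<le> B" "\<And>x. norm (\<phi> x) \<le> B * indicator (cball 0 R) x"
    using test_function_ball_bound[OF \<phi>] by metis
  obtain r where r: "\<And>n. norm (a n) \<le> r"
    using convergent_imp_bounded[OF a] by (auto simp: bounded_iff)
  have [measurable]: "\<phi> \<in> borel_measurable borel" by (rule test_function_measurable[OF \<phi>])
  have fin: "emeasure lborel (cball (0 :: real ^ 3) (R + r)) < \<infinity>"
    by (intro emeasure_bounded_finite) auto
  have ind: "(\<lambda>x. complex_of_real (indicator (cball (0 :: real ^ 3) (R + r)) x)) \<in> L2"
    by (rule indicator_L2) (use fin in auto)
  show ?thesis
  proof (rule L2_norm_tendsto_0_dominated[OF _ ind, where c = "2 * B"])
    show "AE x in lborel. (\<lambda>n. \<phi> (x + a n) - \<phi> x) \<longlonglongrightarrow> 0"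
    proof (intro AE_I2)
      fix x
      have "isCont \<phi> x"
        using smooth_fun_continuous[OF test_function_smooth[OF \<phi>]] by (simp add: continuous_on_eq_continuous_at)
      moreover have "(\<lambda>n. x + a n) \<longlonglongrightarrow> x" using tendsto_add[OF tendsto_const a, of x] by simp
      ultimately have "(\<lambda>n. \<phi> (x + a n)) \<longlonglongrightarrow> \<phi> x" by (rule isCont_tendsto_compose)
      then show "(\<lambda>n. \<phi> (x + a n) - \<phi> x) \<longlonglongrightarrow> 0" by (simp add: LIM_zero_iff)
    qed
    fix n x
    have 1: "norm (\<phi> (x + a n)) \<le> B * indicator (cball 0 (R + r)) x"
    proof (cases "x \<in> cball 0 (R + r)")
      case True
      have "norm (\<phi> (x + a n)) \<le> B * indicator (cball 0 R) (x + a n)" by (rule B)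
      also have "\<dots> \<le> B" using B(1) by (auto simp: indicator_def)
      finally show ?thesis using True by simp
    next
      case False
      then have "x + a n \<notin> cball 0 R"
        using r[of n] norm_triangle_ineq4[of "x + a n" "a n"] by auto
      then show ?thesis using B(2)[of "x + a n"] False by simp
    qed
    have "0 \<le> r" using r[of 0] norm_ge_zero order_trans by blast
    then have 2: "norm (\<phi> x) \<le> B * indicator (cball 0 (R + r)) x"
      using B(2)[of x] B(1) by (cases "norm x \<le> R") auto
    show "norm (\<phi> (x + a n) - \<phi> x) \<le> 2 * B * norm (complex_of_real (indicator (cball 0 (R + r)) x))"
      using norm_triangle_ineq4[of "\<phi> (x + a n)" "\<phi> x"] 1 2 by simp
  qed measurable
qed

text \<open>Translation is an isometry, so the error of replacing f by a test function is the same
  before and after the shift; both are at most e / 3.\<close>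

lemma L2_shift_tendsto:
  fixes f :: "real ^ 3 \<Rightarrow> complex"
  assumes f: "f \<in> L2" and a: "a \<longlonglongrightarrow> (0 :: real ^ 3)"
  shows "(\<lambda>n. L2_norm (\<lambda>x. f (x + a n) - f x)) \<longlonglongrightarrow> 0"
proof (rule LIMSEQ_I)
  fix e :: real assume "0 < e"
  then obtain \<phi> where \<phi>: "test_function \<phi>" "L2_dist f \<phi> < e / 3"
    using test_functions_dense[OF f, of "e / 3"] by auto
  have [measurable]: "f \<in> borel_measurable borel" "\<phi> \<in> borel_measurable borel"
    using f \<phi> by (auto dest: L2_measurable test_function_measurable)
  note L2 = f test_function_L2[OF \<phi>(1)]
  obtain N where N: "\<And>n. n \<ge> N \<Longrightarrow> L2_norm (\<lambda>x. \<phi> (x + a n) - \<phi> x) < e / 3"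
    using order_tendstoD(2)[OF test_function_shift_tendsto[OF \<phi>(1) a], of "e / 3"] \<open>0 < e\<close>
    by (auto simp: eventually_sequentially)
  have "L2_norm (\<lambda>x. f (x + a n) - f x) < e" if "n \<ge> N" for n
  proof -
    have "L2_norm (\<lambda>x. f (x + a n) - f x) \<le> L2_norm (\<lambda>x. f (x + a n) - \<phi> (x + a n)) + L2_norm (\<lambda>x. \<phi> (x + a n) - f x)"
      by (intro L2_norm_triangle_diff L2_shift L2)
    also have "L2_norm (\<lambda>x. f (x + a n) - \<phi> (x + a n)) = L2_dist f \<phi>"
      by (rule L2_norm_shift) measurable
    also have "L2_norm (\<lambda>x. \<phi> (x + a n) - f x) \<le> L2_norm (\<lambda>x. \<phi> (x + a n) - \<phi> x) + L2_dist \<phi> f"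
      by (intro L2_norm_triangle_diff L2_shift L2)
    finally show ?thesis
      using N[OF that] \<phi>(2) by (simp add: L2_norm_minus_commute[of \<phi> f])
  qed
  then show "\<exists>N. \<forall>n\<ge>N. norm (L2_norm (\<lambda>x. f (x + a n) - f x) - 0) < e" by auto
qed

section \<open>The Fourier transform on integrable functions\<close>

lemma borel_measurable_cis [measurable (raw)]:
  "f \<in> borel_measurable M \<Longrightarrow> (\<lambda>x. cis (f x)) \<in> borel_measurable M"
  by (rule borel_measurable_continuous_onI[THEN measurable_compose_rev]) (auto intro: continuous_intros)

lemma integrable_cis_mult:
  fixes f :: "'a \<Rightarrow> complex"
  assumes "integrable M f" "g \<in> borel_measurable M"
  shows "integrable M (\<lambda>x. cis (g x) * f x)"
  by (rule Bochner_Integration.integrable_bound[OF assms(1)]) (use assms in \<open>auto simp: norm_mult\<close>)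

lemma fourier_measurable [measurable]:
  assumes [measurable]: "f \<in> borel_measurable borel"
  shows "fourier f \<in> borel_measurable borel"
  unfolding fourier_def by measurable

lemma fourier_add:
  assumes "integrable lborel f" "integrable lborel g"
  shows "fourier (\<lambda>x. f x + g x) \<xi> = fourier f \<xi> + fourier g \<xi>"
  using integrable_cis_mult[OF assms(1), of "\<lambda>x. - (x \<bullet> \<xi>)"] integrable_cis_mult[OF assms(2), of "\<lambda>x. - (x \<bullet> \<xi>)"]
  by (simp add: fourier_def distrib_left)

lemma fourier_cmult: "fourier (\<lambda>x. c * f x) \<xi> = c * fourier f \<xi>"
  unfolding fourier_def by (simp add: mult.left_commute[of _ c])

lemma fourier_diff:
  assumes "integrable lborel f" "integrable lborel g"
  shows "fourier (\<lambda>x. f x - g x) \<xi> = fourier f \<xi> - fourier g \<xi>"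
  using fourier_add[OF assms(1), of "\<lambda>x. (-1) * g x"] fourier_cmult[of "-1" g] assms(2) by simp

lemma fourier_cnj: "fourier (\<lambda>x. cnj (f x)) \<xi> = cnj (fourier f (- \<xi>))"
proof -
  have "(LINT x|lborel. cis (- (x \<bullet> \<xi>)) * cnj (f x)) = (LINT x|lborel. cnj (cis (- (x \<bullet> - \<xi>)) * f x))"
    by (simp add: cis_cnj)
  also have "\<dots> = cnj (LINT x|lborel. cis (- (x \<bullet> - \<xi>)) * f x)"
    by (rule Bochner_Integration.integral_cnj)
  finally show ?thesis by (simp add: fourier_def)
qed

lemma cis_mult_cong: "a + b = c + d \<Longrightarrow> cis a * (cis b * z) = cis c * (cis d * z)"
  by (simp add: cis_mult flip: mult.assoc)

text \<open>Modulation and translation are treated together because a Galilean boost at a fixed time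
  is exactly such a composition. The phase in the result comes from the substitution x -> x +
  a.\<close>

lemma fourier_modulate_shift:
  assumes [measurable]: "f \<in> borel_measurable borel"
  shows "fourier (\<lambda>x. cis (\<xi>0 \<bullet> x + c) * f (x - a)) \<xi> = cis (c - a \<bullet> (\<xi> - \<xi>0)) * fourier f (\<xi> - \<xi>0)"
proof -
  have "(LINT x|lborel. cis (- (x \<bullet> \<xi>)) * (cis (\<xi>0 \<bullet> x + c) * f (x - a)))
     = (LINT x|lborel. cis (- ((x + a) \<bullet> \<xi>)) * (cis (\<xi>0 \<bullet> (x + a) + c) * f (x + a - a)))"
    by (rule integral_lborel_shift[symmetric]) measurable
  also have "\<dots> = (LINT x|lborel. cis (c - a \<bullet> (\<xi> - \<xi>0)) * (cis (- (x \<bullet> (\<xi> - \<xi>0))) * f x))"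
  proof (intro Bochner_Integration.integral_cong refl)
    fix x
    have "- ((x + a) \<bullet> \<xi>) + (\<xi>0 \<bullet> (x + a) + c) = (c - a \<bullet> (\<xi> - \<xi>0)) + - (x \<bullet> (\<xi> - \<xi>0))"
      by (simp add: inner_diff_right inner_add_left inner_add_right inner_commute[of \<xi>0])
    from cis_mult_cong[OF this]
    show "cis (- ((x + a) \<bullet> \<xi>)) * (cis (\<xi>0 \<bullet> (x + a) + c) * f (x + a - a)) =
      cis (c - a \<bullet> (\<xi> - \<xi>0)) * (cis (- (x \<bullet> (\<xi> - \<xi>0))) * f x)" by simp
  qed
  also have "\<dots> = cis (c - a \<bullet> (\<xi> - \<xi>0)) * (LINT x|lborel. cis (- (x \<bullet> (\<xi> - \<xi>0))) * f x)"
    by (rule integral_mult_right_zero)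
  finally show ?thesis by (simp add: fourier_def)
qed

text \<open>Absolute integrability for exchanging the order of integration, with an exponential
  \<open>cis\<close> as the kernel k.\<close>

lemma integrable_tensor:
  fixes f :: "'a::euclidean_space \<Rightarrow> complex" and g :: "'b::euclidean_space \<Rightarrow> complex"
  assumes f: "integrable lborel f" and g: "integrable lborel g"
    and [measurable]: "k \<in> borel_measurable (lborel \<Otimes>\<^sub>M lborel)" and k: "\<And>p. norm (k p) \<le> 1"
  shows "integrable (lborel \<Otimes>\<^sub>M lborel) (\<lambda>(x, y). k (x, y) * (f x * g y))"
proof (rule lborel_pair.Fubini_integrable)
  have [measurable]: "f \<in> borel_measurable borel" "g \<in> borel_measurable borel"
    using f g by auto
  show meas: "(\<lambda>(x, y). k (x, y) * (f x * g y)) \<in> borel_measurable (lborel \<Otimes>\<^sub>M lborel)" by measurable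
  have b: "norm (k (x, y) * (f x * g y)) \<le> norm (f x) * norm (g y)" for x y
    using mult_right_mono[OF k, of "norm (f x * g y)" "(x, y)"] by (simp add: norm_mult)
  have i: "integrable lborel (\<lambda>y. k (x, y) * (f x * g y))" for x
  proof (rule Bochner_Integration.integrable_bound)
    show "integrable lborel (\<lambda>y. norm (f x) * norm (g y))" using g by simp
  qed (use b in auto)
  then show "AE x in lborel. integrable lborel (\<lambda>y. case (x, y) of (x, y) \<Rightarrow> k (x, y) * (f x * g y))" by simp
  show "integrable lborel (\<lambda>x. LINT y|lborel. norm (case (x, y) of (x, y) \<Rightarrow> k (x, y) * (f x * g y)))"
  proof (rule Bochner_Integration.integrable_bound)
    show "integrable lborel (\<lambda>x. norm (f x) * (LINT y|lborel. norm (g y)))" using f by simp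
    have "(LINT y|lborel. norm (k (x, y) * (f x * g y))) \<le> (LINT y|lborel. norm (f x) * norm (g y))" for x
      using g by (intro integral_mono integrable_norm i) (auto intro: b)
    then show "AE x in lborel. norm (LINT y|lborel. norm (case (x, y) of (x, y) \<Rightarrow> k (x, y) * (f x * g y))) \<le>
         norm (norm (f x) * (LINT y|lborel. norm (g y)))"
      by (intro AE_I2) (auto intro!: order_trans[OF _ abs_ge_self])
  qed measurable
qed

text \<open>Fubini, since the kernel is symmetric in x and \<xi>. It moves a Fourier transform from
  one factor to the other.\<close>

lemma fourier_multiplication:
  assumes f: "integrable lborel f" and g: "integrable lborel g"
  shows "(LINT \<xi>|lborel. fourier f \<xi> * g \<xi>) = (LINT x|lborel. f x * fourier g x)"
proof -
  let ?c = "complex_of_real ((2 * pi) powr (- 3/2))"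
  have [measurable]: "f \<in> borel_measurable borel" "g \<in> borel_measurable borel"
    using f g by auto
  have int: "integrable (lborel \<Otimes>\<^sub>M lborel) (\<lambda>(x, y). cis (- (x \<bullet> y)) * (f x * g y))"
    using integrable_tensor[OF f g, of "\<lambda>(x, y). cis (- (x \<bullet> y))"] by (simp add: split_beta')
  have "(LINT \<xi>|lborel. fourier f \<xi> * g \<xi>) = ?c * (LINT \<xi>|lborel. LINT x|lborel. cis (- (x \<bullet> \<xi>)) * (f x * g \<xi>))"
    unfolding fourier_def by (simp add: mult.assoc flip: integral_mult_left_zero)
  also have "(LINT \<xi>|lborel. LINT x|lborel. cis (- (x \<bullet> \<xi>)) * (f x * g \<xi>)) =
      (LINT x|lborel. LINT \<xi>|lborel. cis (- (x \<bullet> \<xi>)) * (f x * g \<xi>))"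
    by (rule lborel_pair.Fubini_integral) (use int in simp)
  also have "?c * \<dots> = (LINT x|lborel. ?c * (LINT \<xi>|lborel. cis (- (x \<bullet> \<xi>)) * (f x * g \<xi>)))"
    by (rule integral_mult_right_zero[symmetric])
  also have "(\<lambda>x. ?c * (LINT \<xi>|lborel. cis (- (x \<bullet> \<xi>)) * (f x * g \<xi>))) = (\<lambda>x. f x * fourier g x)"
  proof
    fix x
    have "(LINT \<xi>|lborel. cis (- (x \<bullet> \<xi>)) * (f x * g \<xi>)) = (LINT \<xi>|lborel. f x * (cis (- (\<xi> \<bullet> x)) * g \<xi>))"
      by (simp only: inner_commute[of x] mult.left_commute)
    also have "\<dots> = f x * (LINT \<xi>|lborel. cis (- (\<xi> \<bullet> x)) * g \<xi>)"
      by (rule integral_mult_right_zero)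
    finally show "?c * (LINT \<xi>|lborel. cis (- (x \<bullet> \<xi>)) * (f x * g \<xi>)) = f x * fourier g x"
      by (simp only: fourier_def mult.left_commute)
  qed
  finally show ?thesis .
qed

section \<open>The Gaussian\<close>

lemma integral_lborel_scale:
  fixes f :: "real ^ 3 \<Rightarrow> complex"
  assumes [measurable]: "f \<in> borel_measurable borel" and c: "0 < c"
  shows "(LINT x|lborel. f x) = of_real (c ^ 3) * (LINT x|lborel. f (c *\<^sub>R x))"
proof -
  have "(LINT x|lborel. f x) = (LINT x|density (distr lborel borel (\<lambda>x. 0 + c *\<^sub>R x)) (\<lambda>_. \<bar>c\<bar>^DIM(real ^ 3)). f x)"
    using lborel_affine[of c "0 :: real ^ 3"] c by simp
  also have "\<dots> = (LINT x|distr lborel borel (\<lambda>x. 0 + c *\<^sub>R x). (c ^ 3) *\<^sub>R f x)"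
    using c by (subst integral_density) auto
  also have "\<dots> = (LINT x|lborel. (c ^ 3) *\<^sub>R f (c *\<^sub>R x))"
    by (subst integral_distr) auto
  finally show ?thesis by (simp add: scaleR_conv_of_real)
qed

lemma integral_lborel_prod:
  fixes f :: "'a::euclidean_space \<Rightarrow> real \<Rightarrow> complex"
  assumes "\<And>b. b \<in> Basis \<Longrightarrow> integrable lborel (f b)"
  shows "(LINT x|(lborel :: 'a measure). (\<Prod>b\<in>Basis. f b (x \<bullet> b))) = (\<Prod>b\<in>Basis. (LINT x|lborel. f b x))"
    and "integrable (lborel :: 'a measure) (\<lambda>x. \<Prod>b\<in>Basis. f b (x \<bullet> b))"
proof -
  interpret product_sigma_finite "\<lambda>b :: 'a. lborel :: real measure" ..
  have [measurable]: "b \<in> Basis \<Longrightarrow> f b \<in> borel_measurable borel" for b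
    using assms[of b] by auto
  have eq: "(\<Prod>b\<in>Basis. f b ((\<Sum>b\<in>Basis. g b *\<^sub>R b) \<bullet> b)) = (\<Prod>b\<in>Basis. f b (g b))" for g :: "'a \<Rightarrow> real"
    by (intro prod.cong) (auto simp: inner_sum_left_Basis)
  have "(LINT x|(lborel :: 'a measure). (\<Prod>b\<in>Basis. f b (x \<bullet> b))) =
     (LINT g|(\<Pi>\<^sub>M b\<in>Basis. lborel). (\<Prod>b\<in>Basis. f b (g b)))"
    by (subst lborel_eq, subst integral_distr) (auto simp: eq)
  also have "\<dots> = (\<Prod>b\<in>Basis. (LINT x|lborel. f b x))"
    by (rule product_integral_prod) (use assms in auto)
  finally show "(LINT x|(lborel :: 'a measure). (\<Prod>b\<in>Basis. f b (x \<bullet> b))) = (\<Prod>b\<in>Basis. (LINT x|lborel. f b x))" .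
  show "integrable (lborel :: 'a measure) (\<lambda>x. \<Prod>b\<in>Basis. f b (x \<bullet> b))"
    by (subst lborel_eq, subst integrable_distr_eq) (auto simp: eq intro!: product_integrable_prod assms)
qed

text \<open>This is the characteristic function of the standard normal distribution, evaluated at -
  t to match the sign in \<open>fourier\<close> and rescaled by sqrt (2 pi).\<close>

lemma
  shows integral_gaussian_real: "(LINT x|lborel. cis (- (x * t)) * of_real (exp (- x\<^sup>2 / 2))) = of_real (sqrt (2 * pi) * exp (- t\<^sup>2 / 2))"
    and integrable_gaussian_real: "integrable lborel (\<lambda>x. cis (- (x * t)) * of_real (exp (- x\<^sup>2 / 2)))"
proof -
  have d: "exp (- x\<^sup>2 / 2) = sqrt (2 * pi) * std_normal_density x" for x
    by (simp add: std_normal_density_def)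
  have "integrable lborel (\<lambda>x. exp (- x\<^sup>2 / 2) :: real)"
    unfolding d using integrable_std_normal_moment[of 0] by simp
  then have "integrable lborel (\<lambda>x. complex_of_real (exp (- x\<^sup>2 / 2)))"
    by (rule integrable_of_real)
  then show "integrable lborel (\<lambda>x. cis (- (x * t)) * of_real (exp (- x\<^sup>2 / 2)))"
    by (rule integrable_cis_mult) measurable
  have "complex_of_real (exp (- t\<^sup>2 / 2)) = char std_normal_distribution (- t)"
    by (simp add: char_std_normal_distribution)
  also have "\<dots> = (LINT x|lborel. std_normal_density x *\<^sub>R cis (- (x * t)))"
    unfolding char_def
    by (subst integral_density) (auto simp: cis_conv_exp mult_ac)
  finally have "of_real (sqrt (2 * pi)) * complex_of_real (exp (- t\<^sup>2 / 2)) =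
     (LINT x|lborel. of_real (sqrt (2 * pi)) * (std_normal_density x *\<^sub>R cis (- (x * t))))"
    by (simp only: integral_mult_right_zero)
  also have "\<dots> = (LINT x|lborel. cis (- (x * t)) * of_real (exp (- x\<^sup>2 / 2)))"
    unfolding d by (simp add: scaleR_conv_of_real mult_ac)
  finally show "(LINT x|lborel. cis (- (x * t)) * of_real (exp (- x\<^sup>2 / 2))) = of_real (sqrt (2 * pi) * exp (- t\<^sup>2 / 2))"
    by simp
qed

definition gaussian :: "real ^ 3 \<Rightarrow> complex" where
  "gaussian x = of_real (exp (- (norm x)\<^sup>2 / 2))"

lemma gaussian_measurable [measurable]: "gaussian \<in> borel_measurable borel"
  unfolding gaussian_def[abs_def] by measurable

text \<open>Gaussian and character both factor over the coordinates, which reduces everything to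
  dimension one.\<close>

lemma
  shows integrable_gaussian: "integrable lborel gaussian"
    and fourier_gaussian: "fourier gaussian \<xi> = gaussian \<xi>"
    and integral_gaussian: "(LINT x|lborel. gaussian x) = of_real ((2 * pi) powr (3/2))"
proof -
  have eq: "cis (- (x \<bullet> \<xi>)) * gaussian x = (\<Prod>b\<in>Basis. cis (- ((x \<bullet> b) * (\<xi> \<bullet> b))) * of_real (exp (- (x \<bullet> b)\<^sup>2 / 2)))" for x \<xi>
  proof -
    have "cis (- (x \<bullet> \<xi>)) = (\<Prod>b\<in>Basis. cis (- ((x \<bullet> b) * (\<xi> \<bullet> b))))"
      unfolding cis_conv_exp by (subst exp_sum[symmetric])
        (auto simp: euclidean_inner[of x \<xi>] sum_distrib_left sum_negf)
    moreover have "gaussian x = (\<Prod>b\<in>Basis. of_real (exp (- (x \<bullet> b)\<^sup>2 / 2)))"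
    proof -
      have "(norm x)\<^sup>2 = (\<Sum>b\<in>Basis. (x \<bullet> b)\<^sup>2)"
        unfolding power2_norm_eq_inner by (subst euclidean_inner) (simp add: power2_eq_square)
      then have "exp (- (norm x)\<^sup>2 / 2) = (\<Prod>b\<in>Basis. exp (- (x \<bullet> b)\<^sup>2 / 2))"
        by (subst exp_sum[symmetric]) (auto simp: sum_negf sum_divide_distrib)
      then show ?thesis by (simp add: gaussian_def)
    qed
    ultimately show ?thesis by (simp add: prod.distrib)
  qed
  have "integrable lborel (\<lambda>x. cis (- (x \<bullet> 0)) * gaussian x)"
    unfolding eq by (intro integral_lborel_prod(2) integrable_gaussian_real)
  then show "integrable lborel gaussian" by simp
  have I: "(LINT x|lborel. cis (- (x \<bullet> \<xi>)) * gaussian x) = of_real ((2 * pi) powr (3/2)) * gaussian \<xi>" for \<xi>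
  proof -
    have "(LINT x|lborel. cis (- (x \<bullet> \<xi>)) * gaussian x) = (\<Prod>b\<in>Basis. of_real (sqrt (2 * pi) * exp (- (\<xi> \<bullet> b)\<^sup>2 / 2)))"
      unfolding eq integral_lborel_prod(1)[OF integrable_gaussian_real] integral_gaussian_real ..
    also have "\<dots> = of_real (sqrt (2 * pi)) ^ 3 * (\<Prod>b\<in>Basis. cis (- ((\<xi> \<bullet> b) * (0 \<bullet> b))) * of_real (exp (- (\<xi> \<bullet> b)\<^sup>2 / 2)))"
      by (simp add: prod.distrib)
    also have "(\<Prod>b\<in>Basis. cis (- ((\<xi> \<bullet> b) * (0 \<bullet> b))) * of_real (exp (- (\<xi> \<bullet> b)\<^sup>2 / 2))) = gaussian \<xi>"
      using eq[of \<xi> 0] by simp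
    also have "complex_of_real (sqrt (2 * pi)) ^ 3 = of_real ((2 * pi) powr (3/2))"
    proof -
      have "(2 * pi) powr (3/2) = ((2 * pi) powr (1/2)) powr 3" by (simp add: powr_powr)
      also have "\<dots> = sqrt (2 * pi) ^ 3" by (simp add: powr_half_sqrt powr_numeral)
      finally show ?thesis by simp
    qed
    finally show ?thesis .
  qed
  show "fourier gaussian \<xi> = gaussian \<xi>"
    unfolding fourier_def I by (simp add: powr_minus field_simps)
  show "(LINT x|lborel. gaussian x) = of_real ((2 * pi) powr (3/2))"
    using I[of 0] by (simp add: gaussian_def)
qed

lemma norm_gaussian_le: "norm (gaussian x) \<le> 1"
  by (simp add: gaussian_def)

text \<open>The form in which a dilated Gaussian appears after the substitution x -> c x in the
  multiplication formula: the Jacobian c^3 compensates the concentration of its transform.\<close>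

lemma
  assumes c: "0 < c"
  shows fourier_gaussian_scale: "of_real (c ^ 3) * fourier (\<lambda>x. gaussian (c *\<^sub>R x)) (c *\<^sub>R \<xi>) = gaussian \<xi>"
    and integrable_gaussian_scale: "integrable lborel (\<lambda>x. gaussian (c *\<^sub>R x))"
proof -
  have "(LINT x|lborel. cis (- (x \<bullet> \<xi>)) * gaussian x) = of_real (c ^ 3) * (LINT x|lborel. cis (- ((c *\<^sub>R x) \<bullet> \<xi>)) * gaussian (c *\<^sub>R x))"
    by (rule integral_lborel_scale[OF _ c]) measurable
  then show "of_real (c ^ 3) * fourier (\<lambda>x. gaussian (c *\<^sub>R x)) (c *\<^sub>R \<xi>) = gaussian \<xi>"
    using fourier_gaussian[of \<xi>] by (simp add: fourier_def mult_ac)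
  have "integrable lborel (\<lambda>x. c ^ 3 *\<^sub>R gaussian (c *\<^sub>R x))"
    using integrable_gaussian c by (subst (asm) lborel_affine[of c 0]) (auto simp: integrable_density integrable_distr_eq)
  from integrable_scaleR_right[of "1 / c ^ 3", OF this] c
  show "integrable lborel (\<lambda>x. gaussian (c *\<^sub>R x))" by simp
qed

section \<open>The Plancherel theorem\<close>

text \<open>A is the convolution of h with its conjugated reflection, so its transform is the
  squared modulus of that of h, up to the constant of the symmetric normalisation. A square not yet
  known to be integrable is thereby the transform of an integrable function.\<close>

lemma autocorrelation_fourier:
  assumes h: "integrable lborel h"
  defines "A \<equiv> \<lambda>z. LINT y|lborel. h (y + z) * cnj (h y)"
  shows "integrable lborel A"
    and "of_real ((2 * pi) powr (3/2)) * of_real (norm (fourier h \<xi>) ^ 2) = fourier A \<xi>"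
proof -
  have [measurable]: "h \<in> borel_measurable borel" using h by auto
  let ?c = "complex_of_real ((2 * pi) powr (- 3/2))"
  have "integrable (lborel \<Otimes>\<^sub>M lborel) (\<lambda>(x, y). cnj (h x) * h (y + x))"
  proof (rule lborel_pair.Fubini_integrable)
    show "(\<lambda>(x, y). cnj (h x) * h (y + x)) \<in> borel_measurable (lborel \<Otimes>\<^sub>M lborel)" by measurable
    have i: "integrable lborel (\<lambda>y. h (y + x))" for x
      using h by (subst integrable_lborel_shift) auto
    have "(LINT y|lborel. norm (h (y + x))) = (LINT y|lborel. norm (h y))" for x
      by (rule integral_lborel_shift) measurable
    then show "integrable lborel (\<lambda>x. LINT y|lborel. norm (case (x, y) of (x, y) \<Rightarrow> cnj (h x) * h (y + x)))"
      using h by (simp add: norm_mult)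
    show "AE x in lborel. integrable lborel (\<lambda>y. case (x, y) of (x, y) \<Rightarrow> cnj (h x) * h (y + x))"
      using i by simp
  qed
  then have int: "integrable (lborel \<Otimes>\<^sub>M lborel) (\<lambda>(y, z). cnj (h y) * h (z + y))" .
  have int': "integrable (lborel \<Otimes>\<^sub>M lborel) (\<lambda>(z, y). cnj (h y) * h (z + y))"
    using lborel_pair.integrable_product_swap[OF int] by simp
  from lborel_pair.integrable_fst'[OF int'] show "integrable lborel A"
    by (simp add: A_def add.commute mult.commute)
  have int2: "integrable (lborel \<Otimes>\<^sub>M lborel) (\<lambda>(y, z). cis (- (z \<bullet> \<xi>)) * (cnj (h y) * h (z + y)))"
    using integrable_cis_mult[OF int, of "\<lambda>p. - (snd p \<bullet> \<xi>)"] by (simp add: split_beta')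
  have "fourier A \<xi> = ?c * (LINT z|lborel. LINT y|lborel. cis (- (z \<bullet> \<xi>)) * (cnj (h y) * h (z + y)))"
    by (simp add: fourier_def A_def add.commute mult.commute)
  also have "(LINT z|lborel. LINT y|lborel. cis (- (z \<bullet> \<xi>)) * (cnj (h y) * h (z + y))) =
     (LINT y|lborel. LINT z|lborel. cis (- (z \<bullet> \<xi>)) * (cnj (h y) * h (z + y)))"
    by (rule lborel_pair.Fubini_integral) (use int2 in simp)
  also have "(\<lambda>y. LINT z|lborel. cis (- (z \<bullet> \<xi>)) * (cnj (h y) * h (z + y))) =
     (\<lambda>y. cnj (cis (- (y \<bullet> \<xi>)) * h y) * (LINT x|lborel. cis (- (x \<bullet> \<xi>)) * h x))"
  proof
    fix y
    have "(LINT z|lborel. cis (- (z \<bullet> \<xi>)) * (cnj (h y) * h (z + y))) =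
       (LINT z|lborel. cnj (cis (- (y \<bullet> \<xi>)) * h y) * (cis (- ((z + y) \<bullet> \<xi>)) * h (z + y)))"
    proof (intro Bochner_Integration.integral_cong refl)
      fix z
      have "cis (- (z \<bullet> \<xi>)) = cis (y \<bullet> \<xi>) * cis (- ((z + y) \<bullet> \<xi>))"
        by (simp add: cis_mult inner_add_left)
      then show "cis (- (z \<bullet> \<xi>)) * (cnj (h y) * h (z + y)) =
          cnj (cis (- (y \<bullet> \<xi>)) * h y) * (cis (- ((z + y) \<bullet> \<xi>)) * h (z + y))"
        by (simp only: complex_cnj_mult cis_cnj minus_minus mult_ac)
    qed
    also have "\<dots> = cnj (cis (- (y \<bullet> \<xi>)) * h y) * (LINT z|lborel. (cis (- ((z + y) \<bullet> \<xi>)) * h (z + y)))"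
      by (rule integral_mult_right_zero)
    also have "(LINT z|lborel. (cis (- ((z + y) \<bullet> \<xi>)) * h (z + y))) = (LINT x|lborel. cis (- (x \<bullet> \<xi>)) * h x)"
      by (rule integral_lborel_shift) measurable
    finally show "(LINT z|lborel. cis (- (z \<bullet> \<xi>)) * (cnj (h y) * h (z + y))) =
        cnj (cis (- (y \<bullet> \<xi>)) * h y) * (LINT x|lborel. cis (- (x \<bullet> \<xi>)) * h x)" .
  qed
  also have "(LINT y|lborel. cnj (cis (- (y \<bullet> \<xi>)) * h y) * (LINT x|lborel. cis (- (x \<bullet> \<xi>)) * h x)) =
     cnj (LINT x|lborel. cis (- (x \<bullet> \<xi>)) * h x) * (LINT x|lborel. cis (- (x \<bullet> \<xi>)) * h x)"
    by (subst integral_mult_left_zero) (simp only: Bochner_Integration.integral_cnj)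
  finally have *: "fourier A \<xi> = ?c * (cnj (LINT x|lborel. cis (- (x \<bullet> \<xi>)) * h x) * (LINT x|lborel. cis (- (x \<bullet> \<xi>)) * h x))" .
  have "of_real (norm (fourier h \<xi>) ^ 2) = ?c * (?c * (cnj (LINT x|lborel. cis (- (x \<bullet> \<xi>)) * h x) * (LINT x|lborel. cis (- (x \<bullet> \<xi>)) * h x)))"
    unfolding complex_norm_square by (simp add: fourier_def)
  also have "\<dots> = ?c * fourier A \<xi>" unfolding * ..
  finally show "of_real ((2 * pi) powr (3/2)) * of_real (norm (fourier h \<xi>) ^ 2) = fourier A \<xi>"
    by (simp add: powr_minus field_simps)
qed

text \<open>Gaussian regularisation: the squared modulus of \<open>fourier h\<close> is weighted
  with a wide Gaussian, and the multiplication formula turns the integral into an average of A(e n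
  w), which tends to A(0) = ||h||^2. On the frequency side monotone convergence then yields
  integrability and the value of the norm at once.\<close>

theorem Plancherel:
  assumes h: "integrable lborel h" "h \<in> L2"
  shows "fourier h \<in> L2" and "L2_norm (fourier h) = L2_norm h"
proof -
  define A where "A = (\<lambda>z. LINT y|lborel. h (y + z) * cnj (h y))"
  note A = autocorrelation_fourier[OF h(1), folded A_def]
  have [measurable]: "h \<in> borel_measurable borel" "A \<in> borel_measurable borel" using h A(1) by auto
  define e where "e = (\<lambda>n. 1 / real (Suc n))"
  have e: "0 < e n" for n by (simp add: e_def)
  have Ain: "A z = L2_inner (\<lambda>y. h (y + z)) h" for z by (simp add: A_def L2_inner_def)
  have A0: "A 0 = of_real (L2_norm h ^ 2)" using L2_inner_self[of h] by (simp add: Ain)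
  have Ab: "norm (A z) \<le> L2_norm h ^ 2" for z
  proof -
    have "norm (A z) \<le> L2_norm (\<lambda>y. h (y + z)) * L2_norm h"
      unfolding Ain by (intro L2_Cauchy_Schwarz L2_shift h)
    also have "L2_norm (\<lambda>y. h (y + z)) = L2_norm h" by (rule L2_norm_shift) measurable
    finally show ?thesis by (simp add: power2_eq_square)
  qed
  \<comment> \<open>Continuity of A at 0 is continuity of translations in L2; here h in
    \<open>L2\<close> enters.\<close>
  have Alim: "(\<lambda>n. A (e n *\<^sub>R w)) \<longlonglongrightarrow> A 0" for w
  proof (rule Lim_null_comparison[THEN LIM_zero_cancel])
    have e0: "(\<lambda>n. e n *\<^sub>R w) \<longlonglongrightarrow> 0"
      using tendsto_scaleR[OF LIMSEQ_inverse_real_of_nat tendsto_const, of w] by (simp add: e_def inverse_eq_divide)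
    show "\<forall>\<^sub>F n in sequentially. norm (A (e n *\<^sub>R w) - A 0) \<le> L2_norm (\<lambda>x. h (x + e n *\<^sub>R w) - h x) * L2_norm h"
    proof (intro always_eventually allI)
      fix n
      have "A (e n *\<^sub>R w) - A 0 = L2_inner (\<lambda>y. h (y + e n *\<^sub>R w) - h y) h"
        unfolding Ain using h by (simp add: L2_inner_diff_left L2_shift)
      then show "norm (A (e n *\<^sub>R w) - A 0) \<le> L2_norm (\<lambda>x. h (x + e n *\<^sub>R w) - h x) * L2_norm h"
        by (auto intro!: L2_Cauchy_Schwarz L2_diff L2_shift h)
    qed
    show "(\<lambda>n. L2_norm (\<lambda>x. h (x + e n *\<^sub>R w) - h x) * L2_norm h) \<longlonglongrightarrow> 0"
      using tendsto_mult_right[OF L2_shift_tendsto[OF h(2) e0], of "L2_norm h"] by simp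
  qed
  let ?C = "(2 * pi) powr (3/2)"
  have key: "(LINT \<xi>|lborel. of_real ?C * (of_real (norm (fourier h \<xi>) ^ 2) * gaussian (e n *\<^sub>R \<xi>))) =
      (LINT w|lborel. A (e n *\<^sub>R w) * gaussian w)" for n
  proof -
    have "(LINT \<xi>|lborel. of_real ?C * (of_real (norm (fourier h \<xi>) ^ 2) * gaussian (e n *\<^sub>R \<xi>))) =
       (LINT \<xi>|lborel. fourier A \<xi> * gaussian (e n *\<^sub>R \<xi>))"
      by (simp only: A(2)[symmetric] mult.assoc)
    also have "\<dots> = (LINT x|lborel. A x * fourier (\<lambda>x. gaussian (e n *\<^sub>R x)) x)"
      by (rule fourier_multiplication[OF A(1) integrable_gaussian_scale[OF e]])
    also have "\<dots> = of_real (e n ^ 3) * (LINT x|lborel. A (e n *\<^sub>R x) * fourier (\<lambda>x. gaussian (e n *\<^sub>R x)) (e n *\<^sub>R x))"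
      by (rule integral_lborel_scale[OF _ e]) measurable
    also have "\<dots> = (LINT x|lborel. A (e n *\<^sub>R x) * (of_real (e n ^ 3) * fourier (\<lambda>x. gaussian (e n *\<^sub>R x)) (e n *\<^sub>R x)))"
      by (subst integral_mult_right_zero[symmetric]) (simp add: mult_ac)
    finally show ?thesis by (simp only: fourier_gaussian_scale[OF e])
  qed
  have lim: "(\<lambda>n. LINT w|lborel. A (e n *\<^sub>R w) * gaussian w) \<longlonglongrightarrow> (LINT w|lborel. A 0 * gaussian w)"
  proof (rule integral_dominated_convergence)
    show "integrable lborel (\<lambda>w. L2_norm h ^ 2 * norm (gaussian w))" using integrable_gaussian by simp
    show "AE w in lborel. (\<lambda>n. A (e n *\<^sub>R w) * gaussian w) \<longlonglongrightarrow> A 0 * gaussian w"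
      by (intro AE_I2 tendsto_mult_right Alim)
    show "AE w in lborel. norm (A (e n *\<^sub>R w) * gaussian w) \<le> L2_norm h ^ 2 * norm (gaussian w)" for n
      by (intro AE_I2) (auto simp: norm_mult intro!: mult_right_mono Ab)
  qed auto
  \<comment> \<open>The uniform bound by the L1 norm makes every regularised integrand integrable,
    as monotone convergence requires.\<close>
  have fb: "norm (fourier h \<xi>) \<le> (2 * pi) powr (- 3/2) * (LINT x|lborel. norm (h x))" for \<xi>
  proof -
    have "norm (LINT x|lborel. cis (- (x \<bullet> \<xi>)) * h x) \<le> (LINT x|lborel. norm (cis (- (x \<bullet> \<xi>)) * h x))"
      by (rule integral_norm_bound)
    then show ?thesis by (simp add: fourier_def norm_mult)
  qed
  let ?g = "\<lambda>n \<xi>. norm (fourier h \<xi>) ^ 2 * exp (- (norm (e n *\<^sub>R \<xi>))\<^sup>2 / 2)"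
  have int: "integrable lborel (?g n)" for n
  proof (rule Bochner_Integration.integrable_bound)
    show "integrable lborel (\<lambda>\<xi>. ((2 * pi) powr (- 3/2) * (LINT x|lborel. norm (h x))) ^ 2 * norm (gaussian (e n *\<^sub>R \<xi>)))"
      using integrable_gaussian_scale[OF e[of n]] by simp
    show "AE \<xi> in lborel. norm (?g n \<xi>) \<le> norm (((2 * pi) powr (- 3/2) * (LINT x|lborel. norm (h x))) ^ 2 * norm (gaussian (e n *\<^sub>R \<xi>)))"
    proof (intro AE_I2)
      fix \<xi>
      have "norm (fourier h \<xi>) ^ 2 \<le> ((2 * pi) powr (- 3/2) * (LINT x|lborel. norm (h x))) ^ 2"
        by (intro power_mono fb) auto
      then show "norm (?g n \<xi>) \<le> norm (((2 * pi) powr (- 3/2) * (LINT x|lborel. norm (h x))) ^ 2 * norm (gaussian (e n *\<^sub>R \<xi>)))"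
        by (simp add: gaussian_def abs_mult)
    qed
  qed measurable
  have glim: "(\<lambda>n. LINT \<xi>|lborel. ?g n \<xi>) \<longlonglongrightarrow> L2_norm h ^ 2"
  proof -
    have "(\<lambda>n. Re (LINT w|lborel. A (e n *\<^sub>R w) * gaussian w) / ?C) \<longlonglongrightarrow> Re (LINT w|lborel. A 0 * gaussian w) / ?C"
      by (intro tendsto_divide tendsto_Re lim tendsto_const) auto
    moreover have "Re (LINT w|lborel. A (e n *\<^sub>R w) * gaussian w) / ?C = (LINT \<xi>|lborel. ?g n \<xi>)" for n
    proof -
      have "(LINT \<xi>|lborel. of_real ?C * (of_real (norm (fourier h \<xi>) ^ 2) * gaussian (e n *\<^sub>R \<xi>))) =
         (LINT \<xi>|lborel. complex_of_real (?C * ?g n \<xi>))"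
        by (simp add: gaussian_def)
      also have "\<dots> = complex_of_real (?C * (LINT \<xi>|lborel. ?g n \<xi>))"
        by (simp only: integral_complex_of_real integral_mult_right_zero)
      finally show ?thesis unfolding key[symmetric] by simp
    qed
    moreover have "Re (LINT w|lborel. A 0 * gaussian w) / ?C = L2_norm h ^ 2"
      by (simp add: integral_gaussian A0)
    ultimately show ?thesis by simp
  qed
  have mono: "AE \<xi> in lborel. mono (\<lambda>n. ?g n \<xi>)"
  proof (intro AE_I2 monoI)
    fix \<xi> :: "real ^ 3" and m n :: nat assume "m \<le> n"
    then have "e n \<le> e m" by (simp add: e_def divide_left_mono)
    then have "norm (e n *\<^sub>R \<xi>) ^ 2 \<le> norm (e m *\<^sub>R \<xi>) ^ 2"
      using e[of n] e[of m] by (intro power_mono) (auto intro!: mult_right_mono)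
    then show "?g m \<xi> \<le> ?g n \<xi>" by (intro mult_left_mono) auto
  qed
  have ptw: "AE \<xi> in lborel. (\<lambda>n. ?g n \<xi>) \<longlonglongrightarrow> norm (fourier h \<xi>) ^ 2"
  proof (intro AE_I2)
    fix \<xi>
    have "(\<lambda>n. norm (fourier h \<xi>) ^ 2 * exp (- (norm (e n *\<^sub>R \<xi>))\<^sup>2 / 2)) \<longlonglongrightarrow> norm (fourier h \<xi>) ^ 2 * exp (- (norm (0 *\<^sub>R \<xi>))\<^sup>2 / 2)"
      unfolding e_def inverse_eq_divide[symmetric]
      by (intro tendsto_intros LIMSEQ_inverse_real_of_nat) auto
    then show "(\<lambda>n. ?g n \<xi>) \<longlonglongrightarrow> norm (fourier h \<xi>) ^ 2" by simp
  qed
  have meas: "(\<lambda>\<xi>. norm (fourier h \<xi>) ^ 2) \<in> borel_measurable lborel" by measurable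
  have I: "integrable lborel (\<lambda>\<xi>. norm (fourier h \<xi>) ^ 2)"
    by (rule integrable_monotone_convergence[OF int mono ptw glim meas])
  then show "fourier h \<in> L2" by (intro L2I) measurable
  have "L2_norm (fourier h) ^ 2 = L2_norm h ^ 2"
    unfolding L2_norm_square[of "fourier h"] by (rule integral_monotone_convergence[OF int mono ptw glim meas])
  then show "L2_norm (fourier h) = L2_norm h" by simp
qed

section \<open>Completeness of L2\<close>

lemma L2_norm_nn_integral:
  assumes "f \<in> borel_measurable borel" "(\<integral>\<^sup>+x. ennreal (norm (f x) ^ 2) \<partial>lborel) \<le> ennreal (c ^ 2)" "0 \<le> c"
  shows "f \<in> L2" and "L2_norm f \<le> c"
proof -
  have i: "integrable lborel (\<lambda>x. norm (f x) ^ 2)"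
    using assms by (intro integrableI_bounded) (auto simp: le_less_trans)
  then show "f \<in> L2" using assms(1) by (intro L2I)
  have "ennreal (L2_norm f ^ 2) \<le> ennreal (c ^ 2)"
    unfolding L2_norm_square using assms(2) by (subst nn_integral_eq_integral[symmetric]) (auto simp: i)
  then have "L2_norm f ^ 2 \<le> c ^ 2" by simp
  then show "L2_norm f \<le> c" using assms(3) by (rule power2_le_imp_le)
qed

lemma nn_integral_L2_norm:
  "f \<in> L2 \<Longrightarrow> (\<integral>\<^sup>+x. ennreal (norm (f x) ^ 2) \<partial>lborel) = ennreal (L2_norm f ^ 2)"
  unfolding L2_norm_square by (intro nn_integral_eq_integral L2_integrable_norm) auto

lemma gaussian_L2: "gaussian \<in> L2"
proof (rule L2I)
  show "integrable lborel (\<lambda>x. norm (gaussian x) ^ 2)"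
  proof (rule Bochner_Integration.integrable_bound)
    show "integrable lborel (\<lambda>x. norm (gaussian x))" using integrable_gaussian by simp
    have "norm (gaussian x) ^ 2 \<le> norm (gaussian x)" for x
      using norm_gaussian_le[of x] by (simp add: power2_eq_square mult_left_le)
    then show "AE x in lborel. norm (norm (gaussian x) ^ 2) \<le> norm (norm (gaussian x))" by simp
  qed measurable
qed measurable

text \<open>Riesz-Fischer. A fast subsequence converges almost everywhere; Fatou's lemma along it
  turns the Cauchy estimate into a bound for the distance of the whole sequence to the
  limit.\<close>

theorem L2_complete:
  fixes f :: "nat \<Rightarrow> real ^ 3 \<Rightarrow> complex"
  assumes f: "\<And>n. f n \<in> L2"
    and cauchy: "\<And>e. 0 < e \<Longrightarrow> \<exists>N. \<forall>m\<ge>N. \<forall>n\<ge>N. L2_dist (f m) (f n) < e"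
  shows "\<exists>F\<in>L2. (\<lambda>n. L2_dist (f n) F) \<longlonglongrightarrow> 0"
proof -
  have [measurable]: "f n \<in> borel_measurable borel" for n using f by (auto dest: L2_measurable)
  have "\<forall>k. \<exists>N. \<forall>m\<ge>N. \<forall>n\<ge>N. L2_dist (f m) (f n) < (1 / 2) ^ k"
    by (intro allI cauchy) simp
  then obtain N where N: "\<And>k m n. m \<ge> N k \<Longrightarrow> n \<ge> N k \<Longrightarrow> L2_dist (f m) (f n) < (1 / 2) ^ k"
    by metis
  \<comment> \<open>Cumulated sums instead of \<open>N\<close>: \<open>r k\<close> is at least
    \<open>N i\<close> for all i \<le> k, which serves for consecutive indices as well as for all
    late k in the Fatou step.\<close>
  define r where "r = (\<lambda>k. \<Sum>i\<le>k. N i)"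
  have rN: "N k \<le> r k" "N k \<le> r (Suc k)" for k
    unfolding r_def by (rule member_le_sum; simp)+
  define d where "d = (\<lambda>k x. f (r (Suc k)) x - f (r k) x)"
  have dL2: "d k \<in> L2" for k unfolding d_def by (intro L2_diff f)
  then have [measurable]: "d k \<in> borel_measurable borel" for k by (auto dest: L2_measurable)
  \<comment> \<open>The Gaussian weight turns the \<open>L\<^sup>2\<close> bounds into \<open>L\<^sup>1\<close> bounds.\<close>
  have I: "(\<integral>\<^sup>+x. ennreal (norm (d k x) * norm (gaussian x)) \<partial>lborel) \<le> ennreal ((1 / 2) ^ k * L2_norm gaussian)" for k
  proof -
    have "(\<integral>\<^sup>+x. ennreal (norm (d k x) * norm (gaussian x)) \<partial>lborel) = ennreal (LINT x|lborel. norm (d k x) * norm (gaussian x))"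
      by (intro nn_integral_eq_integral L2_integrable_norm_mult dL2 gaussian_L2) auto
    also have "\<dots> \<le> ennreal ((1 / 2) ^ k * L2_norm gaussian)"
    proof (intro ennreal_leI)
      have "L2_norm (d k) \<le> (1 / 2) ^ k" unfolding d_def using N[OF rN(2) rN(1), of k] by simp
      then have "L2_norm (d k) * L2_norm gaussian \<le> (1 / 2) ^ k * L2_norm gaussian"
        by (intro mult_right_mono) auto
      with L2_Cauchy_Schwarz_norm[OF dL2 gaussian_L2, of k]
      show "(LINT x|lborel. norm (d k x) * norm (gaussian x)) \<le> (1 / 2) ^ k * L2_norm gaussian" by linarith
    qed
    finally show ?thesis .
  qed
  have "(\<integral>\<^sup>+x. (\<Sum>k. ennreal (norm (d k x) * norm (gaussian x))) \<partial>lborel) =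
     (\<Sum>k. \<integral>\<^sup>+x. ennreal (norm (d k x) * norm (gaussian x)) \<partial>lborel)"
    by (rule nn_integral_suminf) measurable
  also have "\<dots> \<le> (\<Sum>k. ennreal ((1 / 2) ^ k * L2_norm gaussian))"
    by (intro suminf_le I) auto
  also have "\<dots> = ennreal (\<Sum>k. (1 / 2) ^ k * L2_norm gaussian)"
    by (intro suminf_ennreal2 summable_mult2 summable_geometric) auto
  finally have fin: "(\<integral>\<^sup>+x. (\<Sum>k. ennreal (norm (d k x) * norm (gaussian x))) \<partial>lborel) \<noteq> \<infinity>"
    by (auto simp: top_unique)
  have "AE x in lborel. (\<Sum>k. ennreal (norm (d k x) * norm (gaussian x))) \<noteq> \<infinity>"
    by (rule nn_integral_PInf_AE[OF _ fin]) measurable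
  then have conv: "AE x in lborel. convergent (\<lambda>k. f (r k) x)"
  proof eventually_elim
    case (elim x)
    then have "summable (\<lambda>k. norm (d k x) * norm (gaussian x))"
      by (intro summable_suminf_not_top) auto
    from summable_mult2[OF this, of "1 / norm (gaussian x)"] have "summable (\<lambda>k. norm (d k x))"
      by (simp add: gaussian_def)
    then have "summable (\<lambda>k. d k x)" by (rule summable_norm_cancel)
    then have "convergent (\<lambda>n. \<Sum>k<n. d k x)" by (simp add: summable_iff_convergent)
    moreover have "(\<Sum>k<n. d k x) = f (r n) x - f (r 0) x" for n
      unfolding d_def by (rule sum_lessThan_telescope)
    ultimately have "convergent (\<lambda>n. (f (r n) x - f (r 0) x) + f (r 0) x)"
      by (intro convergent_add convergent_const) auto
    then show ?case by simp
  qed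
  define F where "F = (\<lambda>x. lim (\<lambda>k. f (r k) x))"
  have [measurable]: "F \<in> borel_measurable borel"
    unfolding F_def by measurable
  have lim: "AE x in lborel. (\<lambda>k. f (r k) x) \<longlonglongrightarrow> F x"
    using conv unfolding F_def by (simp add: convergent_LIMSEQ_iff)
  have tail: "(\<lambda>x. f n x - F x) \<in> L2 \<and> L2_dist (f n) F \<le> (1 / 2) ^ j" if "n \<ge> N j" for n j
  proof -
    have "(\<integral>\<^sup>+x. ennreal (norm (f n x - F x) ^ 2) \<partial>lborel) = (\<integral>\<^sup>+x. liminf (\<lambda>k. ennreal (norm (f n x - f (r k) x) ^ 2)) \<partial>lborel)"
    proof (rule nn_integral_cong_AE)
      show "AE x in lborel. ennreal (norm (f n x - F x) ^ 2) = liminf (\<lambda>k. ennreal (norm (f n x - f (r k) x) ^ 2))"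
        using lim
      proof eventually_elim
        case (elim x)
        have "(\<lambda>k. ennreal (norm (f n x - f (r k) x) ^ 2)) \<longlonglongrightarrow> ennreal (norm (f n x - F x) ^ 2)"
          by (intro tendsto_intros elim)
        from lim_imp_Liminf[OF _ this] show ?case by simp
      qed
    qed
    also have "\<dots> \<le> liminf (\<lambda>k. \<integral>\<^sup>+x. ennreal (norm (f n x - f (r k) x) ^ 2) \<partial>lborel)"
      by (rule nn_integral_liminf) measurable
    also have "\<dots> \<le> ennreal (((1 / 2) ^ j) ^ 2)"
    proof (rule Liminf_le)
      show "\<forall>\<^sub>F k in sequentially. (\<integral>\<^sup>+x. ennreal (norm (f n x - f (r k) x) ^ 2) \<partial>lborel) \<le> ennreal (((1 / 2) ^ j) ^ 2)"
        using eventually_ge_at_top[of j]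
      proof eventually_elim
        case (elim k)
        then have "N j \<le> r k" unfolding r_def by (intro member_le_sum) auto
        with N[OF that this] show ?case
          unfolding nn_integral_L2_norm[OF L2_diff[OF f f]]
          by (intro ennreal_leI power_mono) auto
      qed
    qed auto
    finally have b: "(\<integral>\<^sup>+x. ennreal (norm (f n x - F x) ^ 2) \<partial>lborel) \<le> ennreal (((1 / 2) ^ j) ^ 2)" .
    show ?thesis using L2_norm_nn_integral[OF _ b] by auto
  qed
  have "(\<lambda>x. f (N 0) x - (f (N 0) x - F x)) \<in> L2"
    by (rule L2_diff[OF f conjunct1[OF tail[OF order_refl]]])
  then have "F \<in> L2" by simp
  moreover have "(\<lambda>n. L2_dist (f n) F) \<longlonglongrightarrow> 0"
  proof (rule LIMSEQ_I)
    fix e :: real assume "0 < e"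
    then obtain j where "(1 / 2) ^ j < e" using real_arch_pow_inv[of e "1 / 2"] by auto
    then have "norm (L2_dist (f n) F - 0) < e" if "n \<ge> N j" for n
      using tail[OF that] by auto
    then show "\<exists>N. \<forall>n\<ge>N. norm (L2_dist (f n) F - 0) < e" by blast
  qed
  ultimately show ?thesis by blast
qed

section \<open>The Fourier transform on L2\<close>

lemma L2_inner_tendsto:
  assumes "\<And>n. h n \<in> L2" "\<And>n. k n \<in> L2" "f \<in> L2" "g \<in> L2"
    and h: "(\<lambda>n. L2_dist (h n) f) \<longlonglongrightarrow> 0" and k: "(\<lambda>n. L2_dist (k n) g) \<longlonglongrightarrow> 0"
  shows "(\<lambda>n. L2_inner (h n) (k n)) \<longlonglongrightarrow> L2_inner f g"
proof (rule LIM_zero_cancel, rule Lim_null_comparison)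
  let ?b = "\<lambda>n. L2_dist (h n) f * (L2_dist (k n) g + L2_norm g) + L2_norm f * L2_dist (k n) g"
  show "\<forall>\<^sub>F n in sequentially. norm (L2_inner (h n) (k n) - L2_inner f g) \<le> ?b n"
  proof (intro always_eventually allI)
    fix n
    have "L2_inner (h n) (k n) - L2_inner f g = L2_inner (\<lambda>x. h n x - f x) (k n) + L2_inner f (\<lambda>x. k n x - g x)"
      using assms by (simp add: L2_inner_diff_left L2_inner_diff_right)
    also have "norm \<dots> \<le> L2_dist (h n) f * L2_norm (k n) + L2_norm f * L2_dist (k n) g"
      by (intro norm_triangle_mono L2_Cauchy_Schwarz L2_diff assms)
    also have "\<dots> \<le> ?b n"
      using L2_norm_diff_le[OF assms(2)[of n] assms(4)] by (intro add_right_mono mult_left_mono) auto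
    finally show "norm (L2_inner (h n) (k n) - L2_inner f g) \<le> ?b n" .
  qed
  have "?b \<longlonglongrightarrow> 0 * (0 + L2_norm g) + L2_norm f * 0"
    by (intro tendsto_intros h k)
  then show "?b \<longlonglongrightarrow> 0" by simp
qed

lemma L2_norm_tendsto:
  assumes "\<And>n. h n \<in> L2" "f \<in> L2" and h: "(\<lambda>n. L2_dist (h n) f) \<longlonglongrightarrow> 0"
  shows "(\<lambda>n. L2_norm (h n)) \<longlonglongrightarrow> L2_norm (f :: real ^ 3 \<Rightarrow> complex)"
  by (rule LIM_zero_cancel, rule Lim_null_comparison[OF _ h])
     (use L2_norm_diff_le[OF assms(1,2)] in auto)

lemma L2_fourierE:
  assumes "L2_fourier f F"
  obtains h where "\<And>n. integrable lborel (h n)" "\<And>n. h n \<in> L2" "\<And>n. fourier (h n) \<in> L2"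
    "(\<lambda>n. L2_dist (h n) f) \<longlonglongrightarrow> 0" "(\<lambda>n. L2_norm (\<lambda>\<xi>. fourier (h n) \<xi> - F \<xi>)) \<longlonglongrightarrow> 0"
  using assms unfolding L2_fourier_def by auto

lemma L2_fourier_L2: "L2_fourier f F \<Longrightarrow> f \<in> L2" "L2_fourier f F \<Longrightarrow> F \<in> L2"
  by (auto simp: L2_fourier_def)

lemma L2_fourier_isometry:
  assumes "L2_fourier f F" shows "L2_norm F = L2_norm f"
proof -
  obtain h where h: "\<And>n. integrable lborel (h n)" "\<And>n. h n \<in> L2" "\<And>n. fourier (h n) \<in> L2"
    "(\<lambda>n. L2_dist (h n) f) \<longlonglongrightarrow> 0" "(\<lambda>n. L2_norm (\<lambda>\<xi>. fourier (h n) \<xi> - F \<xi>)) \<longlonglongrightarrow> 0"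
    using L2_fourierE[OF assms] by blast
  have "(\<lambda>n. L2_norm (h n)) \<longlonglongrightarrow> L2_norm f"
    by (rule L2_norm_tendsto[OF h(2) L2_fourier_L2(1)[OF assms] h(4)])
  moreover have "(\<lambda>n. L2_norm (fourier (h n))) \<longlonglongrightarrow> L2_norm F"
    by (rule L2_norm_tendsto[OF h(3) L2_fourier_L2(2)[OF assms] h(5)])
  ultimately show ?thesis
    using LIMSEQ_unique by (auto simp: Plancherel(2)[OF h(1,2)])
qed

lemma L2_fourier_cong_AE:
  assumes "L2_fourier f F" "f' \<in> L2" "F' \<in> L2" "AE x in lborel. f x = f' x" "AE x in lborel. F x = F' x"
  shows "L2_fourier f' F'"
proof -
  obtain h where h: "\<And>n. integrable lborel (h n)" "\<And>n. h n \<in> L2" "\<And>n. fourier (h n) \<in> L2"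
    "(\<lambda>n. L2_dist (h n) f) \<longlonglongrightarrow> 0" "(\<lambda>n. L2_norm (\<lambda>\<xi>. fourier (h n) \<xi> - F \<xi>)) \<longlonglongrightarrow> 0"
    using L2_fourierE[OF assms(1)] by blast
  have [measurable]: "f \<in> borel_measurable borel" "f' \<in> borel_measurable borel" "F \<in> borel_measurable borel" "F' \<in> borel_measurable borel"
    "h n \<in> borel_measurable borel" for n
    using assms h L2_fourier_L2[OF assms(1)] by (auto dest: L2_measurable)
  have "L2_dist (h n) f = L2_dist (h n) f'" for n
    by (rule L2_norm_cong_AE) (use assms(4) in auto)
  moreover have "L2_norm (\<lambda>\<xi>. fourier (h n) \<xi> - F \<xi>) = L2_norm (\<lambda>\<xi>. fourier (h n) \<xi> - F' \<xi>)" for n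
    by (rule L2_norm_cong_AE) (use assms(5) in auto)
  ultimately show ?thesis
    unfolding L2_fourier_def using assms h by (intro conjI exI[of _ h]) auto
qed

lemma L2_fourier_add_cmult:
  assumes "L2_fourier f F" "L2_fourier g G"
  shows "L2_fourier (\<lambda>x. f x + c * g x) (\<lambda>\<xi>. F \<xi> + c * G \<xi>)"
proof -
  obtain h where h: "\<And>n. integrable lborel (h n)" "\<And>n. h n \<in> L2" "\<And>n. fourier (h n) \<in> L2"
    "(\<lambda>n. L2_dist (h n) f) \<longlonglongrightarrow> 0" "(\<lambda>n. L2_norm (\<lambda>\<xi>. fourier (h n) \<xi> - F \<xi>)) \<longlonglongrightarrow> 0"
    using L2_fourierE[OF assms(1)] by blast
  obtain k where k: "\<And>n. integrable lborel (k n)" "\<And>n. k n \<in> L2" "\<And>n. fourier (k n) \<in> L2"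
    "(\<lambda>n. L2_dist (k n) g) \<longlonglongrightarrow> 0" "(\<lambda>n. L2_norm (\<lambda>\<xi>. fourier (k n) \<xi> - G \<xi>)) \<longlonglongrightarrow> 0"
    using L2_fourierE[OF assms(2)] by blast
  note L2 = L2_fourier_L2[OF assms(1)] L2_fourier_L2[OF assms(2)]
  have four: "fourier (\<lambda>x. h n x + c * k n x) = (\<lambda>\<xi>. fourier (h n) \<xi> + c * fourier (k n) \<xi>)" for n
    using h(1)[of n] k(1)[of n] by (simp add: fourier_add fourier_cmult fun_eq_iff)
  have lim: "(\<lambda>n. L2_norm (\<lambda>x. a n x + c * b n x - (A x + c * B x))) \<longlonglongrightarrow> 0"
    if "\<And>n. a n \<in> L2" "\<And>n. b n \<in> L2" "A \<in> L2" "B \<in> L2"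
       "(\<lambda>n. L2_dist (a n) A) \<longlonglongrightarrow> 0" "(\<lambda>n. L2_dist (b n) B) \<longlonglongrightarrow> 0"
    for a b and A B :: "real ^ 3 \<Rightarrow> complex"
  proof (rule Lim_null_comparison)
    show "\<forall>\<^sub>F n in sequentially. norm (L2_norm (\<lambda>x. a n x + c * b n x - (A x + c * B x))) \<le>
        L2_dist (a n) A + norm c * L2_dist (b n) B"
    proof (intro always_eventually allI)
      fix n
      have "L2_norm (\<lambda>x. (a n x - A x) + c * (b n x - B x)) \<le> L2_dist (a n) A + L2_norm (\<lambda>x. c * (b n x - B x))"
        by (intro L2_norm_triangle L2_diff L2_cmult that)
      then show "norm (L2_norm (\<lambda>x. a n x + c * b n x - (A x + c * B x))) \<le>
        L2_dist (a n) A + norm c * L2_dist (b n) B"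
        unfolding L2_norm_cmult by (simp add: algebra_simps)
    qed
    show "(\<lambda>n. L2_dist (a n) A + norm c * L2_dist (b n) B) \<longlonglongrightarrow> 0"
      using tendsto_add[OF that(5) tendsto_mult_right[OF that(6), of "norm c"]] by (simp add: mult.commute)
  qed
  show ?thesis
    unfolding L2_fourier_def
  proof (intro conjI exI[of _ "\<lambda>n x. h n x + c * k n x"] allI)
    show "(\<lambda>n. L2_norm (\<lambda>\<xi>. fourier (\<lambda>x. h n x + c * k n x) \<xi> - (F \<xi> + c * G \<xi>))) \<longlonglongrightarrow> 0"
      unfolding four by (rule lim[OF h(3) k(3) L2(2,4) h(5) k(5)])
    show "(\<lambda>n. L2_norm (\<lambda>x. h n x + c * k n x - (f x + c * g x))) \<longlonglongrightarrow> 0"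
      by (rule lim[OF h(2) k(2) L2(1,3) h(4) k(4)])
  qed (use h k L2 in \<open>auto simp: four intro!: L2_add L2_cmult\<close>)
qed

lemma L2_fourier_cmult:
  assumes "L2_fourier f F" shows "L2_fourier (\<lambda>x. c * f x) (\<lambda>\<xi>. c * F \<xi>)"
  using L2_fourier_add_cmult[OF assms assms, of "c - 1"] by (simp add: algebra_simps)

text \<open>Polarisation: the norm of f + c g is preserved, and c = 1 and c = i recover the real and
  the imaginary part.\<close>

lemma L2_fourier_inner:
  assumes "L2_fourier f F" "L2_fourier g G"
  shows "L2_inner F G = L2_inner f g"
proof -
  note L2 = L2_fourier_L2[OF assms(1)] L2_fourier_L2[OF assms(2)]
  have *: "Re (L2_inner F (\<lambda>x. c * G x)) = Re (L2_inner f (\<lambda>x. c * g x))" for c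
    using L2_norm_square_add[OF L2(2) L2_cmult[OF L2(4), of c]] L2_norm_square_add[OF L2(1) L2_cmult[OF L2(3), of c]]
      L2_fourier_isometry[OF L2_fourier_add_cmult[OF assms, of c]] L2_fourier_isometry[OF assms(1)]
      L2_fourier_isometry[OF L2_fourier_cmult[OF assms(2), of c]] by simp
  show ?thesis
    using *[of 1] *[of \<i>] by (intro complex_eqI) (auto simp: L2_inner_cmult_right)
qed

lemma L2_fourier_unique:
  assumes "L2_fourier f F" "L2_fourier f' F'" "AE x in lborel. f x = f' x"
  shows "AE \<xi> in lborel. F \<xi> = F' \<xi>"
proof -
  note L2 = L2_fourier_L2[OF assms(1)] L2_fourier_L2[OF assms(2)]
  have "L2_norm (\<lambda>\<xi>. F \<xi> + (-1) * F' \<xi>) = L2_norm (\<lambda>x. f x + (-1) * f' x)"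
    by (rule L2_fourier_isometry[OF L2_fourier_add_cmult[OF assms(1,2)]])
  also have "\<dots> = 0"
    using assms(3) L2_norm_eq_0_iff[OF L2_diff[OF L2(1,3)]] by simp
  finally show ?thesis using L2_norm_eq_0_iff[OF L2_diff[OF L2(2,4)]] by simp
qed

text \<open>Truncations to balls are integrable because balls have finite measure. By Plancherel
  their transforms form a Cauchy sequence, and completeness supplies the limit.\<close>

theorem L2_fourier_exists:
  assumes f: "f \<in> L2" shows "\<exists>F. L2_fourier f F"
proof -
  have [measurable]: "f \<in> borel_measurable borel" using f by (auto dest: L2_measurable)
  define h where "h = (\<lambda>n x. complex_of_real (indicator (cball 0 (real n)) x) * f x)"
  have ind: "(\<lambda>x. complex_of_real (indicator (cball (0 :: real ^ 3) (real n)) x)) \<in> L2" for n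
    using emeasure_bounded_finite[of "cball (0 :: real ^ 3) (real n)"] by (intro indicator_L2) auto
  have h: "integrable lborel (h n)" "h n \<in> L2" for n
  proof -
    show "integrable lborel (h n)" unfolding h_def by (rule L2_integrable_mult[OF ind f])
    show "h n \<in> L2" unfolding h_def
      by (rule L2_mult_bounded[OF f L2_measurable[OF ind], where c=1]) (simp add: indicator_def)
  qed
  have lim: "(\<lambda>n. L2_dist (h n) f) \<longlonglongrightarrow> 0"
  proof (rule L2_norm_tendsto_0_dominated[OF _ f, where c=1])
    show "(\<lambda>x. h n x - f x) \<in> borel_measurable borel" for n
      using L2_measurable[OF L2_diff[OF h(2) f]] .
    show "AE x in lborel. (\<lambda>n. h n x - f x) \<longlonglongrightarrow> 0"
    proof (intro AE_I2)
      fix x :: "real ^ 3"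
      obtain N where N: "norm x < real N" using reals_Archimedean2 by blast
      have "\<forall>\<^sub>F n in sequentially. 0 = h n x - f x"
        using eventually_ge_at_top[of N] by eventually_elim (use N in \<open>auto simp: h_def\<close>)
      then show "(\<lambda>n. h n x - f x) \<longlonglongrightarrow> 0" by (rule Lim_transform_eventually[OF tendsto_const])
    qed
    show "norm (h n x - f x) \<le> 1 * norm (f x)" for n x by (auto simp: h_def indicator_def)
  qed
  have diff: "L2_norm (\<lambda>\<xi>. fourier (h m) \<xi> - fourier (h n) \<xi>) = L2_dist (h m) (h n)" for m n
  proof -
    have "fourier (\<lambda>x. h m x - h n x) = (\<lambda>\<xi>. fourier (h m) \<xi> - fourier (h n) \<xi>)"
      using h(1) by (simp add: fourier_diff fun_eq_iff)
    then show ?thesis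
      using Plancherel(2)[of "\<lambda>x. h m x - h n x"] h by (simp add: L2_diff)
  qed
  have "\<exists>F\<in>L2. (\<lambda>n. L2_norm (\<lambda>\<xi>. fourier (h n) \<xi> - F \<xi>)) \<longlonglongrightarrow> 0"
  proof (rule L2_complete)
    show "fourier (h n) \<in> L2" for n by (rule Plancherel(1)[OF h])
    fix e :: real assume "0 < e"
    then obtain N where N: "\<And>n. n \<ge> N \<Longrightarrow> L2_dist (h n) f < e / 2"
      using order_tendstoD(2)[OF lim, of "e / 2"] by (auto simp: eventually_sequentially)
    have "L2_norm (\<lambda>\<xi>. fourier (h m) \<xi> - fourier (h n) \<xi>) < e" if "m \<ge> N" "n \<ge> N" for m n
      using L2_norm_triangle_diff[OF h(2)[of m] f h(2)[of n]] N[OF that(1)] N[OF that(2)]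
      unfolding diff by (simp add: L2_norm_minus_commute[of f])
    then show "\<exists>N. \<forall>m\<ge>N. \<forall>n\<ge>N. L2_norm (\<lambda>\<xi>. fourier (h m) \<xi> - fourier (h n) \<xi>) < e" by blast
  qed
  then obtain F where "F \<in> L2" "(\<lambda>n. L2_norm (\<lambda>\<xi>. fourier (h n) \<xi> - F \<xi>)) \<longlonglongrightarrow> 0" by blast
  then have "L2_fourier f F"
    unfolding L2_fourier_def using h f lim Plancherel(1)[OF h] by (intro conjI exI[of _ h]) auto
  then show ?thesis by blast
qed

lemma L2_reflect:
  fixes f :: "real ^ 3 \<Rightarrow> complex"
  assumes "f \<in> L2" shows "(\<lambda>x. f (- x)) \<in> L2" and "L2_norm (\<lambda>x. f (- x)) = L2_norm f"
proof -
  have [measurable]: "f \<in> borel_measurable borel" using assms by (auto dest: L2_measurable)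
  show "(\<lambda>x. f (- x)) \<in> L2"
    using L2_integrable_norm[OF assms] integrable_lborel_uminus[of "\<lambda>x. norm (f x) ^ 2"]
    by (intro L2I) auto
  show "L2_norm (\<lambda>x. f (- x)) = L2_norm f"
    unfolding L2_norm_def by (subst integral_lborel_uminus[of "\<lambda>x. norm (f x) ^ 2"]) auto
qed

lemma L2_fourier_cnj:
  assumes "L2_fourier f F" shows "L2_fourier (\<lambda>x. cnj (f x)) (\<lambda>\<xi>. cnj (F (- \<xi>)))"
proof -
  obtain h where h: "\<And>n. integrable lborel (h n)" "\<And>n. h n \<in> L2" "\<And>n. fourier (h n) \<in> L2"
    "(\<lambda>n. L2_dist (h n) f) \<longlonglongrightarrow> 0" "(\<lambda>n. L2_norm (\<lambda>\<xi>. fourier (h n) \<xi> - F \<xi>)) \<longlonglongrightarrow> 0"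
    using L2_fourierE[OF assms] by blast
  note L2 = L2_fourier_L2[OF assms]
  have "L2_norm (\<lambda>x. cnj (h n x) - cnj (f x)) = L2_dist (h n) f" for n
    by (rule L2_norm_cong) (simp flip: complex_cnj_diff)
  moreover have "L2_norm (\<lambda>\<xi>. fourier (\<lambda>x. cnj (h n x)) \<xi> - cnj (F (- \<xi>))) = L2_norm (\<lambda>\<xi>. fourier (h n) \<xi> - F \<xi>)" for n
    unfolding fourier_cnj L2_reflect(2)[OF L2_diff[OF h(3)[of n] L2(2)], symmetric]
    by (rule L2_norm_cong) (simp flip: complex_cnj_diff)
  moreover have "fourier (\<lambda>x. cnj (h n x)) \<in> L2" for n
    using L2_cnj[OF L2_reflect(1)[OF h(3)[of n]]] by (simp add: fourier_cnj[abs_def])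
  ultimately show ?thesis
    unfolding L2_fourier_def using h L2
    by (intro conjI exI[of _ "\<lambda>n x. cnj (h n x)"] allI) (auto intro!: L2_cnj L2_reflect(1))
qed

text \<open>The conjugates cancel the one inside \<open>L2_inner\<close>, so both sides are the
  bilinear integrals of \<open>fourier_multiplication\<close>, passed to the limit.\<close>

lemma L2_fourier_multiplication:
  assumes "L2_fourier f F" "L2_fourier g G"
  shows "L2_inner F (\<lambda>x. cnj (g x)) = L2_inner f (\<lambda>x. cnj (G x))"
proof -
  obtain h where h: "\<And>n. integrable lborel (h n)" "\<And>n. h n \<in> L2" "\<And>n. fourier (h n) \<in> L2"
    "(\<lambda>n. L2_dist (h n) f) \<longlonglongrightarrow> 0" "(\<lambda>n. L2_norm (\<lambda>\<xi>. fourier (h n) \<xi> - F \<xi>)) \<longlonglongrightarrow> 0"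
    using L2_fourierE[OF assms(1)] by blast
  obtain k where k: "\<And>n. integrable lborel (k n)" "\<And>n. k n \<in> L2" "\<And>n. fourier (k n) \<in> L2"
    "(\<lambda>n. L2_dist (k n) g) \<longlonglongrightarrow> 0" "(\<lambda>n. L2_norm (\<lambda>\<xi>. fourier (k n) \<xi> - G \<xi>)) \<longlonglongrightarrow> 0"
    using L2_fourierE[OF assms(2)] by blast
  note L2 = L2_fourier_L2[OF assms(1)] L2_fourier_L2[OF assms(2)]
  have cnj: "(\<lambda>n. L2_norm (\<lambda>x. cnj (a n x) - cnj (b x))) \<longlonglongrightarrow> 0"
    if "(\<lambda>n. L2_dist (a n) b) \<longlonglongrightarrow> 0" for a and b :: "real ^ 3 \<Rightarrow> complex"
  proof -
    have "L2_norm (\<lambda>x. cnj (a n x) - cnj (b x)) = L2_dist (a n) b" for n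
      by (rule L2_norm_cong) (simp flip: complex_cnj_diff)
    then show ?thesis using that by simp
  qed
  have "(\<lambda>n. L2_inner (fourier (h n)) (\<lambda>x. cnj (k n x))) \<longlonglongrightarrow> L2_inner F (\<lambda>x. cnj (g x))"
    by (intro L2_inner_tendsto h L2_cnj k L2 cnj)
  moreover have "(\<lambda>n. L2_inner (h n) (\<lambda>x. cnj (fourier (k n) x))) \<longlonglongrightarrow> L2_inner f (\<lambda>x. cnj (G x))"
    by (intro L2_inner_tendsto h L2_cnj k L2 cnj)
  moreover have "L2_inner (fourier (h n)) (\<lambda>x. cnj (k n x)) = L2_inner (h n) (\<lambda>x. cnj (fourier (k n) x))" for n
    using fourier_multiplication[OF h(1) k(1), of n n] by (simp add: L2_inner_def)
  ultimately show ?thesis using LIMSEQ_unique by simp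
qed

text \<open>
  The multiplication formula identifies the adjoint of the Fourier transform, which is again an
  isometry; an isometry with isometric adjoint is onto.
\<close>
theorem L2_fourier_onto:
  assumes F: "F \<in> L2" shows "\<exists>f. L2_fourier f F"
proof -
  obtain K where K: "L2_fourier F K" using L2_fourier_exists[OF F] ..
  \<comment> \<open>The candidate for the inverse transform of F is its reflected transform. The
    transform E of u has the norm of F and satisfies <E, F> = ||F||^2, so ||E - F|| = 0.\<close>
  define u where "u = (\<lambda>x. K (- x))"
  have u: "u \<in> L2" "L2_norm u = L2_norm F"
    using L2_reflect[OF L2_fourier_L2(2)[OF K]] L2_fourier_isometry[OF K] by (auto simp: u_def)
  obtain E where E: "L2_fourier u E" using L2_fourier_exists[OF u(1)] ..
  have "L2_inner E (\<lambda>x. cnj (cnj (F x))) = L2_inner u (\<lambda>x. cnj (cnj (K (- x))))"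
    by (rule L2_fourier_multiplication[OF E L2_fourier_cnj[OF K]])
  then have "L2_inner E F = of_real (L2_norm F ^ 2)"
    by (simp add: L2_inner_self[of u] u(2) flip: u_def)
  then have "L2_dist E F ^ 2 = 0"
    using L2_norm_square_diff[OF L2_fourier_L2(2)[OF E] F] L2_fourier_isometry[OF E] u(2) by simp
  then have "AE x in lborel. E x = F x"
    using L2_norm_eq_0_iff[OF L2_diff[OF L2_fourier_L2(2)[OF E] F]] by simp
  then have "L2_fourier u F" by (intro L2_fourier_cong_AE[OF E u(1) F]) auto
  then show ?thesis by blast
qed

lemma L2_modulate_shift:
  assumes f: "f \<in> L2"
  shows "(\<lambda>x. cis (\<xi>0 \<bullet> x + c) * f (x - a)) \<in> L2"
    and "L2_norm (\<lambda>x. cis (\<xi>0 \<bullet> x + c) * f (x - a)) = L2_norm f"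
proof -
  have [measurable]: "f \<in> borel_measurable borel" using f by (auto dest: L2_measurable)
  show "(\<lambda>x. cis (\<xi>0 \<bullet> x + c) * f (x - a)) \<in> L2"
    using L2_shift[OF f, of "- a"] by (intro L2_mult_bounded[where c=1]) auto
  have "L2_norm (\<lambda>x. cis (\<xi>0 \<bullet> x + c) * f (x - a)) = L2_norm (\<lambda>x. f (x + - a))"
    by (rule L2_norm_cong) (simp add: norm_mult)
  also have "\<dots> = L2_norm f" by (rule L2_norm_shift) measurable
  finally show "L2_norm (\<lambda>x. cis (\<xi>0 \<bullet> x + c) * f (x - a)) = L2_norm f" .
qed

lemma L2_fourier_modulate_shift:
  assumes "L2_fourier f F"
  shows "L2_fourier (\<lambda>x. cis (\<xi>0 \<bullet> x + c) * f (x - a)) (\<lambda>\<xi>. cis (c - a \<bullet> (\<xi> - \<xi>0)) * F (\<xi> - \<xi>0))"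
proof -
  obtain h where h: "\<And>n. integrable lborel (h n)" "\<And>n. h n \<in> L2" "\<And>n. fourier (h n) \<in> L2"
    "(\<lambda>n. L2_dist (h n) f) \<longlonglongrightarrow> 0" "(\<lambda>n. L2_norm (\<lambda>\<xi>. fourier (h n) \<xi> - F \<xi>)) \<longlonglongrightarrow> 0"
    using L2_fourierE[OF assms] by blast
  note L2 = L2_fourier_L2[OF assms]
  \<comment> \<open>On the Fourier side the operation is again a modulation, of frequency - a,
    composed with a shift by \<xi>0, so \<open>L2_modulate_shift\<close> gives the isometry there as
    well.\<close>
  have eq: "(\<lambda>\<xi>. cis (c - a \<bullet> (\<xi> - \<xi>0)) * K (\<xi> - \<xi>0)) = (\<lambda>\<xi>. cis (- a \<bullet> \<xi> + (c + a \<bullet> \<xi>0)) * K (\<xi> - \<xi>0))" for K :: "real ^ 3 \<Rightarrow> complex"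
    by (simp add: inner_diff_right algebra_simps)
  have four: "fourier (\<lambda>x. cis (\<xi>0 \<bullet> x + c) * h n (x - a)) = (\<lambda>\<xi>. cis (- a \<bullet> \<xi> + (c + a \<bullet> \<xi>0)) * fourier (h n) (\<xi> - \<xi>0))" for n
    using h(2)[of n] fourier_modulate_shift[of "h n" \<xi>0 c a] unfolding eq[symmetric] by (auto dest: L2_measurable)
  have "L2_norm (\<lambda>x. cis (\<xi>0 \<bullet> x + c) * h n (x - a) - cis (\<xi>0 \<bullet> x + c) * f (x - a)) = L2_dist (h n) f" for n
    using L2_modulate_shift(2)[OF L2_diff[OF h(2)[of n] L2(1)], of \<xi>0 c a] by (simp add: right_diff_distrib)
  moreover have "L2_norm (\<lambda>\<xi>. cis (- a \<bullet> \<xi> + (c + a \<bullet> \<xi>0)) * fourier (h n) (\<xi> - \<xi>0) - cis (- a \<bullet> \<xi> + (c + a \<bullet> \<xi>0)) * F (\<xi> - \<xi>0))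
      = L2_norm (\<lambda>\<xi>. fourier (h n) \<xi> - F \<xi>)" for n
    using L2_modulate_shift(2)[OF L2_diff[OF h(3)[of n] L2(2)], of "- a" "c + a \<bullet> \<xi>0" \<xi>0] by (simp add: right_diff_distrib)
  moreover have "integrable lborel (\<lambda>x. cis (\<xi>0 \<bullet> x + c) * h n (x - a))" for n
    using h(1)[of n] integrable_lborel_shift[of "h n" "- a"] by (intro integrable_cis_mult) auto
  ultimately show ?thesis
    unfolding L2_fourier_def eq
    using L2_modulate_shift(1)[OF L2(1)] L2_modulate_shift(1)[OF L2(2), of "- a" "c + a \<bullet> \<xi>0" \<xi>0] h
      L2_modulate_shift(1)[OF h(2)] L2_modulate_shift(1)[OF h(3), of "- a" "c + a \<bullet> \<xi>0" _ \<xi>0]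
    by (intro conjI exI[of _ "\<lambda>n x. cis (\<xi>0 \<bullet> x + c) * h n (x - a)"] allI) (auto simp: four)
qed

section \<open>Weak gradients\<close>

lemma partial_mult:
  "smooth_fun f \<Longrightarrow> smooth_fun g \<Longrightarrow> partial j (\<lambda>x. f x * g x) x = f x * partial j g x + partial j f x * g x"
  by (rule has_derivative_partials_unique[OF smooth_fun_mult_has_derivative])

lemma partial_cis: "partial j (\<lambda>x. c * cis (\<xi> \<bullet> x)) x = \<i> * of_real (\<xi> $ j) * c * cis (\<xi> \<bullet> x)"
  by (rule has_derivative_partials_unique[OF cis_has_derivative])

lemma partial_shift: "smooth_fun f \<Longrightarrow> partial j (\<lambda>x. f (x + a)) x = partial j f (x + a)"
  by (rule has_derivative_partials_unique[OF smooth_fun_shift_has_derivative])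

lemma borel_measurable_vec_nth [measurable (raw)]:
  fixes f :: "'a \<Rightarrow> ('b::topological_space) ^ 'n"
  assumes "f \<in> borel_measurable M" shows "(\<lambda>x. f x $ i) \<in> borel_measurable M"
proof (rule measurable_compose[OF assms])
  show "(\<lambda>v :: 'b ^ 'n. v $ i) \<in> borel_measurable borel"
    by (intro borel_measurable_continuous_onI continuous_intros)
qed

lemma L2_nth:
  fixes g :: "real ^ 3 \<Rightarrow> complex ^ 3"
  assumes "g \<in> L2" shows "(\<lambda>x. g x $ j) \<in> L2"
proof -
  have [measurable]: "g \<in> borel_measurable borel" using assms by (auto dest: L2_measurable)
  have "(\<lambda>x. g x $ j) \<in> borel_measurable borel" by measurable
  then show ?thesis
    by (rule L2_bound[OF _ assms, of _ 1]) (simp add: Finite_Cartesian_Product.norm_nth_le)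
qed

lemma L2_vec:
  fixes g :: "3 \<Rightarrow> real ^ 3 \<Rightarrow> complex"
  assumes "\<And>j. g j \<in> L2" shows "(\<lambda>x. \<chi> j. g j x) \<in> L2"
proof -
  have "(\<lambda>x. \<Sum>j\<in>UNIV. axis j (g j x)) \<in> L2"
  proof (rule L2_sum)
    fix j
    have [measurable]: "g j \<in> borel_measurable borel" using assms by (auto dest: L2_measurable)
    have "(\<lambda>z :: complex. axis j z :: complex ^ 3) \<in> borel_measurable borel"
    proof (rule borel_measurable_continuous_onI)
      have "continuous_on UNIV (\<lambda>z :: complex. if i = j then z else 0)" for i
        by (cases "i = j") auto
      then show "continuous_on UNIV (\<lambda>z :: complex. axis j z :: complex ^ 3)"
        unfolding axis_def by (intro continuous_on_vec_lambda)
    qed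
    then have "(\<lambda>x. axis j (g j x) :: complex ^ 3) \<in> borel_measurable borel" by measurable
    then show "(\<lambda>x. axis j (g j x) :: complex ^ 3) \<in> L2"
      by (rule L2_bound[OF _ assms, of _ 1 j]) (simp add: norm_vec_def L2_set_def axis_def if_distrib[of norm] if_distrib[of "\<lambda>x. x ^ 2"] cong: if_cong)
  qed
  moreover have "(\<Sum>j\<in>UNIV. axis j (g j x)) = (\<chi> j. g j x)" for x
    by (simp add: vec_eq_iff axis_def if_distrib[of "\<lambda>v. v $ _"] cong: if_cong)
  ultimately show ?thesis by simp
qed

lemma L2_norm_vec_le:
  fixes g :: "real ^ 3 \<Rightarrow> complex ^ 3"
  assumes "g \<in> L2"
  shows "L2_norm g \<le> (\<Sum>j\<in>UNIV. L2_norm (\<lambda>x. g x $ j))"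
    and "L2_norm (\<lambda>x. g x $ j) \<le> L2_norm g"
proof -
  have sq: "L2_norm g ^ 2 = (\<Sum>j\<in>UNIV. L2_norm (\<lambda>x. g x $ j) ^ 2)"
  proof -
    have "norm (g x) ^ 2 = (\<Sum>j\<in>UNIV. norm (g x $ j) ^ 2)" for x
      by (simp add: norm_vec_def L2_set_def sum_nonneg)
    then show ?thesis
      unfolding L2_norm_square using L2_integrable_norm[OF L2_nth[OF assms]] by simp
  qed
  show "L2_norm (\<lambda>x. g x $ j) \<le> L2_norm g"
    by (rule power2_le_imp_le) (auto simp: sq intro!: member_le_sum)
  have "L2_norm g = L2_set (\<lambda>j. L2_norm (\<lambda>x. g x $ j)) UNIV"
    by (simp add: L2_set_def flip: sq)
  also have "\<dots> \<le> (\<Sum>j\<in>UNIV. L2_norm (\<lambda>x. g x $ j))"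
    by (rule L2_set_le_sum) auto
  finally show "L2_norm g \<le> (\<Sum>j\<in>UNIV. L2_norm (\<lambda>x. g x $ j))" .
qed

lemma weak_gradientD:
  "weak_gradient f g \<Longrightarrow> test_function \<phi> \<Longrightarrow> (LINT x|lborel. f x * partial j \<phi> x) = - (LINT x|lborel. g x $ j * \<phi> x)"
  by (simp add: weak_gradient_def)

text \<open>The difference of the components is orthogonal to all test functions. Since
  \<open>grad\<close> is a Hilbert choice, this lemma is what identifies it, up to null sets, with
  an explicitly given weak gradient.\<close>

lemma weak_gradient_unique:
  assumes "weak_gradient f g" "weak_gradient f' g'" "g \<in> L2" "g' \<in> L2"
    and [measurable]: "f \<in> borel_measurable borel" "f' \<in> borel_measurable borel"
    and "AE x in lborel. f x = f' x"
  shows "AE x in lborel. g x = g' x"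
proof -
  have "AE x in lborel. g x $ j - g' x $ j = 0" for j
  proof (rule L2_eq_0_if_orthogonal_test)
    show "(\<lambda>x. g x $ j - g' x $ j) \<in> L2" by (intro L2_diff L2_nth assms)
    fix \<phi> assume \<phi>: "test_function \<phi>"
    note \<phi>' = test_function_cnj[OF \<phi>]
    have [measurable]: "partial j (\<lambda>x. cnj (\<phi> x)) \<in> borel_measurable borel"
      by (rule test_function_measurable[OF test_function_partial[OF \<phi>']])
    have "(LINT x|lborel. f x * partial j (\<lambda>x. cnj (\<phi> x)) x) = (LINT x|lborel. f' x * partial j (\<lambda>x. cnj (\<phi> x)) x)"
      by (rule integral_cong_AE) (use assms(7) in auto)
    then have "L2_inner (\<lambda>x. g x $ j) \<phi> = L2_inner (\<lambda>x. g' x $ j) \<phi>"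
      using weak_gradientD[OF assms(1) \<phi>'] weak_gradientD[OF assms(2) \<phi>'] by (simp add: L2_inner_def)
    then show "L2_inner (\<lambda>x. g x $ j - g' x $ j) \<phi> = 0"
      using L2_inner_diff_left[OF L2_nth[OF assms(3)] L2_nth[OF assms(4)] test_function_L2[OF \<phi>]] by simp
  qed
  then have "AE x in lborel. \<forall>j. g x $ j = g' x $ j" by (simp add: AE_all_countable)
  then show ?thesis by eventually_elim (simp add: vec_eq_iff)
qed

lemma H1_L2: "f \<in> H1 \<Longrightarrow> f \<in> L2"
  by (simp add: H1_def)

lemma
  assumes "f \<in> H1"
  shows grad_L2: "grad f \<in> L2" and weak_gradient_grad: "weak_gradient f (grad f)"
proof -
  have "\<exists>g. g \<in> L2 \<and> weak_gradient f g" using assms by (auto simp: H1_def)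
  from someI_ex[OF this] show "grad f \<in> L2" "weak_gradient f (grad f)" by (auto simp: grad_def)
qed

lemma
  assumes "f \<in> L2" "g \<in> L2" "weak_gradient f g"
  shows H1I: "f \<in> H1" and grad_AE_eq: "AE x in lborel. grad f x = g x"
proof -
  show f: "f \<in> H1" using assms by (auto simp: H1_def)
  show "AE x in lborel. grad f x = g x"
    using assms by (intro weak_gradient_unique[OF weak_gradient_grad[OF f] assms(3) grad_L2[OF f]]) (auto dest: L2_measurable)
qed

lemma grad_cong_AE:
  assumes "f \<in> H1" "g \<in> H1" "AE x in lborel. f x = g x"
  shows "AE x in lborel. grad f x = grad g x"
  using assms by (intro weak_gradient_unique[OF weak_gradient_grad weak_gradient_grad] grad_L2) (auto dest: H1_L2 L2_measurable)

lemma weak_gradient_diff: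
  assumes "f \<in> L2" "g \<in> L2" "a \<in> L2" "b \<in> L2" "weak_gradient f a" "weak_gradient g b"
  shows "weak_gradient (\<lambda>x. f x - g x) (\<lambda>x. a x - b x)"
  unfolding weak_gradient_def
proof (intro allI impI)
  fix \<phi> j assume \<phi>: "test_function \<phi>"
  note L2 = test_function_L2[OF \<phi>] test_function_L2[OF test_function_partial[OF \<phi>, of j]]
  show "(LINT x|lborel. (f x - g x) * partial j \<phi> x) = - (LINT x|lborel. (a x - b x) $ j * \<phi> x)"
    using weak_gradientD[OF assms(5) \<phi>, of j] weak_gradientD[OF assms(6) \<phi>, of j]
      L2_integrable_mult[OF assms(1) L2(2)] L2_integrable_mult[OF assms(2) L2(2)]
      L2_integrable_mult[OF L2_nth[OF assms(3)] L2(1)] L2_integrable_mult[OF L2_nth[OF assms(4)] L2(1)]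
    by (simp add: left_diff_distrib)
qed

lemma
  assumes "f \<in> H1" "g \<in> H1"
  shows H1_diff: "(\<lambda>x. f x - g x) \<in> H1"
    and grad_diff: "AE x in lborel. grad (\<lambda>x. f x - g x) x = grad f x - grad g x"
proof -
  note w = weak_gradient_diff[OF H1_L2[OF assms(1)] H1_L2[OF assms(2)] grad_L2[OF assms(1)] grad_L2[OF assms(2)]
      weak_gradient_grad[OF assms(1)] weak_gradient_grad[OF assms(2)]]
  show "(\<lambda>x. f x - g x) \<in> H1" "AE x in lborel. grad (\<lambda>x. f x - g x) x = grad f x - grad g x"
    by (intro H1I[OF _ _ w] grad_AE_eq[OF _ _ w] L2_diff[OF H1_L2 H1_L2] L2_diff[OF grad_L2 grad_L2] assms)+
qed

text \<open>The substitution x -> x + a transfers modulation and shift to the test function, which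
  becomes \<psi>. The product rule for \<psi> produces the extra term i \<xi>_j f.\<close>

lemma weak_gradient_modulate_shift:
  assumes f: "f \<in> L2" and g: "g \<in> L2" and w: "weak_gradient f g"
  shows "weak_gradient (\<lambda>x. cis (\<xi> \<bullet> x + c) * f (x - a))
    (\<lambda>x. \<chi> j. cis (\<xi> \<bullet> x + c) * (g (x - a) $ j + \<i> * of_real (\<xi> $ j) * f (x - a)))"
  unfolding weak_gradient_def
proof (intro allI impI)
  fix \<phi> j assume \<phi>: "test_function \<phi>"
  have [measurable]: "f \<in> borel_measurable borel" "(\<lambda>x. g x $ j) \<in> borel_measurable borel"
    "\<phi> \<in> borel_measurable borel" "partial j \<phi> \<in> borel_measurable borel"
    using f L2_nth[OF g] test_function_measurable[OF \<phi>] test_function_measurable[OF test_function_partial[OF \<phi>]]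
    by (auto dest: L2_measurable)
  define k where "k = cis (\<xi> \<bullet> a + c)"
  define e where "e = (\<lambda>x. k * cis (\<xi> \<bullet> x))"
  define \<psi> where "\<psi> = (\<lambda>x. e x * \<phi> (x + a))"
  have se: "smooth_fun e" unfolding e_def by (rule smooth_fun_cis)
  note s\<phi> = smooth_fun_shift[OF test_function_smooth[OF \<phi>], of a]
  have \<psi>: "test_function \<psi>" unfolding \<psi>_def by (intro test_function_mult se test_function_shift \<phi>)
  have p\<psi>: "partial j \<psi> x = e x * partial j \<phi> (x + a) + \<i> * of_real (\<xi> $ j) * \<psi> x" for x
    unfolding \<psi>_def partial_mult[OF se s\<phi>] partial_shift[OF test_function_smooth[OF \<phi>]]
    by (simp add: e_def partial_cis)
  have ea: "cis (\<xi> \<bullet> (x + a) + c) = e x" for x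
    by (simp add: e_def k_def cis_mult inner_add_right algebra_simps)
  have i1: "integrable lborel (\<lambda>x. f x * partial j \<psi> x)"
    by (rule L2_integrable_mult[OF f test_function_L2[OF test_function_partial[OF \<psi>]]])
  have i2: "integrable lborel (\<lambda>x. \<i> * of_real (\<xi> $ j) * f x * \<psi> x)"
    by (rule L2_integrable_mult[OF L2_cmult[OF f] test_function_L2[OF \<psi>]])
  have i3: "integrable lborel (\<lambda>x. g x $ j * \<psi> x)"
    by (rule L2_integrable_mult[OF L2_nth[OF g] test_function_L2[OF \<psi>]])
  have "(LINT x|lborel. cis (\<xi> \<bullet> x + c) * f (x - a) * partial j \<phi> x) =
     (LINT x|lborel. cis (\<xi> \<bullet> (x + a) + c) * f (x + a - a) * partial j \<phi> (x + a))"
    by (rule integral_lborel_shift[symmetric]) measurable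
  also have "\<dots> = (LINT x|lborel. f x * partial j \<psi> x - \<i> * of_real (\<xi> $ j) * f x * \<psi> x)"
    unfolding ea p\<psi> by (simp add: algebra_simps)
  also have "\<dots> = - (LINT x|lborel. g x $ j * \<psi> x) - (LINT x|lborel. \<i> * of_real (\<xi> $ j) * f x * \<psi> x)"
    using i1 i2 weak_gradientD[OF w \<psi>, of j] by simp
  also have "\<dots> = - (LINT x|lborel. g x $ j * \<psi> x + \<i> * of_real (\<xi> $ j) * f x * \<psi> x)"
    using i2 i3 by (subst Bochner_Integration.integral_add) simp_all
  also have "(LINT x|lborel. g x $ j * \<psi> x + \<i> * of_real (\<xi> $ j) * f x * \<psi> x) =
     (LINT x|lborel. cis (\<xi> \<bullet> (x + a) + c) * (g (x + a - a) $ j + \<i> * of_real (\<xi> $ j) * f (x + a - a)) * \<phi> (x + a))"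
    unfolding ea by (simp add: \<psi>_def algebra_simps)
  also have "\<dots> = (LINT x|lborel. cis (\<xi> \<bullet> x + c) * (g (x - a) $ j + \<i> * of_real (\<xi> $ j) * f (x - a)) * \<phi> x)"
  proof (rule integral_lborel_shift)
    have [measurable]: "(\<lambda>x. g (x - a) $ j) \<in> borel_measurable borel"
      using L2_measurable[OF L2_shift[OF L2_nth[OF g, of j], of "- a"]] by simp
    show "(\<lambda>x. cis (\<xi> \<bullet> x + c) * (g (x - a) $ j + \<i> * of_real (\<xi> $ j) * f (x - a)) * \<phi> x) \<in> borel_measurable borel"
      by measurable
  qed
  finally show "(LINT x|lborel. cis (\<xi> \<bullet> x + c) * f (x - a) * partial j \<phi> x) =
    - (LINT x|lborel. (\<chi> j. cis (\<xi> \<bullet> x + c) * (g (x - a) $ j + \<i> * of_real (\<xi> $ j) * f (x - a))) $ j * \<phi> x)"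
    by simp
qed

lemma
  assumes f: "f \<in> H1"
  shows H1_modulate_shift: "(\<lambda>x. cis (\<xi> \<bullet> x + c) * f (x - a)) \<in> H1"
    and grad_modulate_shift: "AE x in lborel. grad (\<lambda>x. cis (\<xi> \<bullet> x + c) * f (x - a)) x =
      (\<chi> j. cis (\<xi> \<bullet> x + c) * (grad f (x - a) $ j + \<i> * of_real (\<xi> $ j) * f (x - a)))"
proof -
  have *: "(\<lambda>x. \<chi> j. cis (\<xi> \<bullet> x + c) * (grad f (x - a) $ j + \<i> * of_real (\<xi> $ j) * f (x - a))) \<in> L2"
    using L2_modulate_shift(1)[OF L2_add[OF L2_nth[OF grad_L2[OF f]] L2_cmult[OF H1_L2[OF f]]]]
    by (intro L2_vec)
  note w = weak_gradient_modulate_shift[OF H1_L2[OF f] grad_L2[OF f] weak_gradient_grad[OF f], of \<xi> c a]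
  show "(\<lambda>x. cis (\<xi> \<bullet> x + c) * f (x - a)) \<in> H1"
    by (rule H1I[OF L2_modulate_shift(1)[OF H1_L2[OF f]] * w])
  show "AE x in lborel. grad (\<lambda>x. cis (\<xi> \<bullet> x + c) * f (x - a)) x =
      (\<chi> j. cis (\<xi> \<bullet> x + c) * (grad f (x - a) $ j + \<i> * of_real (\<xi> $ j) * f (x - a)))"
    by (rule grad_AE_eq[OF L2_modulate_shift(1)[OF H1_L2[OF f]] * w])
qed

section \<open>The Fourier transform of a weak derivative\<close>

lemma integrable_indicator_translates:
  fixes f p :: "real ^ 3 \<Rightarrow> complex"
  assumes f: "f \<in> L2" and p: "p \<in> L2"
  shows "integrable (lborel \<Otimes>\<^sub>M lborel) (\<lambda>(s, x). indicator {0..h::real} s *\<^sub>R (f x * p (x - s *\<^sub>R e)))"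
proof (rule lborel_pair.Fubini_integrable)
  have [measurable]: "f \<in> borel_measurable borel" "p \<in> borel_measurable borel"
    using f p by (auto dest: L2_measurable)
  show "(\<lambda>(s, x). indicator {0..h} s *\<^sub>R (f x * p (x - s *\<^sub>R e))) \<in> borel_measurable (lborel \<Otimes>\<^sub>M lborel)"
    by measurable
  have pL2: "(\<lambda>x. p (x - s *\<^sub>R e)) \<in> L2" for s using L2_shift[OF p, of "- (s *\<^sub>R e)"] by simp
  show "AE s in lborel. integrable lborel (\<lambda>x. case (s, x) of (s, x) \<Rightarrow> indicator {0..h} s *\<^sub>R (f x * p (x - s *\<^sub>R e)))"
    using L2_integrable_mult[OF f pL2] by (intro AE_I2) simp
  show "integrable lborel (\<lambda>s. LINT x|lborel. norm (case (s, x) of (s, x) \<Rightarrow> indicator {0..h} s *\<^sub>R (f x * p (x - s *\<^sub>R e))))"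
  proof (rule Bochner_Integration.integrable_bound)
    show "integrable lborel (\<lambda>s. indicator {0..h} s * (L2_norm f * L2_norm p))"
      by (intro integrable_mult_left integrable_real_indicator) (auto simp: emeasure_lborel_Icc_eq)
    show "AE s in lborel. norm (LINT x|lborel. norm (case (s, x) of (s, x) \<Rightarrow> indicator {0..h} s *\<^sub>R (f x * p (x - s *\<^sub>R e))))
        \<le> norm (indicator {0..h} s * (L2_norm f * L2_norm p))"
    proof (intro AE_I2)
      fix s
      have "(LINT x|lborel. norm (f x) * norm (p (x - s *\<^sub>R e))) \<le> L2_norm f * L2_norm p"
        using L2_Cauchy_Schwarz_norm[OF f pL2, of s] L2_norm_shift[of p "- (s *\<^sub>R e)"] by simp
      moreover have "0 \<le> (LINT x|lborel. norm (f x) * norm (p (x - s *\<^sub>R e)))"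
        by (intro integral_nonneg_AE) auto
      ultimately show "norm (LINT x|lborel. norm (case (s, x) of (s, x) \<Rightarrow> indicator {0..h} s *\<^sub>R (f x * p (x - s *\<^sub>R e))))
        \<le> norm (indicator {0..h} s * (L2_norm f * L2_norm p))"
        by (auto simp: indicator_def norm_mult)
    qed
  qed measurable
qed

definition cis_mean :: "real \<Rightarrow> real \<Rightarrow> complex" where
  "cis_mean h y = (LINT s|lborel. indicator {0..h} s *\<^sub>R cis (s * y))"

lemma cis_mean_measurable [measurable]: "cis_mean h \<in> borel_measurable borel"
  unfolding cis_mean_def[abs_def] by measurable

lemma norm_cis_mean_le: assumes "0 \<le> h" shows "norm (cis_mean h y) \<le> h"
proof -
  have "norm (cis_mean h y) \<le> (LINT s|lborel. norm (indicator {0..h} s *\<^sub>R cis (s * y)))"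
    unfolding cis_mean_def by (rule integral_norm_bound)
  also have "\<dots> = (LINT s|lborel. indicator {0..h} s)"
    by (intro Bochner_Integration.integral_cong) auto
  also have "\<dots> = h" using assms by simp
  finally show ?thesis .
qed

lemma cis_mean_eq:
  assumes "0 \<le> h" shows "\<i> * of_real y * cis_mean h y = cis (h * y) - 1"
proof -
  have "(LINT s|lborel. indicator {0..h} s *\<^sub>R (\<i> * of_real y * cis (s * y))) = cis (h * y) - cis (0 * y)"
  proof (rule integral_FTC_atLeastAtMost[OF assms])
    show "((\<lambda>s. cis (s * y)) has_vector_derivative \<i> * of_real y * cis (x * y)) (at x within {0..h})" for x
      unfolding has_vector_derivative_def
      by (auto intro!: derivative_eq_intros simp: fun_eq_iff scaleR_conv_of_real)
    show "continuous_on {0..h} (\<lambda>s. \<i> * of_real y * cis (s * y))" by (intro continuous_intros)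
  qed
  moreover have "(LINT s|lborel. indicator {0..h} s *\<^sub>R (\<i> * of_real y * cis (s * y))) = \<i> * of_real y * cis_mean h y"
    unfolding cis_mean_def by (subst integral_mult_right_zero[symmetric]) (simp add: mult_ac)
  ultimately show ?thesis by simp
qed

text \<open>Within h |y| < pi the exponential \<open>cis (h * y)\<close> equals 1 only for y = 0,
  where the integral is h. For a small step h the mean may therefore be divided out.\<close>

lemma cis_mean_nonzero:
  assumes "0 < h" "h * \<bar>y\<bar> < pi" shows "cis_mean h y \<noteq> 0"
proof (cases "y = 0")
  case True
  then have "cis_mean h y = (LINT s|lborel. complex_of_real (indicator {0..h} s))"
    by (simp add: cis_mean_def scaleR_conv_of_real)
  also have "\<dots> = of_real h" using assms by simp
  finally show ?thesis using assms by simp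
next
  case False
  then have "0 < sin (h * \<bar>y\<bar>)" using assms by (intro sin_gt_zero) auto
  then have "sin (h * y) \<noteq> 0" by (cases "0 \<le> y") auto
  then have "cis (h * y) \<noteq> 1" by (metis cis.sel(2) one_complex.sel(2))
  then show ?thesis using cis_mean_eq[of h y] assms by auto
qed

lemma inner_axis_1: "(x :: real ^ 3) \<bullet> axis j 1 = x $ j"
  by (simp add: inner_axis)

text \<open>Integrated form of the weak derivative: along s the translate of \<psi> has the
  derivative given by minus the translated \<open>partial j \<psi>\<close>, so the fundamental
  theorem and Fubini express an increment of pairings through g. Only translates of \<psi> occur,
  and these have bounded Fourier multipliers.\<close>

lemma weak_derivative_increment:
  assumes f: "f \<in> L2" and g: "g \<in> L2"
    and w: "\<And>\<phi>. test_function \<phi> \<Longrightarrow> (LINT x|lborel. f x * partial j \<phi> x) = - (LINT x|lborel. g x * \<phi> x)"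
    and \<psi>: "test_function \<psi>" and h: "0 \<le> h"
  defines "e \<equiv> axis j 1 :: real ^ 3"
  shows "(LINT x|lborel. f x * \<psi> (x - h *\<^sub>R e)) - (LINT x|lborel. f x * \<psi> x) =
    (LINT s|lborel. indicator {0..h} s *\<^sub>R (LINT x|lborel. g x * \<psi> (x - s *\<^sub>R e)))"
proof -
  have t\<psi>: "test_function (\<lambda>x. \<psi> (x - s *\<^sub>R e))" for s
    using test_function_shift[OF \<psi>, of "- (s *\<^sub>R e)"] by simp
  note p\<psi> = test_function_partial[OF \<psi>, of j]
  have p: "partial j (\<lambda>x. \<psi> (x - s *\<^sub>R e)) x = partial j \<psi> (x - s *\<^sub>R e)" for s x
    using partial_shift[OF test_function_smooth[OF \<psi>], of j "- (s *\<^sub>R e)" x] by simp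
  have FTC: "(LINT s|lborel. indicator {0..h} s *\<^sub>R (- partial j \<psi> (x - s *\<^sub>R e))) = \<psi> (x - h *\<^sub>R e) - \<psi> x" for x
  proof -
    have "(LINT s|lborel. indicator {0..h} s *\<^sub>R (- partial j \<psi> (x - s *\<^sub>R e))) = \<psi> (x - h *\<^sub>R e) - \<psi> (x - 0 *\<^sub>R e)"
    proof (rule integral_FTC_atLeastAtMost[OF h])
      show "((\<lambda>s. \<psi> (x - s *\<^sub>R e)) has_vector_derivative - partial j \<psi> (x - s *\<^sub>R e)) (at s within {0..h})" for s
      proof -
        have inner: "((\<lambda>s. x - s *\<^sub>R e) has_derivative (\<lambda>r. - (r *\<^sub>R e))) (at s within {0..h})"
          by (auto intro!: derivative_eq_intros)
        have "((\<lambda>s. \<psi> (x - s *\<^sub>R e)) has_derivative (\<lambda>r. \<Sum>k\<in>UNIV. (- (r *\<^sub>R e)) $ k *\<^sub>R partial k \<psi> (x - s *\<^sub>R e))) (at s within {0..h})"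
          by (rule has_derivative_compose[OF inner smooth_fun_has_derivative[OF test_function_smooth[OF \<psi>]]])
        moreover have "(\<Sum>k\<in>UNIV. (- (r *\<^sub>R e)) $ k *\<^sub>R partial k \<psi> (x - s *\<^sub>R e)) = r *\<^sub>R (- partial j \<psi> (x - s *\<^sub>R e))" for r
        proof -
          have "(\<Sum>k\<in>UNIV. (- (r *\<^sub>R e)) $ k *\<^sub>R partial k \<psi> (x - s *\<^sub>R e)) =
            (\<Sum>k\<in>UNIV. if k = j then r *\<^sub>R (- partial j \<psi> (x - s *\<^sub>R e)) else 0)"
            by (intro sum.cong) (auto simp: e_def axis_def)
          then show ?thesis by simp
        qed
        ultimately show ?thesis by (simp add: has_vector_derivative_def)
      qed
      have "continuous_on {0..h} (\<lambda>s. partial j \<psi> (x - s *\<^sub>R e))"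
        by (rule continuous_on_compose2[OF smooth_fun_continuous[OF test_function_smooth[OF p\<psi>]]])
           (auto intro!: continuous_intros)
      then show "continuous_on {0..h} (\<lambda>s. - partial j \<psi> (x - s *\<^sub>R e))"
        by (rule continuous_on_minus)
    qed
    then show ?thesis by simp
  qed
  have "(LINT x|lborel. f x * \<psi> (x - h *\<^sub>R e)) - (LINT x|lborel. f x * \<psi> x) = (LINT x|lborel. f x * (\<psi> (x - h *\<^sub>R e) - \<psi> x))"
    using L2_integrable_mult[OF f test_function_L2[OF t\<psi>]] L2_integrable_mult[OF f test_function_L2[OF \<psi>]]
    by (simp add: right_diff_distrib)
  also have "\<dots> = (LINT x|lborel. LINT s|lborel. indicator {0..h} s *\<^sub>R (f x * (- partial j \<psi> (x - s *\<^sub>R e))))"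
    unfolding FTC[symmetric] by (subst integral_mult_right_zero[symmetric]) simp
  also have "\<dots> = (LINT s|lborel. LINT x|lborel. indicator {0..h} s *\<^sub>R (f x * (- partial j \<psi> (x - s *\<^sub>R e))))"
    using integrable_indicator_translates[OF f L2_uminus[OF test_function_L2[OF p\<psi>]], of h e]
    by (intro lborel_pair.Fubini_integral) simp
  also have "\<dots> = (LINT s|lborel. indicator {0..h} s *\<^sub>R (LINT x|lborel. g x * \<psi> (x - s *\<^sub>R e)))"
    using w[OF t\<psi>] by (simp add: p)
  finally show ?thesis .
qed

lemma integral_indicator_cis:
  assumes "integrable lborel k" "0 \<le> h"
  shows "(LINT s|lborel. indicator {0..h} s *\<^sub>R (LINT \<xi>|lborel. cis (s * (\<xi> $ j)) * k \<xi>)) =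
    (LINT \<xi>|lborel. cis_mean h (\<xi> $ j) * k (\<xi> :: real ^ 3))"
proof -
  have i: "integrable lborel (\<lambda>s. complex_of_real (indicator {0..h} s))"
    by (intro integrable_of_real integrable_real_indicator) (auto simp: emeasure_lborel_Icc_eq)
  have "integrable (lborel \<Otimes>\<^sub>M lborel) (\<lambda>(s, \<xi>). cis (s * (\<xi> $ j)) * (complex_of_real (indicator {0..h} s) * k \<xi>))"
    using integrable_tensor[OF i assms(1), of "\<lambda>(s, \<xi>). cis (s * (\<xi> $ j))"] by (simp add: split_beta')
  then have int: "integrable (lborel \<Otimes>\<^sub>M lborel) (\<lambda>(s, \<xi>). indicator {0..h} s *\<^sub>R (cis (s * (\<xi> $ j)) * k \<xi>))"
    by (simp add: scaleR_conv_of_real mult_ac)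
  have "(LINT s|lborel. indicator {0..h} s *\<^sub>R (LINT \<xi>|lborel. cis (s * (\<xi> $ j)) * k \<xi>)) =
    (LINT s|lborel. LINT \<xi>|lborel. indicator {0..h} s *\<^sub>R (cis (s * (\<xi> $ j)) * k \<xi>))" by simp
  also have "\<dots> = (LINT \<xi>|lborel. LINT s|lborel. indicator {0..h} s *\<^sub>R (cis (s * (\<xi> $ j)) * k \<xi>))"
    by (intro lborel_pair.Fubini_integral[symmetric]) (use int in simp)
  also have "\<dots> = (LINT \<xi>|lborel. cis_mean h (\<xi> $ j) * k \<xi>)"
    unfolding cis_mean_def by (subst integral_mult_left_zero[symmetric]) simp
  finally show ?thesis .
qed

lemma L2_fourier_shift_inner:
  assumes "L2_fourier f F" "L2_fourier \<phi> \<Phi>"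
  shows "(LINT x|lborel. f x * cnj (\<phi> (x - s *\<^sub>R axis j 1))) = (LINT \<xi>|lborel. cis (s * (\<xi> $ j)) * (F \<xi> * cnj (\<Phi> \<xi>)))"
proof -
  have "L2_fourier (\<lambda>x. \<phi> (x - s *\<^sub>R axis j 1)) (\<lambda>\<xi>. cis (- (s * (\<xi> $ j))) * \<Phi> \<xi>)"
    using L2_fourier_modulate_shift[OF assms(2), of 0 0 "s *\<^sub>R axis j 1"] by (simp add: inner_axis_1 inner_commute[of "axis j 1"])
  from L2_fourier_inner[OF assms(1) this] show ?thesis
    by (simp add: L2_inner_def cis_cnj mult_ac)
qed

text \<open>
  The multiplier \<open>i\<xi>\<^sub>j\<close> is unbounded, so the relation is first shown after averaging over the
  translations by \<open>s e\<^sub>j\<close> with \<open>0 \<le> s \<le> h\<close>: this replaces it by the bounded multipliers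
  \<open>e\<^bsup>ih\<xi>\<^sub>j\<^esup> - 1\<close> and \<open>\<integral>\<^sub>0\<^sup>h e\<^bsup>is\<xi>\<^sub>j\<^esup> ds\<close>, for which density of the test functions suffices.
\<close>

theorem L2_fourier_weak_derivative:
  assumes F: "L2_fourier f F" and G: "L2_fourier g G"
    and w: "\<And>\<phi>. test_function \<phi> \<Longrightarrow> (LINT x|lborel. f x * partial j \<phi> x) = - (LINT x|lborel. g x * \<phi> x)"
  shows "AE \<xi> in lborel. G \<xi> = \<i> * of_real (\<xi> $ j) * F \<xi>"
proof -
  note L2 = L2_fourier_L2[OF F] L2_fourier_L2[OF G]
  have *: "AE \<xi> in lborel. (cis (h * (\<xi> $ j)) - 1) * F \<xi> - cis_mean h (\<xi> $ j) * G \<xi> = 0" if h: "0 \<le> h" for h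
  proof -
    define W where "W = (\<lambda>\<xi>. (cis (h * (\<xi> $ j)) - 1) * F \<xi> - cis_mean h (\<xi> $ j) * G \<xi>)"
    have W1: "(\<lambda>\<xi>. (cis (h * (\<xi> $ j)) - 1) * F \<xi>) \<in> L2"
      by (rule L2_mult_bounded[OF L2(2), where c=2]) (auto intro: order_trans[OF norm_triangle_ineq4])
    have W2: "(\<lambda>\<xi>. cis_mean h (\<xi> $ j) * G \<xi>) \<in> L2"
      by (rule L2_mult_bounded[OF L2(4), where c=h]) (auto intro: norm_cis_mean_le[OF h])
    have WL2: "W \<in> L2" unfolding W_def by (rule L2_diff[OF W1 W2])
    \<comment> \<open>Test functions live on the physical side, so W is pulled back to some v, which
      is then shown to be orthogonal to all of them.\<close>
    obtain v where v: "L2_fourier v W" using L2_fourier_onto[OF WL2] by blast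
    have "AE x in lborel. v x = 0"
    proof (rule L2_eq_0_if_orthogonal_test[OF L2_fourier_L2(1)[OF v]])
      fix \<phi> assume \<phi>: "test_function \<phi>"
      obtain \<Phi> where \<Phi>: "L2_fourier \<phi> \<Phi>" using L2_fourier_exists[OF test_function_L2[OF \<phi>]] by blast
      note \<Phi>L2 = L2_fourier_L2(2)[OF \<Phi>]
      note FS = L2_fourier_shift_inner[OF F \<Phi>, of _ j] and GS = L2_fourier_shift_inner[OF G \<Phi>, of _ j]
      have "(LINT \<xi>|lborel. cis (h * (\<xi> $ j)) * (F \<xi> * cnj (\<Phi> \<xi>))) - (LINT \<xi>|lborel. cis (0 * (\<xi> $ j)) * (F \<xi> * cnj (\<Phi> \<xi>))) =
        (LINT s|lborel. indicator {0..h} s *\<^sub>R (LINT \<xi>|lborel. cis (s * (\<xi> $ j)) * (G \<xi> * cnj (\<Phi> \<xi>))))"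
        using weak_derivative_increment[OF L2(1,3) w test_function_cnj[OF \<phi>] h]
        unfolding FS[symmetric] GS[symmetric] by simp
      also have "\<dots> = L2_inner (\<lambda>\<xi>. cis_mean h (\<xi> $ j) * G \<xi>) \<Phi>"
        by (subst integral_indicator_cis[OF L2_integrable_inner[OF L2(4) \<Phi>L2] h]) (simp add: L2_inner_def mult_ac)
      also have "(LINT \<xi>|lborel. cis (h * (\<xi> $ j)) * (F \<xi> * cnj (\<Phi> \<xi>))) - (LINT \<xi>|lborel. cis (0 * (\<xi> $ j)) * (F \<xi> * cnj (\<Phi> \<xi>))) =
         L2_inner (\<lambda>\<xi>. (cis (h * (\<xi> $ j)) - 1) * F \<xi>) \<Phi>"
        using integrable_cis_mult[OF L2_integrable_inner[OF L2(2) \<Phi>L2], of "\<lambda>\<xi>. h * (\<xi> $ j)"] L2_integrable_inner[OF L2(2) \<Phi>L2]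
        unfolding L2_inner_def by (simp add: left_diff_distrib mult.assoc)
      finally have "L2_inner W \<Phi> = 0"
        unfolding W_def by (simp add: L2_inner_diff_left[OF W1 W2 \<Phi>L2])
      then show "L2_inner v \<phi> = 0" using L2_fourier_inner[OF v \<Phi>] by simp
    qed
    then have "L2_norm W = 0"
      using L2_fourier_isometry[OF v] L2_norm_eq_0_iff[OF L2_fourier_L2(1)[OF v]] by simp
    then show ?thesis using L2_norm_eq_0_iff[OF WL2] by (simp add: W_def)
  qed
  \<comment> \<open>Countably many steps h = 1 / (n + 1) keep the union of the exceptional sets
    null, and for each \<xi> one of them is small enough to make the mean nonzero.\<close>
  then have "AE \<xi> in lborel. \<forall>n. (cis (1 / real (Suc n) * (\<xi> $ j)) - 1) * F \<xi> - cis_mean (1 / real (Suc n)) (\<xi> $ j) * G \<xi> = 0"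
    unfolding AE_all_countable by (intro allI *) simp
  then show ?thesis
  proof eventually_elim
    case (elim \<xi>)
    obtain n where "\<bar>\<xi> $ j\<bar> < real n" using reals_Archimedean2 by blast
    then have "\<bar>\<xi> $ j\<bar> < real (Suc n) * pi" using pi_gt3
      by (smt (verit) mult_less_cancel_left1 mult_right_less_imp_less of_nat_0_le_iff of_nat_Suc mult_left_mono)
    then have "1 / real (Suc n) * \<bar>\<xi> $ j\<bar> < pi" by (simp add: divide_less_eq mult.commute)
    then have nz: "cis_mean (1 / real (Suc n)) (\<xi> $ j) \<noteq> 0" by (intro cis_mean_nonzero) auto
    have "cis_mean (1 / real (Suc n)) (\<xi> $ j) * G \<xi> = (cis (1 / real (Suc n) * (\<xi> $ j)) - 1) * F \<xi>"
      using elim[rule_format, of n] by simp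
    also have "\<dots> = \<i> * of_real (\<xi> $ j) * cis_mean (1 / real (Suc n)) (\<xi> $ j) * F \<xi>"
      by (subst cis_mean_eq) simp_all
    finally have "cis_mean (1 / real (Suc n)) (\<xi> $ j) * G \<xi> = cis_mean (1 / real (Suc n)) (\<xi> $ j) * (\<i> * of_real (\<xi> $ j) * F \<xi>)"
      by (simp add: mult_ac)
    with nz show ?case by simp
  qed
qed

lemma L2_fourier_grad:
  assumes "f \<in> H1" "L2_fourier f F"
  shows "L2_fourier (\<lambda>x. grad f x $ j) (\<lambda>\<xi>. \<i> * of_real (\<xi> $ j) * F \<xi>)"
proof -
  have g: "(\<lambda>x. grad f x $ j) \<in> L2" by (rule L2_nth[OF grad_L2[OF assms(1)]])
  obtain G where G: "L2_fourier (\<lambda>x. grad f x $ j) G" using L2_fourier_exists[OF g] by blast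
  have [measurable]: "F \<in> borel_measurable borel" using L2_fourier_L2(2)[OF assms(2)] by (rule L2_measurable)
  have AE: "AE \<xi> in lborel. G \<xi> = \<i> * of_real (\<xi> $ j) * F \<xi>"
    by (rule L2_fourier_weak_derivative[OF assms(2) G weak_gradientD[OF weak_gradient_grad[OF assms(1)]]])
  \<comment> \<open>Square integrability of the unbounded multiple of F is inherited from G, which
    agrees with it almost everywhere.\<close>
  have "(\<lambda>\<xi>. \<i> * of_real (\<xi> $ j) * F \<xi>) \<in> L2"
  proof (rule L2I)
    have "integrable lborel (\<lambda>\<xi>. norm (G \<xi>) ^ 2)" by (rule L2_integrable_norm[OF L2_fourier_L2(2)[OF G]])
    moreover have "AE \<xi> in lborel. norm (G \<xi>) ^ 2 = norm (\<i> * of_real (\<xi> $ j) * F \<xi>) ^ 2"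
      using AE by eventually_elim simp
    ultimately show "integrable lborel (\<lambda>\<xi>. norm (\<i> * of_real (\<xi> $ j) * F \<xi>) ^ 2)"
      using L2_measurable[OF L2_fourier_L2(2)[OF G]] by (subst (asm) integrable_cong_AE) auto
  qed measurable
  then show ?thesis using L2_fourier_cong_AE[OF G g _ _ AE] by simp
qed

section \<open>Conservation of momentum\<close>

lemma norm_cis_minus_1_le: "norm (cis y - 1) \<le> \<bar>y\<bar>"
  using iexp_approx1[of y 0] by (simp add: cis_conv_exp)

text \<open>Taylor's bound |e^{iz} - 1 - iz| \<le> z^2 / 2 at z = y / (n + 1), multiplied by n +
  1.\<close>

lemma cis_difference_quotient_tendsto: "(\<lambda>n. of_nat (Suc n) * (cis (y / real (Suc n)) - 1)) \<longlonglongrightarrow> \<i> * of_real y"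
proof (rule LIM_zero_cancel, rule Lim_null_comparison)
  show "\<forall>\<^sub>F n in sequentially. norm (of_nat (Suc n) * (cis (y / real (Suc n)) - 1) - \<i> * of_real y) \<le> y\<^sup>2 * inverse (real (Suc n))"
  proof (intro always_eventually allI)
    fix n
    let ?z = "y / real (Suc n)"
    have "norm (cis ?z - 1 - \<i> * of_real ?z) \<le> ?z\<^sup>2 / 2"
      using iexp_approx1[of ?z 1] by (simp add: cis_conv_exp power2_eq_square algebra_simps)
    then have "real (Suc n) * norm (cis ?z - 1 - \<i> * of_real ?z) \<le> real (Suc n) * (?z\<^sup>2 / 2)"
      by (intro mult_left_mono) auto
    also have "\<dots> = y\<^sup>2 * inverse (real (Suc n)) / 2"
      by (simp add: power2_eq_square field_simps del: of_nat_Suc)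
    also have "\<dots> \<le> y\<^sup>2 * inverse (real (Suc n))" by simp
    also have "real (Suc n) * norm (cis ?z - 1 - \<i> * of_real ?z) = norm (of_nat (Suc n) * (cis ?z - 1 - \<i> * of_real ?z))"
      by (simp only: norm_mult norm_of_nat)
    also have "of_nat (Suc n) * (cis ?z - 1 - \<i> * of_real ?z) = of_nat (Suc n) * (cis ?z - 1) - \<i> * of_real y"
      by (simp add: right_diff_distrib del: of_nat_Suc)
    finally show "norm (of_nat (Suc n) * (cis ?z - 1) - \<i> * of_real y) \<le> y\<^sup>2 * inverse (real (Suc n))" .
  qed
  show "(\<lambda>n. y\<^sup>2 * inverse (real (Suc n))) \<longlonglongrightarrow> 0"
    using tendsto_mult_left[OF LIMSEQ_inverse_real_of_nat, of "y\<^sup>2"] by simp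
qed

text \<open>Young's inequality with exponents 4 and 4/3, certified by a sum of squares.\<close>

lemma young_quartic: "4 * (x * y ^ 3) \<le> x ^ 4 + 3 * y ^ 4" for x y :: real
proof -
  have "x ^ 4 + 3 * y ^ 4 - 4 * (x * y ^ 3) = (x\<^sup>2 - y\<^sup>2)\<^sup>2 + 2 * y\<^sup>2 * (x - y)\<^sup>2"
    by (simp add: power2_eq_square power3_eq_cube power4_eq_xxxx algebra_simps)
  also have "\<dots> \<ge> 0" by simp
  finally show ?thesis by simp
qed

abbreviation cubic :: "(real ^ 3 \<Rightarrow> complex) \<Rightarrow> real ^ 3 \<Rightarrow> complex" where
  "cubic f \<equiv> \<lambda>x. of_real (norm (f x) ^ 2) * f x"

text \<open>
  By convexity of the quartic, the pairing of \<open>|u|\<^sup>2u\<close> with a translate of \<open>u\<close> is maximal for the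
  trivial translate, so its derivative along translations vanishes.
\<close>

lemma translate_pairing_le:
  assumes u: "u \<in> L2" and N: "(cubic u) \<in> L2" (is "?N \<in> L2")
  shows "Re (L2_inner (\<lambda>x. u (x + a)) ?N) \<le> Re (L2_inner u ?N)"
proof -
  have [measurable]: "u \<in> borel_measurable borel" using u by (rule L2_measurable)
  have eq4: "u x * cnj (?N x) = of_real (norm (u x) ^ 4)" for x
  proof -
    have "u x * cnj (?N x) = of_real (norm (u x) ^ 2) * (u x * cnj (u x))" by simp
    also have "\<dots> = of_real (norm (u x) ^ 2) * of_real (norm (u x) ^ 2)" by (simp only: complex_norm_square)
    finally show ?thesis by (simp add: power2_eq_square power4_eq_xxxx)
  qed
  have "integrable lborel (\<lambda>x. complex_of_real (norm (u x) ^ 4))"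
    using L2_integrable_inner[OF u N] unfolding eq4 .
  from integrable_Re[OF this] have i4: "integrable lborel (\<lambda>x. norm (u x) ^ 4)" by simp
  then have i4a: "integrable lborel (\<lambda>x. norm (u (x + a)) ^ 4)"
    by (subst integrable_lborel_shift[of "\<lambda>x. norm (u x) ^ 4"]) auto
  have "Re (L2_inner (\<lambda>x. u (x + a)) ?N) = (LINT x|lborel. Re (u (x + a) * cnj (?N x)))"
    unfolding L2_inner_def by (intro integral_Re[symmetric] L2_integrable_inner L2_shift u N)
  also have "\<dots> \<le> (LINT x|lborel. 1 / 4 * norm (u (x + a)) ^ 4 + 3 / 4 * norm (u x) ^ 4)"
  proof (intro integral_mono)
    show "integrable lborel (\<lambda>x. Re (u (x + a) * cnj (?N x)))"
      by (intro integrable_Re L2_integrable_inner L2_shift u N)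
    fix x
    have "Re (u (x + a) * cnj (?N x)) \<le> norm (u (x + a) * cnj (?N x))" by (rule complex_Re_le_cmod)
    also have "\<dots> = norm (u (x + a)) * norm (u x) ^ 3" by (simp add: norm_mult power2_eq_square power3_eq_cube)
    also have "\<dots> \<le> 1 / 4 * norm (u (x + a)) ^ 4 + 3 / 4 * norm (u x) ^ 4"
      using young_quartic[of "norm (u (x + a))" "norm (u x)"] by simp
    finally show "Re (u (x + a) * cnj (?N x)) \<le> 1 / 4 * norm (u (x + a)) ^ 4 + 3 / 4 * norm (u x) ^ 4" .
  qed (use i4 i4a in auto)
  also have "\<dots> = 1 / 4 * (LINT x|lborel. norm (u (x + a)) ^ 4) + 3 / 4 * (LINT x|lborel. norm (u x) ^ 4)"
    using i4 i4a by simp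
  also have "(LINT x|lborel. norm (u (x + a)) ^ 4) = (LINT x|lborel. norm (u x) ^ 4)"
    by (rule integral_lborel_shift) measurable
  also have "1 / 4 * (LINT x|lborel. norm (u x) ^ 4) + 3 / 4 * (LINT x|lborel. norm (u x) ^ 4) = (LINT x|lborel. norm (u x) ^ 4)"
    by simp
  also have "\<dots> = Re (L2_inner u ?N)"
    unfolding L2_inner_def eq4 by (simp only: integral_complex_of_real Re_complex_of_real)
  finally show ?thesis .
qed

text \<open>On the Fourier side a translation by a is the multiplier
  \<open>cis (a \<bullet> \<xi>)\<close>. Its difference quotients in direction j are dominated by
  |\<xi>_j|, so \<open>XU\<close> permits passing to the limit in the inequality of
  \<open>translate_pairing_le\<close>. The two signs of \<sigma>, translations in opposite
  directions, turn the resulting inequality into an equality.\<close>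

lemma nonlinearity_orthogonal_gradient:
  assumes N: "(cubic u) \<in> L2" (is "?N \<in> L2")
    and U: "L2_fourier u U" and W: "L2_fourier (cubic u) W"
    and XU: "(\<lambda>\<xi>. \<i> * of_real (\<xi> $ j) * U \<xi>) \<in> L2"
  shows "Re (L2_inner (\<lambda>\<xi>. \<i> * of_real (\<xi> $ j) * U \<xi>) W) = 0"
proof -
  note L2 = L2_fourier_L2[OF U] L2_fourier_L2[OF W]
  have [measurable]: "U \<in> borel_measurable borel" "W \<in> borel_measurable borel" using L2 by (auto dest: L2_measurable)
  have le: "Re (L2_inner (\<lambda>\<xi>. (cis (a \<bullet> \<xi>) - 1) * U \<xi>) W) \<le> 0" for a
  proof -
    have "L2_fourier (\<lambda>x. u (x + a)) (\<lambda>\<xi>. cis (a \<bullet> \<xi>) * U \<xi>)"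
      using L2_fourier_modulate_shift[OF U, of 0 0 "- a"] by simp
    from L2_fourier_inner[OF this W] translate_pairing_le[OF L2(1) N, of a] L2_fourier_inner[OF U W]
    have *: "Re (L2_inner (\<lambda>\<xi>. cis (a \<bullet> \<xi>) * U \<xi>) W) \<le> Re (L2_inner U W)" by simp
    have "(\<lambda>\<xi>. cis (a \<bullet> \<xi>) * U \<xi>) \<in> L2" by (rule L2_mult_bounded[OF L2(2), where c=1]) auto
    from L2_inner_diff_left[OF this L2(2,4)] * show ?thesis by (simp add: left_diff_distrib)
  qed
  have main: "Re (L2_inner (\<lambda>\<xi>. \<i> * of_real (\<sigma> * \<xi> $ j) * U \<xi>) W) \<le> 0" if \<sigma>: "\<bar>\<sigma>\<bar> = 1" for \<sigma>
  proof -
    let ?q = "\<lambda>n \<xi>. of_nat (Suc n) * (cis (\<sigma> * (\<xi> $ j) / real (Suc n)) - 1)"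
    have "(\<lambda>n. LINT \<xi>|lborel. ?q n \<xi> * U \<xi> * cnj (W \<xi>)) \<longlonglongrightarrow> (LINT \<xi>|lborel. \<i> * of_real (\<sigma> * (\<xi> $ j)) * U \<xi> * cnj (W \<xi>))"
    proof (rule integral_dominated_convergence)
      show "integrable lborel (\<lambda>\<xi>. norm (\<i> * of_real (\<xi> $ j) * U \<xi>) * norm (W \<xi>))"
        by (rule L2_integrable_norm_mult[OF XU L2(4)])
      show "AE \<xi> in lborel. (\<lambda>n. ?q n \<xi> * U \<xi> * cnj (W \<xi>)) \<longlonglongrightarrow> \<i> * of_real (\<sigma> * (\<xi> $ j)) * U \<xi> * cnj (W \<xi>)"
        by (intro AE_I2 tendsto_mult_right cis_difference_quotient_tendsto)
      show "AE \<xi> in lborel. norm (?q n \<xi> * U \<xi> * cnj (W \<xi>)) \<le> norm (\<i> * of_real (\<xi> $ j) * U \<xi>) * norm (W \<xi>)" for n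
      proof (intro AE_I2)
        fix \<xi> :: "real ^ 3"
        have "norm (?q n \<xi>) = real (Suc n) * norm (cis (\<sigma> * (\<xi> $ j) / real (Suc n)) - 1)"
          by (simp only: norm_mult norm_of_nat)
        also have "\<dots> \<le> real (Suc n) * \<bar>\<sigma> * (\<xi> $ j) / real (Suc n)\<bar>"
          by (intro mult_left_mono norm_cis_minus_1_le) auto
        also have "\<dots> = \<bar>\<xi> $ j\<bar>" using \<sigma> by (simp add: abs_mult)
        finally have "norm (?q n \<xi>) * (norm (U \<xi>) * norm (W \<xi>)) \<le> \<bar>\<xi> $ j\<bar> * (norm (U \<xi>) * norm (W \<xi>))"
          by (intro mult_right_mono) auto
        then show "norm (?q n \<xi> * U \<xi> * cnj (W \<xi>)) \<le> norm (\<i> * of_real (\<xi> $ j) * U \<xi>) * norm (W \<xi>)"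
          by (simp only: norm_mult complex_mod_cnj norm_ii norm_of_real mult.assoc mult_1)
      qed
    qed measurable
    from tendsto_Re[OF this] have lim: "(\<lambda>n. Re (L2_inner (\<lambda>\<xi>. ?q n \<xi> * U \<xi>) W)) \<longlonglongrightarrow> Re (L2_inner (\<lambda>\<xi>. \<i> * of_real (\<sigma> * (\<xi> $ j)) * U \<xi>) W)"
      by (simp only: L2_inner_def)
    have "Re (L2_inner (\<lambda>\<xi>. ?q n \<xi> * U \<xi>) W) \<le> 0" for n
    proof -
      have "L2_inner (\<lambda>\<xi>. ?q n \<xi> * U \<xi>) W = of_nat (Suc n) * L2_inner (\<lambda>\<xi>. (cis (((\<sigma> / real (Suc n)) *\<^sub>R axis j 1) \<bullet> \<xi>) - 1) * U \<xi>) W"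
        unfolding L2_inner_cmult_left[symmetric]
        by (simp add: inner_commute[of "axis j 1"] inner_axis_1 mult.assoc)
      then have "Re (L2_inner (\<lambda>\<xi>. ?q n \<xi> * U \<xi>) W) = real (Suc n) * Re (L2_inner (\<lambda>\<xi>. (cis (((\<sigma> / real (Suc n)) *\<^sub>R axis j 1) \<bullet> \<xi>) - 1) * U \<xi>) W)"
        by (simp del: of_nat_Suc)
      also have "\<dots> \<le> 0" by (rule mult_nonneg_nonpos[OF of_nat_0_le_iff le])
      finally show ?thesis .
    qed
    with lim show ?thesis by (intro LIMSEQ_le_const2[OF lim]) auto
  qed
  have "L2_inner (\<lambda>\<xi>. \<i> * of_real (- 1 * \<xi> $ j) * U \<xi>) W = - L2_inner (\<lambda>\<xi>. \<i> * of_real (\<xi> $ j) * U \<xi>) W"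
    using L2_inner_cmult_left[of "-1" "\<lambda>\<xi>. \<i> * of_real (\<xi> $ j) * U \<xi>" W] by simp
  then show ?thesis using main[of 1] main[of "-1"] by simp
qed

lemma momentum_fourier:
  assumes "f \<in> H1" "L2_fourier f F"
  shows "momentum f $ j = Re (L2_inner (\<lambda>\<xi>. of_real (\<xi> $ j) * F \<xi>) F)"
proof -
  have "momentum f $ j = Im (L2_inner (\<lambda>x. grad f x $ j) f)"
    by (simp add: momentum_def L2_inner_def mult.commute)
  also have "L2_inner (\<lambda>x. grad f x $ j) f = L2_inner (\<lambda>\<xi>. \<i> * (of_real (\<xi> $ j) * F \<xi>)) F"
    using L2_fourier_inner[OF L2_fourier_grad[OF assms, of j] assms(2)] by (simp add: mult.assoc)
  also have "Im \<dots> = Re (L2_inner (\<lambda>\<xi>. of_real (\<xi> $ j) * F \<xi>) F)"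
    unfolding L2_inner_cmult_left by simp
  finally show ?thesis .
qed

lemma momentum_cong_AE:
  assumes "f \<in> H1" "g \<in> H1" "AE x in lborel. f x = g x"
  shows "momentum f = momentum g"
proof -
  have "L2_inner (\<lambda>x. grad f x $ j) f = L2_inner (\<lambda>x. grad g x $ j) g" for j
    using grad_cong_AE[OF assms] assms(3)
    by (intro L2_inner_cong_AE L2_measurable[OF L2_nth[OF grad_L2]] L2_measurable[OF H1_L2] assms(1,2)) auto
  then show ?thesis by (simp add: momentum_def vec_eq_iff L2_inner_def mult.commute)
qed

section \<open>Duhamel's formula for the profile on the Fourier side\<close>

text \<open>The multiplier of the backward free flow. If U t and W t are the transforms of u(t) and
  of |u|^2 u at time t, then \<open>phase t (U t)\<close> is the profile F(t) and
  \<open>phase t (W t)\<close> its source M(t).\<close>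

definition phase :: "real \<Rightarrow> (real ^ 3 \<Rightarrow> complex) \<Rightarrow> real ^ 3 \<Rightarrow> complex" where
  "phase t F \<xi> = cis (t * norm \<xi> ^ 2) * F \<xi>"

lemma phase_L2:
  assumes "F \<in> L2" shows "phase t F \<in> L2"
proof -
  have "(\<lambda>\<xi>. cis (t * norm \<xi> ^ 2) * F \<xi>) \<in> L2" by (rule L2_mult_bounded[OF assms, where c=1]) auto
  then show ?thesis by (simp add: phase_def[abs_def])
qed

lemma L2_norm_phase: "L2_norm (phase t F) = L2_norm F"
  by (rule L2_norm_cong) (simp add: phase_def norm_mult)

lemma L2_inner_phase: "L2_inner (phase t F) G = L2_inner F (phase (- t) G)"
  by (simp add: L2_inner_def phase_def cis_cnj mult_ac)

lemma phase_phase: "phase s (phase t F) = phase (s + t) F"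
  by (simp add: phase_def fun_eq_iff cis_mult algebra_simps flip: mult.assoc)

lemma global_solution_H1: "global_solution u0 u \<Longrightarrow> 0 \<le> t \<Longrightarrow> u t \<in> H1"
  by (simp add: global_solution_def continuous_in_H1_def)

lemma free_evolution_L2: "free_evolution t f g \<Longrightarrow> f \<in> L2"
  by (auto simp: free_evolution_def dest: L2_fourier_L2)

text \<open>\<open>free_evolution\<close> determines its Fourier data only up to null sets; pairings
  and norms may be computed with any representative F fixed beforehand.\<close>

lemma free_evolution_inner:
  assumes "free_evolution t f g" "L2_fourier f' F" "AE x in lborel. f x = f' x" "L2_fourier \<kappa> \<eta>"
  shows "L2_inner g \<kappa> = L2_inner (phase (- t) F) \<eta>"
    and "L2_norm g = L2_norm F"
proof -
  obtain F' where F': "L2_fourier f F'" "L2_fourier g (\<lambda>\<xi>. cis (- t * norm \<xi> ^ 2) * F' \<xi>)"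
    using assms(1) by (auto simp: free_evolution_def)
  have AE: "AE \<xi> in lborel. F' \<xi> = F \<xi>" by (rule L2_fourier_unique[OF F'(1) assms(2,3)])
  have AE': "AE \<xi> in lborel. cis (- t * norm \<xi> ^ 2) * F' \<xi> = phase (- t) F \<xi>"
    using AE by eventually_elim (simp add: phase_def)
  note m = L2_measurable[OF L2_fourier_L2(2)[OF F'(2)]] L2_measurable[OF phase_L2[OF L2_fourier_L2(2)[OF assms(2)]]]
  have "L2_inner g \<kappa> = L2_inner (\<lambda>\<xi>. cis (- t * norm \<xi> ^ 2) * F' \<xi>) \<eta>"
    by (rule L2_fourier_inner[OF F'(2) assms(4), symmetric])
  also have "\<dots> = L2_inner (phase (- t) F) \<eta>"
    using AE' L2_measurable[OF L2_fourier_L2(2)[OF assms(4)]] by (intro L2_inner_cong_AE m) auto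
  finally show "L2_inner g \<kappa> = L2_inner (phase (- t) F) \<eta>" .
  have "L2_norm g = L2_norm (\<lambda>\<xi>. cis (- t * norm \<xi> ^ 2) * F' \<xi>)"
    by (rule L2_fourier_isometry[OF F'(2), symmetric])
  also have "\<dots> = L2_norm (phase (- t) F)"
    using AE' by (intro L2_norm_cong_AE m) auto
  finally show "L2_norm g = L2_norm F" by (simp add: L2_norm_phase)
qed

text \<open>At s = t the Duhamel clause applies \<open>free_evolution\<close> to the nonlinearity,
  and this relation holds only between elements of \<open>L2\<close>.\<close>

lemma global_solution_nonlinearity_L2:
  assumes "global_solution u0 u" "0 \<le> t"
  shows "(cubic (u t)) \<in> L2"
proof -
  obtain G where "\<forall>s\<in>{0..t}. free_evolution (t - s) (cubic (u s)) (G s)"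
    using assms unfolding global_solution_def by blast
  then show ?thesis using assms(2) by (auto intro: free_evolution_L2)
qed

text \<open>Pairing Duhamel's formula with the inverse transform of
  \<open>phase (- t) \<psi>\<close> undoes the free flow: the phase of the integrand, which depends
  on t - s, becomes one depending on s alone. Integrals up to different times then share one
  integrand and can be subtracted.\<close>

lemma Duhamel_fourier:
  assumes sol: "global_solution u0 u"
    and U: "\<And>t. 0 \<le> t \<Longrightarrow> L2_fourier (u t) (U t)"
    and W: "\<And>t. 0 \<le> t \<Longrightarrow> L2_fourier (cubic (u t)) (W t)"
    and t: "0 \<le> t"
  shows "set_integrable lborel {0..t} (\<lambda>s. L2_norm (W s))"
    and "\<psi> \<in> L2 \<Longrightarrow> set_integrable lborel {0..t} (\<lambda>s. L2_inner (phase s (W s)) \<psi>)"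
    and "\<psi> \<in> L2 \<Longrightarrow> L2_inner (phase t (U t)) \<psi> =
      L2_inner (U 0) \<psi> + \<i> * (LINT s:{0..t}|lborel. L2_inner (phase s (W s)) \<psi>)"
proof -
  obtain g G V where g: "free_evolution t u0 g"
    and G: "\<And>s. s \<in> {0..t} \<Longrightarrow> free_evolution (t - s) (cubic (u s)) (G s)"
    and V: "has_L2_integral G 0 t V"
    and eq: "AE x in lborel. u t x = g x + \<i> * V x"
    using sol t unfolding global_solution_def by blast
  have GW: "L2_norm (G s) = L2_norm (W s)" if "s \<in> {0..t}" for s
    using that by (intro free_evolution_inner(2)[OF G[OF that] W _ W]) auto
  have "set_integrable lborel {0..t} (\<lambda>s. L2_norm (G s))" using V by (simp add: has_L2_integral_def)
  then show "set_integrable lborel {0..t} (\<lambda>s. L2_norm (W s))"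
    by (subst (asm) set_integrable_cong[OF refl refl GW]) auto
  assume \<psi>: "\<psi> \<in> L2"
  obtain \<kappa> where \<kappa>: "L2_fourier \<kappa> (phase (- t) \<psi>)" using L2_fourier_onto[OF phase_L2[OF \<psi>]] by blast
  note \<kappa>L2 = L2_fourier_L2(1)[OF \<kappa>]
  have inner: "L2_inner (G s) \<kappa> = L2_inner (phase s (W s)) \<psi>" if "s \<in> {0..t}" for s
  proof -
    have "L2_inner (G s) \<kappa> = L2_inner (phase (- (t - s)) (W s)) (phase (- t) \<psi>)"
      by (rule free_evolution_inner(1)[OF G[OF that] W _ \<kappa>]) (use that in auto)
    then show ?thesis by (simp add: L2_inner_phase[symmetric] phase_phase)
  qed
  have VG: "set_integrable lborel {0..t} (\<lambda>s. L2_inner (G s) \<kappa>)"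
    "L2_inner V \<kappa> = (LINT s:{0..t}|lborel. L2_inner (G s) \<kappa>)" "V \<in> L2"
    using V \<kappa>L2 by (auto simp: has_L2_integral_def)
  from VG(1) show "set_integrable lborel {0..t} (\<lambda>s. L2_inner (phase s (W s)) \<psi>)"
    by (subst (asm) set_integrable_cong[OF refl refl inner]) auto
  have Vi: "L2_inner V \<kappa> = (LINT s:{0..t}|lborel. L2_inner (phase s (W s)) \<psi>)"
    unfolding VG(2) by (rule set_lebesgue_integral_cong) (use inner in auto)
  have u0: "AE x in lborel. u0 x = u 0 x" using sol by (auto simp: global_solution_def)
  have gi: "L2_inner g \<kappa> = L2_inner (U 0) \<psi>"
    using free_evolution_inner(1)[OF g U u0 \<kappa>] by (simp add: L2_inner_phase[symmetric] phase_phase) (simp add: phase_def[abs_def])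
  have gL2: "g \<in> L2" using g by (auto simp: free_evolution_def dest: L2_fourier_L2)
  have "L2_inner (phase t (U t)) \<psi> = L2_inner (U t) (phase (- t) \<psi>)" by (rule L2_inner_phase)
  also have "\<dots> = L2_inner (u t) \<kappa>" by (rule L2_fourier_inner[OF U[OF t] \<kappa>])
  also have "\<dots> = L2_inner (\<lambda>x. g x + \<i> * V x) \<kappa>"
    using eq by (intro L2_inner_cong_AE L2_measurable[OF L2_fourier_L2(1)[OF U[OF t]]] L2_measurable[OF \<kappa>L2]
        L2_measurable[OF L2_add[OF gL2 L2_cmult[OF VG(3)]]]) auto
  also have "\<dots> = L2_inner g \<kappa> + \<i> * L2_inner V \<kappa>"
    by (simp add: L2_inner_add_left[OF gL2 L2_cmult[OF VG(3)] \<kappa>L2] L2_inner_cmult_left)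
  finally show "L2_inner (phase t (U t)) \<psi> = L2_inner (U 0) \<psi> + \<i> * (LINT s:{0..t}|lborel. L2_inner (phase s (W s)) \<psi>)"
    by (simp add: gi Vi)
qed

text \<open>X t - X x splits into two parts. The increment of \<xi>_j U, on which
  \<open>phase t\<close> acts isometrically, is bounded by the gradient part of the H1 norm; the
  change of phase on the fixed element \<xi>_j U x, called \<open>d\<close>, is bounded by 2 and
  treated by dominated convergence.\<close>

lemma profile_continuous:
  fixes j :: 3
  assumes sol: "global_solution u0 u"
    and U: "\<And>t. 0 \<le> t \<Longrightarrow> L2_fourier (u t) (U t)" and x: "0 \<le> x"
  defines "X \<equiv> \<lambda>t. phase t (\<lambda>\<xi>. of_real (\<xi> $ j) * U t \<xi>)"
  shows "((\<lambda>t. L2_dist (X t) (X x)) \<longlongrightarrow> 0) (at x within {0..})"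
proof -
  have XU: "(\<lambda>\<xi>. of_real (\<xi> $ j) * U t \<xi>) \<in> L2" if "0 \<le> t" for t
    using L2_cmult[OF L2_fourier_L2(2)[OF L2_fourier_grad[OF global_solution_H1[OF sol that] U[OF that], of j]], of "- \<i>"]
    by (simp add: mult.assoc[symmetric])
  define d where "d = (\<lambda>t \<xi>. (cis (t * norm \<xi> ^ 2) - cis (x * norm \<xi> ^ 2)) * (of_real (\<xi> $ j) * U x \<xi>))"
  have dL2: "d t \<in> L2" for t
    unfolding d_def by (rule L2_mult_bounded[OF XU[OF x], where c=2]) (auto intro: order_trans[OF norm_triangle_ineq4])
  have dlim: "((\<lambda>t. L2_norm (d t)) \<longlongrightarrow> 0) (at x within {0..})"
    unfolding tendsto_at_iff_sequentially comp_def
  proof (intro allI impI)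
    fix T assume T: "T \<longlonglongrightarrow> x"
    show "(\<lambda>i. L2_norm (d (T i))) \<longlonglongrightarrow> 0"
    proof (rule L2_norm_tendsto_0_dominated[OF L2_measurable[OF dL2] XU[OF x], where c=2])
      show "AE \<xi> in lborel. (\<lambda>n. d (T n) \<xi>) \<longlonglongrightarrow> 0"
      proof (intro AE_I2)
        fix \<xi> :: "real ^ 3"
        have "isCont (\<lambda>t. cis (t * norm \<xi> ^ 2)) x" unfolding cis_conv_exp by (intro continuous_intros)
        note lim = isCont_tendsto_compose[OF this T]
        have "(\<lambda>n. d (T n) \<xi>) \<longlonglongrightarrow> (cis (x * norm \<xi> ^ 2) - cis (x * norm \<xi> ^ 2)) * (of_real (\<xi> $ j) * U x \<xi>)"
          unfolding d_def by (rule tendsto_mult_right[OF tendsto_diff[OF lim tendsto_const]])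
        then show "(\<lambda>n. d (T n) \<xi>) \<longlonglongrightarrow> 0" by simp
      qed
      show "norm (d (T n) \<xi>) \<le> 2 * norm (of_real (\<xi> $ j) * U x \<xi>)" for n \<xi>
        unfolding d_def norm_mult[of "cis _ - cis _"]
        by (intro mult_right_mono order_trans[OF norm_triangle_ineq4]) auto
    qed
  qed
  have hlim: "((\<lambda>t. H1_norm (\<lambda>y. u t y - u x y)) \<longlongrightarrow> 0) (at x within {0..})"
    using sol x by (simp add: global_solution_def continuous_in_H1_def)
  show ?thesis
  proof (rule Lim_null_comparison)
    show "((\<lambda>t. H1_norm (\<lambda>y. u t y - u x y) + L2_norm (d t)) \<longlongrightarrow> 0) (at x within {0..})"
      using tendsto_add[OF hlim dlim] by simp
    have "norm (L2_dist (X t) (X x)) \<le> H1_norm (\<lambda>y. u t y - u x y) + L2_norm (d t)" if t: "0 \<le> t" for t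
    proof -
      have H: "(\<lambda>y. u t y - u x y) \<in> H1" by (intro H1_diff global_solution_H1[OF sol] t x)
      have F: "L2_fourier (\<lambda>y. u t y - u x y) (\<lambda>\<xi>. U t \<xi> - U x \<xi>)"
        using L2_fourier_add_cmult[OF U[OF t] U[OF x], of "-1"] by simp
      let ?e = "\<lambda>\<xi>. of_real (\<xi> $ j) * (U t \<xi> - U x \<xi>)"
      have eL2: "?e \<in> L2" using L2_diff[OF XU[OF t] XU[OF x]] by (simp add: right_diff_distrib)
      have "X t \<xi> - X x \<xi> = phase t ?e \<xi> + d t \<xi>" for \<xi>
        by (simp add: X_def phase_def d_def algebra_simps)
      then have "L2_dist (X t) (X x) \<le> L2_norm (phase t ?e) + L2_norm (d t)"
        using L2_norm_triangle[OF phase_L2[OF eL2] dL2, of t t] by simp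
      also have "L2_norm (phase t ?e) = L2_norm ?e" by (rule L2_norm_phase)
      also have "L2_norm ?e = L2_norm (\<lambda>\<xi>. \<i> * of_real (\<xi> $ j) * (U t \<xi> - U x \<xi>))"
        by (rule L2_norm_cong) (simp add: norm_mult)
      also have "\<dots> = L2_norm (\<lambda>y. grad (\<lambda>y. u t y - u x y) y $ j)"
        by (rule L2_fourier_isometry[OF L2_fourier_grad[OF H F]])
      also have "\<dots> \<le> L2_norm (grad (\<lambda>y. u t y - u x y))"
        by (rule L2_norm_vec_le(2)[OF grad_L2[OF H]])
      also have "\<dots> \<le> H1_norm (\<lambda>y. u t y - u x y)"
        unfolding H1_norm_def by (rule real_le_rsqrt) simp
      finally show ?thesis by simp
    qed
    then show "\<forall>\<^sub>F t in at x within {0..}. norm (L2_dist (X t) (X x)) \<le> H1_norm (\<lambda>y. u t y - u x y) + L2_norm (d t)"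
      by (auto simp: eventually_at_filter)
  qed
qed

theorem momentum_conserved:
  assumes sol: "global_solution u0 u" and T: "0 \<le> T"
  shows "momentum (u T) = momentum (u 0)"
proof -
  have "\<exists>F. L2_fourier (u t) F" if "0 \<le> t" for t
    by (rule L2_fourier_exists[OF H1_L2[OF global_solution_H1[OF sol that]]])
  then obtain U where U: "\<And>t. 0 \<le> t \<Longrightarrow> L2_fourier (u t) (U t)" by metis
  have "\<exists>F. L2_fourier (cubic (u t)) F" if "0 \<le> t" for t
    by (rule L2_fourier_exists[OF global_solution_nonlinearity_L2[OF sol that]])
  then obtain W where W: "\<And>t. 0 \<le> t \<Longrightarrow> L2_fourier (cubic (u t)) (W t)" by metis
  have D1: "set_integrable lborel {0..t} (\<lambda>s. L2_norm (W s))" if "0 \<le> t" for t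
    using Duhamel_fourier(1)[OF sol, of U W t] U W that by blast
  have D2: "set_integrable lborel {0..t} (\<lambda>s. L2_inner (phase s (W s)) \<psi>)" if "0 \<le> t" "\<psi> \<in> L2" for t \<psi>
    using Duhamel_fourier(2)[OF sol, of U W t \<psi>] U W that by blast
  have D3: "L2_inner (phase t (U t)) \<psi> = L2_inner (U 0) \<psi> + \<i> * (LINT s:{0..t}|lborel. L2_inner (phase s (W s)) \<psi>)"
    if "0 \<le> t" "\<psi> \<in> L2" for t \<psi>
    using Duhamel_fourier(3)[OF sol, of U W t \<psi>] U W that by blast
  have UL2: "U t \<in> L2" and WL2: "W t \<in> L2" if "0 \<le> t" for t
    using L2_fourier_L2(2)[OF U[OF that]] L2_fourier_L2(2)[OF W[OF that]] .
  have "momentum (u T) $ j = momentum (u 0) $ j" for j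
  proof -
    have iXU: "(\<lambda>\<xi>. \<i> * of_real (\<xi> $ j) * U t \<xi>) \<in> L2" if "0 \<le> t" for t
      by (rule L2_fourier_L2(2)[OF L2_fourier_grad[OF global_solution_H1[OF sol that] U[OF that]]])
    have XU: "(\<lambda>\<xi>. of_real (\<xi> $ j) * U t \<xi>) \<in> L2" if "0 \<le> t" for t
      using L2_cmult[OF iXU[OF that], of "- \<i>"] by (simp add: mult.assoc[symmetric])
    define X where "X = (\<lambda>t. phase t (\<lambda>\<xi>. of_real (\<xi> $ j) * U t \<xi>))"
    have XL2: "X t \<in> L2" if "0 \<le> t" for t unfolding X_def by (rule phase_L2[OF XU[OF that]])
    define F where "F = (\<lambda>t. phase t (U t))"
    have FL2: "F t \<in> L2" if "0 \<le> t" for t unfolding F_def by (rule phase_L2[OF UL2[OF that]])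
    have XF: "X t \<xi> = of_real (\<xi> $ j) * F t \<xi>" for t \<xi> by (simp add: X_def F_def phase_def mult_ac)
    define p where "p = (\<lambda>t. momentum (u t) $ j)"
    have p: "p t = Re (L2_inner (F t) (X t))" if "0 \<le> t" for t
    proof -
      have "p t = Re (L2_inner (\<lambda>\<xi>. of_real (\<xi> $ j) * U t \<xi>) (U t))"
        unfolding p_def by (rule momentum_fourier[OF global_solution_H1[OF sol that] U[OF that]])
      also have "L2_inner (\<lambda>\<xi>. of_real (\<xi> $ j) * U t \<xi>) (U t) = L2_inner (X t) (F t)"
        unfolding X_def F_def L2_inner_phase phase_phase by (simp add: phase_def[abs_def])
      finally show ?thesis by (subst L2_inner_commute) simp
    qed
    \<comment> \<open>A difference of squares: multiplication by the real \<xi>_j is symmetric, so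
      the real parts of the cross terms cancel.\<close>
    have diff: "p t - p s = Re (L2_inner (\<lambda>\<xi>. F t \<xi> - F s \<xi>) (\<lambda>\<xi>. X t \<xi> + X s \<xi>))" if "0 \<le> s" "0 \<le> t" for s t
    proof -
      have "L2_inner (F t) (X s) = cnj (L2_inner (F s) (X t))"
        unfolding L2_inner_commute[of "F s" "X t", symmetric] by (subst L2_inner_commute[of "F s" "X t"]) (simp add: L2_inner_def XF mult_ac)
      then have "Re (L2_inner (F t) (X s)) = Re (L2_inner (F s) (X t))" by simp
      then show ?thesis
        using that by (simp add: p L2_inner_diff_left L2_inner_add_right FL2 XL2 L2_add)
    qed
    \<comment> \<open>At equal times the phases cancel in the pairing, which leaves the
      orthogonality of |u|^2 u and the j-th derivative of u.\<close>
    have orth: "Re (\<i> * L2_inner (phase \<tau> (W \<tau>)) (X \<tau>)) = 0" if "0 \<le> \<tau>" for \<tau>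
    proof -
      have "L2_inner (phase \<tau> (W \<tau>)) (X \<tau>) = L2_inner (W \<tau>) (\<lambda>\<xi>. of_real (\<xi> $ j) * U \<tau> \<xi>)"
        unfolding X_def L2_inner_phase phase_phase by (simp add: phase_def[abs_def])
      then have "Re (\<i> * L2_inner (phase \<tau> (W \<tau>)) (X \<tau>)) = Re (- L2_inner (W \<tau>) (\<lambda>\<xi>. \<i> * (of_real (\<xi> $ j) * U \<tau> \<xi>)))"
        by (simp add: L2_inner_cmult_right)
      also have "\<dots> = - Re (L2_inner (\<lambda>\<xi>. \<i> * (of_real (\<xi> $ j) * U \<tau> \<xi>)) (W \<tau>))"
        by (subst L2_inner_commute) simp
      also have "\<dots> = 0"
        using nonlinearity_orthogonal_gradient[OF global_solution_nonlinearity_L2[OF sol that] U[OF that] W[OF that] iXU[OF that]]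
        by (simp add: mult.assoc)
      finally show ?thesis .
    qed
    \<comment> \<open>Half-open intervals make adjacent ones disjoint, so that integrals over them
      add up exactly.\<close>
    have Wint: "set_integrable lborel {s<..t} (\<lambda>\<tau>. L2_norm (W \<tau>))" if "0 \<le> s" "s \<le> t" for s t
      using that by (intro set_integrable_subset[OF D1[of t]]) auto
    have incr: "L2_inner (\<lambda>\<xi>. F t \<xi> - F s \<xi>) \<psi> = \<i> * (LINT \<tau>:{s<..t}|lborel. L2_inner (phase \<tau> (W \<tau>)) \<psi>)"
      and Mint: "set_integrable lborel {s<..t} (\<lambda>\<tau>. L2_inner (phase \<tau> (W \<tau>)) \<psi>)"
      if st: "0 \<le> s" "s \<le> t" and \<psi>: "\<psi> \<in> L2" for s t \<psi>
    proof -
      have t: "0 \<le> t" using st by simp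
      show M: "set_integrable lborel {s<..t} (\<lambda>\<tau>. L2_inner (phase \<tau> (W \<tau>)) \<psi>)"
        by (rule set_integrable_subset[OF D2[OF t \<psi>]]) (use st in auto)
      have "{0..t} = {0..s} \<union> {s<..t}" using st by auto
      moreover have "{0..s} \<inter> {s<..t} = {}" by auto
      ultimately have "(LINT \<tau>:{0..t}|lborel. L2_inner (phase \<tau> (W \<tau>)) \<psi>) =
        (LINT \<tau>:{0..s}|lborel. L2_inner (phase \<tau> (W \<tau>)) \<psi>) + (LINT \<tau>:{s<..t}|lborel. L2_inner (phase \<tau> (W \<tau>)) \<psi>)"
        using set_integral_Un[OF _ D2[OF st(1) \<psi>] M] by simp
      then show "L2_inner (\<lambda>\<xi>. F t \<xi> - F s \<xi>) \<psi> = \<i> * (LINT \<tau>:{s<..t}|lborel. L2_inner (phase \<tau> (W \<tau>)) \<psi>)"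
        using D3[OF t \<psi>] D3[OF st(1) \<psi>]
        by (simp add: L2_inner_diff_left FL2 t st \<psi> F_def[symmetric] distrib_left)
          (simp add: F_def)
    qed
    \<comment> \<open>By \<open>orth\<close>, subtracting 2 X \<tau> from X t + X s does not change
      the real part of the integrand; the remainder is small when X varies little on [s, t].\<close>
    have bound: "\<bar>p t - p s\<bar> \<le> \<epsilon> * (LINT \<tau>:{s<..t}|lborel. L2_norm (W \<tau>))"
      if st: "0 \<le> s" "s \<le> t" and \<epsilon>: "\<And>\<tau>. \<tau> \<in> {s<..t} \<Longrightarrow> L2_norm (\<lambda>\<xi>. (X t \<xi> + X s \<xi>) - 2 * X \<tau> \<xi>) \<le> \<epsilon>" for s t \<epsilon>
    proof -
      let ?\<psi> = "\<lambda>\<xi>. X t \<xi> + X s \<xi>"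
      have t: "0 \<le> t" using st by simp
      have \<psi>: "?\<psi> \<in> L2" using st by (intro L2_add XL2) auto
      let ?f = "\<lambda>\<tau>. indicator {s<..t} \<tau> *\<^sub>R Re (\<i> * L2_inner (phase \<tau> (W \<tau>)) ?\<psi>)"
      have fi: "integrable lborel (\<lambda>\<tau>. indicator {s<..t} \<tau> *\<^sub>R (\<i> * L2_inner (phase \<tau> (W \<tau>)) ?\<psi>))"
        using integrable_mult_right[of \<i>, OF Mint[OF st \<psi>, unfolded set_integrable_def]] by simp
      have "p t - p s = Re (\<i> * (LINT \<tau>:{s<..t}|lborel. L2_inner (phase \<tau> (W \<tau>)) ?\<psi>))"
        unfolding diff[OF st(1) t] incr[OF st \<psi>] ..
      also have "\<i> * (LINT \<tau>:{s<..t}|lborel. L2_inner (phase \<tau> (W \<tau>)) ?\<psi>) =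
          (LINT \<tau>|lborel. indicator {s<..t} \<tau> *\<^sub>R (\<i> * L2_inner (phase \<tau> (W \<tau>)) ?\<psi>))"
        unfolding set_lebesgue_integral_def by (subst integral_mult_right_zero[symmetric]) simp
      also have "Re \<dots> = (LINT \<tau>|lborel. ?f \<tau>)"
        by (subst integral_Re[OF fi, symmetric]) simp
      also have "norm \<dots> \<le> (LINT \<tau>|lborel. \<epsilon> * (indicator {s<..t} \<tau> *\<^sub>R L2_norm (W \<tau>)))"
      proof (rule Bochner_Integration.integral_norm_bound_integral)
        show "integrable lborel ?f" using integrable_Re[OF fi] by simp
        show "integrable lborel (\<lambda>\<tau>. \<epsilon> * (indicator {s<..t} \<tau> *\<^sub>R L2_norm (W \<tau>)))"
          using Wint[OF st] unfolding set_integrable_def by (rule integrable_mult_right)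
        fix \<tau>
        show "norm (?f \<tau>) \<le> \<epsilon> * (indicator {s<..t} \<tau> *\<^sub>R L2_norm (W \<tau>))"
        proof (cases "\<tau> \<in> {s<..t}")
          case True
          then have \<tau>: "0 \<le> \<tau>" using st by auto
          note L2s = phase_L2[OF WL2[OF \<tau>]] XL2[OF \<tau>]
          have "L2_inner (phase \<tau> (W \<tau>)) ?\<psi> =
            L2_inner (phase \<tau> (W \<tau>)) (\<lambda>\<xi>. ?\<psi> \<xi> - 2 * X \<tau> \<xi>) + 2 * L2_inner (phase \<tau> (W \<tau>)) (X \<tau>)"
            using L2_inner_diff_right[OF \<psi> L2_cmult[OF L2s(2), of 2] L2s(1)[of \<tau>]] by (simp add: L2_inner_cmult_right)
          then have "Re (\<i> * L2_inner (phase \<tau> (W \<tau>)) ?\<psi>) = Re (\<i> * L2_inner (phase \<tau> (W \<tau>)) (\<lambda>\<xi>. ?\<psi> \<xi> - 2 * X \<tau> \<xi>))"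
            using orth[OF \<tau>] by (simp add: distrib_left)
          also have "\<bar>\<dots>\<bar> \<le> norm (\<i> * L2_inner (phase \<tau> (W \<tau>)) (\<lambda>\<xi>. ?\<psi> \<xi> - 2 * X \<tau> \<xi>))"
            by (rule abs_Re_le_cmod)
          also have "\<dots> \<le> L2_norm (W \<tau>) * L2_norm (\<lambda>\<xi>. ?\<psi> \<xi> - 2 * X \<tau> \<xi>)"
            using L2_Cauchy_Schwarz[OF L2s(1)[of \<tau>] L2_diff[OF \<psi> L2_cmult[OF L2s(2), of 2]]]
            by (simp add: norm_mult L2_norm_phase)
          also have "\<dots> \<le> L2_norm (W \<tau>) * \<epsilon>"
            using \<epsilon>[OF True] by (intro mult_left_mono) auto
          finally show ?thesis using True by (simp add: mult.commute)
        qed simp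
      qed
      finally show ?thesis by (simp add: set_lebesgue_integral_def)
    qed
    have "\<bar>p T - p 0\<bar> \<le> e * (LINT \<tau>:{0<..T}|lborel. L2_norm (W \<tau>))" if e: "0 < e" for e
    proof -
      \<comment> \<open>Bisection produces the fine partition: the estimate is additive over
        adjacent intervals and holds on short intervals around each point, where X is continuous.
        The premises at 0 and T are instances of the restriction to subintervals of [0, T].\<close>
      have "0 \<le> (0::real) \<longrightarrow> 0 \<le> T \<longrightarrow> T \<le> T \<longrightarrow> \<bar>p T - p 0\<bar> \<le> e * (LINT \<tau>:{0<..T}|lborel. L2_norm (W \<tau>))"
        using T
      proof (induction rule: Bolzano[where P="\<lambda>a b. 0 \<le> a \<longrightarrow> a \<le> b \<longrightarrow> b \<le> T \<longrightarrow> \<bar>p b - p a\<bar> \<le> e * (LINT \<tau>:{a<..b}|lborel. L2_norm (W \<tau>))"])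
        case (trans a b c)
        show ?case
        proof (intro impI)
          assume a: "0 \<le> a" "c \<le> T"
          have "{a<..c} = {a<..b} \<union> {b<..c}" using trans by auto
          moreover have "{a<..b} \<inter> {b<..c} = {}" by auto
          ultimately have "(LINT \<tau>:{a<..c}|lborel. L2_norm (W \<tau>)) = (LINT \<tau>:{a<..b}|lborel. L2_norm (W \<tau>)) + (LINT \<tau>:{b<..c}|lborel. L2_norm (W \<tau>))"
            using set_integral_Un[OF _ Wint Wint, of a b b c] a trans by simp
          moreover have "\<bar>p b - p a\<bar> \<le> e * (LINT \<tau>:{a<..b}|lborel. L2_norm (W \<tau>))" "\<bar>p c - p b\<bar> \<le> e * (LINT \<tau>:{b<..c}|lborel. L2_norm (W \<tau>))"
            using trans a by auto
          ultimately show "\<bar>p c - p a\<bar> \<le> e * (LINT \<tau>:{a<..c}|lborel. L2_norm (W \<tau>))"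
            by (simp add: distrib_left)
        qed
      next
        case (local x)
        have "((\<lambda>t. L2_dist (X t) (X x)) \<longlongrightarrow> 0) (at x within {0..})"
          unfolding X_def by (rule profile_continuous[OF sol U]) (use local in auto)
        \<comment> \<open>X a and X b enter once and X \<tau> twice: four distances to X x, hence e
          / 4.\<close>
        then have "\<forall>\<^sub>F t in at x within {0..}. L2_dist (X t) (X x) < e / 4"
          using e by (intro order_tendstoD(2)) auto
        then obtain d where d: "0 < d" "\<And>t. 0 \<le> t \<Longrightarrow> t \<noteq> x \<Longrightarrow> dist t x < d \<Longrightarrow> L2_dist (X t) (X x) < e / 4"
          by (auto simp: eventually_at)
        have d': "L2_dist (X t) (X x) \<le> e / 4" if "0 \<le> t" "\<bar>t - x\<bar> < d" for t
          using d(2)[of t] that e by (cases "t = x") (auto simp: dist_real_def L2_norm_def)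
        show ?case
        proof (intro exI[of _ d] conjI allI impI d(1))
          fix a b assume ab: "a \<le> x \<and> x \<le> b \<and> b - a < d" "0 \<le> a" "a \<le> b" "b \<le> T"
          show "\<bar>p b - p a\<bar> \<le> e * (LINT \<tau>:{a<..b}|lborel. L2_norm (W \<tau>))"
          proof (rule bound)
            fix \<tau> assume \<tau>: "\<tau> \<in> {a<..b}"
            have nn: "0 \<le> \<tau>" "0 \<le> b" "0 \<le> x" using ab \<tau> by auto
            note L = XL2[OF ab(2)] XL2[OF nn(1)] XL2[OF nn(2)] XL2[OF nn(3)]
            have "L2_norm (\<lambda>\<xi>. (X b \<xi> + X a \<xi>) - 2 * X \<tau> \<xi>) =
              L2_norm (\<lambda>\<xi>. ((X b \<xi> - X x \<xi>) + (X a \<xi> - X x \<xi>)) - 2 * (X \<tau> \<xi> - X x \<xi>))"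
              by (rule L2_norm_cong) (simp add: algebra_simps)
            also have "\<dots> \<le> L2_norm (\<lambda>\<xi>. (X b \<xi> - X x \<xi>) + (X a \<xi> - X x \<xi>)) + L2_norm (\<lambda>\<xi>. 2 * (X \<tau> \<xi> - X x \<xi>))"
              by (rule L2_norm_diff_triangle[OF L2_add[OF L2_diff[OF L(3,4)] L2_diff[OF L(1,4)]] L2_cmult[OF L2_diff[OF L(2,4)]]])
            also have "\<dots> \<le> (L2_dist (X b) (X x) + L2_dist (X a) (X x)) + 2 * L2_dist (X \<tau>) (X x)"
              unfolding L2_norm_cmult using L2_norm_triangle[OF L2_diff[OF L(3,4)] L2_diff[OF L(1,4)]] by simp
            also have "\<dots> \<le> e"
            proof -
              have "\<bar>a - x\<bar> < d" "\<bar>b - x\<bar> < d" "\<bar>\<tau> - x\<bar> < d" using ab \<tau> by auto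
              then show ?thesis using d'[of a] d'[of b] d'[of \<tau>] ab(2) nn by simp
            qed
            finally show "L2_norm (\<lambda>\<xi>. (X b \<xi> + X a \<xi>) - 2 * X \<tau> \<xi>) \<le> e" .
          qed (use ab in auto)
        qed
      qed
      then show ?thesis using T by simp
    qed
    note b = this
    \<comment> \<open>C does not depend on e, so the estimate may be used with e / (C + 1); the 1
      covers C = 0.\<close>
    define C where "C = (LINT \<tau>:{0<..T}|lborel. L2_norm (W \<tau>))"
    have C: "0 \<le> C" unfolding C_def set_lebesgue_integral_def by (intro integral_nonneg_AE) auto
    have "\<bar>p T - p 0\<bar> \<le> 0"
    proof (rule field_le_epsilon)
      fix e :: real assume "0 < e"
      then have "\<bar>p T - p 0\<bar> \<le> e / (C + 1) * C" using b[of "e / (C + 1)"] C by (simp add: C_def add_nonneg_pos)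
      also have "\<dots> \<le> e" using \<open>0 < e\<close> C by (simp add: divide_le_eq algebra_simps)
      finally show "\<bar>p T - p 0\<bar> \<le> 0 + e" by simp
    qed
    then show ?thesis by (simp add: p_def)
  qed
  then show ?thesis by (simp add: vec_eq_iff)
qed

section \<open>Galilean boosts\<close>

text \<open>Time slice of the Galilean transform of a solution: frequencies move by \<xi> and
  positions by 2 t \<xi>. The phase is written as a sum so that the lemmas on modulated shifts apply
  literally.\<close>

definition boost :: "real ^ 3 \<Rightarrow> real \<Rightarrow> (real ^ 3 \<Rightarrow> complex) \<Rightarrow> real ^ 3 \<Rightarrow> complex" where
  "boost \<xi> t f x = cis (\<xi> \<bullet> x + - (t * norm \<xi> ^ 2)) * f (x - (2 * t) *\<^sub>R \<xi>)"

lemma boost_fun: "boost \<xi> t f = (\<lambda>x. cis (\<xi> \<bullet> x + - (t * norm \<xi> ^ 2)) * f (x - (2 * t) *\<^sub>R \<xi>))"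
  by (simp add: boost_def fun_eq_iff)

lemma norm_boost: "norm (boost \<xi> t f x) = norm (f (x - (2 * t) *\<^sub>R \<xi>))"
  by (simp add: boost_def norm_mult)

lemma boost_L2: "f \<in> L2 \<Longrightarrow> boost \<xi> t f \<in> L2"
  and L2_norm_boost: "f \<in> L2 \<Longrightarrow> L2_norm (boost \<xi> t f) = L2_norm f"
  unfolding boost_fun by (rule L2_modulate_shift; assumption)+

lemma boost_H1: "f \<in> H1 \<Longrightarrow> boost \<xi> t f \<in> H1"
  unfolding boost_fun by (rule H1_modulate_shift)

lemma grad_boost:
  assumes "f \<in> H1"
  shows "AE x in lborel. grad (boost \<xi> t f) x $ j = boost \<xi> t (\<lambda>x. grad f x $ j + \<i> * of_real (\<xi> $ j) * f x) x"
  using grad_modulate_shift[OF assms, of \<xi> "- (t * norm \<xi> ^ 2)" "(2 * t) *\<^sub>R \<xi>"]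
  unfolding boost_fun by eventually_elim simp

text \<open>Completing the square, |\<eta>|^2 = |\<eta> - \<xi>|^2 + 2 \<xi> . (\<eta> - \<xi>) +
  |\<xi>|^2, shows that the free flow over time \<tau> carries the boost at time s to the boost at
  time s + \<tau>.\<close>

lemma free_evolution_boost:
  assumes "free_evolution \<tau> f g"
  shows "free_evolution \<tau> (boost \<xi> s f) (boost \<xi> (s + \<tau>) g)"
proof -
  obtain F where F: "L2_fourier f F" "L2_fourier g (\<lambda>\<eta>. cis (- \<tau> * norm \<eta> ^ 2) * F \<eta>)"
    using assms by (auto simp: free_evolution_def)
  define K where "K = (\<lambda>\<eta>. cis (- (s * norm \<xi> ^ 2) - ((2 * s) *\<^sub>R \<xi>) \<bullet> (\<eta> - \<xi>)) * F (\<eta> - \<xi>))"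
  have 1: "L2_fourier (boost \<xi> s f) K"
    unfolding boost_fun K_def by (rule L2_fourier_modulate_shift[OF F(1)])
  have eq: "cis (- ((s + \<tau>) * norm \<xi> ^ 2) - ((2 * (s + \<tau>)) *\<^sub>R \<xi>) \<bullet> (\<eta> - \<xi>)) * (cis (- \<tau> * norm (\<eta> - \<xi>) ^ 2) * F (\<eta> - \<xi>)) =
      cis (- \<tau> * norm \<eta> ^ 2) * K \<eta>" for \<eta>
    unfolding K_def
    by (rule cis_mult_cong)
       (simp add: power2_norm_eq_inner inner_diff_left inner_diff_right inner_commute[of \<eta> \<xi>] algebra_simps)
  have "L2_fourier (boost \<xi> (s + \<tau>) g) (\<lambda>\<eta>. cis (- \<tau> * norm \<eta> ^ 2) * K \<eta>)"
    using L2_fourier_modulate_shift[OF F(2), of \<xi> "- ((s + \<tau>) * norm \<xi> ^ 2)" "(2 * (s + \<tau>)) *\<^sub>R \<xi>"]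
    unfolding boost_fun eq .
  with 1 show ?thesis unfolding free_evolution_def by blast
qed

lemma L2_inner_modulate_shift:
  assumes [measurable]: "f \<in> borel_measurable borel" "\<phi> \<in> borel_measurable borel"
  shows "L2_inner (\<lambda>x. cis (\<xi> \<bullet> x + c) * f (x - a)) \<phi> =
    L2_inner f (\<lambda>x. cis ((- \<xi>) \<bullet> x + (- (\<xi> \<bullet> a) - c)) * \<phi> (x - - a))"
proof -
  have "L2_inner (\<lambda>x. cis (\<xi> \<bullet> x + c) * f (x - a)) \<phi> =
    (LINT x|lborel. cis (\<xi> \<bullet> (x + a) + c) * f (x + a - a) * cnj (\<phi> (x + a)))"
    unfolding L2_inner_def by (rule integral_lborel_shift[symmetric]) measurable
  then show ?thesis by (simp add: L2_inner_def cis_cnj inner_add_right algebra_simps)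
qed

text \<open>The boost is an isometry whose adjoint, again a modulated shift, is put on the test
  element. Its time t is fixed while s runs, because the free flow over t - s has already carried
  the boost at time s to the one at time t.\<close>

lemma has_L2_integral_boost:
  assumes "has_L2_integral G a b V"
  shows "has_L2_integral (\<lambda>s. boost \<xi> t (G s)) a b (boost \<xi> t V)"
proof -
  have V: "V \<in> L2" and G: "\<And>s. s \<in> {a..b} \<Longrightarrow> G s \<in> L2"
    and n: "set_integrable lborel {a..b} (\<lambda>s. L2_norm (G s))"
    and w: "\<And>\<phi>. \<phi> \<in> L2 \<Longrightarrow> set_integrable lborel {a..b} (\<lambda>s. L2_inner (G s) \<phi>)"
      "\<And>\<phi>. \<phi> \<in> L2 \<Longrightarrow> L2_inner V \<phi> = (LINT s:{a..b}|lborel. L2_inner (G s) \<phi>)"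
    using assms by (auto simp: has_L2_integral_def)
  have "set_integrable lborel {a..b} (\<lambda>s. L2_norm (boost \<xi> t (G s)))"
    using n by (subst set_integrable_cong[OF refl refl L2_norm_boost[OF G]]) auto
  moreover have "set_integrable lborel {a..b} (\<lambda>s. L2_inner (boost \<xi> t (G s)) \<phi>) \<and>
      L2_inner (boost \<xi> t V) \<phi> = (LINT s:{a..b}|lborel. L2_inner (boost \<xi> t (G s)) \<phi>)" if \<phi>: "\<phi> \<in> L2" for \<phi>
  proof -
    define \<phi>' where "\<phi>' = (\<lambda>x. cis ((- \<xi>) \<bullet> x + (- (\<xi> \<bullet> ((2 * t) *\<^sub>R \<xi>)) - - (t * norm \<xi> ^ 2))) * \<phi> (x - - ((2 * t) *\<^sub>R \<xi>)))"
    have \<phi>': "\<phi>' \<in> L2" unfolding \<phi>'_def by (rule L2_modulate_shift(1)[OF \<phi>])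
    have eq: "L2_inner (boost \<xi> t f) \<phi> = L2_inner f \<phi>'" if "f \<in> L2" for f
      unfolding boost_fun \<phi>'_def by (rule L2_inner_modulate_shift[OF L2_measurable[OF that] L2_measurable[OF \<phi>]])
    have "set_integrable lborel {a..b} (\<lambda>s. L2_inner (boost \<xi> t (G s)) \<phi>)"
      using w(1)[OF \<phi>'] by (subst set_integrable_cong[OF refl refl eq[OF G]]) auto
    moreover have "(LINT s:{a..b}|lborel. L2_inner (boost \<xi> t (G s)) \<phi>) = (LINT s:{a..b}|lborel. L2_inner (G s) \<phi>')"
      by (rule set_lebesgue_integral_cong) (auto intro: eq[OF G])
    ultimately show ?thesis using w(2)[OF \<phi>'] eq[OF V] by simp
  qed
  ultimately show ?thesis
    unfolding has_L2_integral_def using boost_L2[OF V] boost_L2[OF G] by auto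
qed

lemma AE_lborel_shift:
  fixes a :: "'a::euclidean_space"
  assumes "AE x in lborel. P x" shows "AE x in lborel. P (x + a)"
proof -
  obtain N where N: "{x. \<not> P x} \<subseteq> N" "N \<in> null_sets lborel"
    using assms by (auto simp: eventually_ae_filter)
  have [measurable]: "N \<in> sets borel" using N(2) by (auto simp: null_sets_def)
  have "emeasure lborel N = emeasure (distr lborel borel ((+) a)) N" by (simp add: lborel_distr_plus)
  also have "\<dots> = emeasure lborel {x. x + a \<in> N}"
    by (subst emeasure_distr) (auto simp: vimage_def add.commute)
  finally have "{x. x + a \<in> N} \<in> null_sets lborel" using N(2) by (auto simp: null_sets_def)
  then show ?thesis
    by (rule AE_I') (use N(1) in auto)
qed

lemma AE_boost:
  assumes "AE x in lborel. f x = g x" shows "AE x in lborel. boost \<xi> t f x = boost \<xi> t g x"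
  using AE_lborel_shift[OF assms, of "- ((2 * t) *\<^sub>R \<xi>)"] by eventually_elim (simp add: boost_def)

section \<open>Continuity of boosted paths in time\<close>

text \<open>The modulation in x is common to both terms and drops out of the norm. There remain a
  convergent scalar phase and a shift, handled by continuity of translations.\<close>

lemma L2_norm_boost_diff_tendsto:
  assumes f: "f \<in> L2" and T: "T \<longlonglongrightarrow> t"
  shows "(\<lambda>n. L2_norm (\<lambda>x. boost \<xi> (T n) f x - boost \<xi> t f x)) \<longlonglongrightarrow> 0"
proof (rule Lim_null_comparison)
  let ?c = "\<lambda>t. cis (- (t * norm \<xi> ^ 2))" and ?a = "\<lambda>t. (2 * t) *\<^sub>R \<xi>"
  let ?b = "\<lambda>n. norm (?c (T n) - ?c t) * L2_norm f + L2_norm (\<lambda>x. f (x + (?a t - ?a (T n))) - f x)"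
  have [measurable]: "f \<in> borel_measurable borel" using f by (rule L2_measurable)
  have fs: "(\<lambda>x. f (x - a)) \<in> L2" "L2_norm (\<lambda>x. f (x - a)) = L2_norm f" for a
    using L2_shift[OF f, of "- a"] L2_norm_shift[of f "- a"] by auto
  show "\<forall>\<^sub>F n in sequentially. norm (L2_norm (\<lambda>x. boost \<xi> (T n) f x - boost \<xi> t f x)) \<le> ?b n"
  proof (intro always_eventually allI)
    fix n
    have split: "boost \<xi> (T n) f x - boost \<xi> t f x =
      cis (\<xi> \<bullet> x) * ((?c (T n) - ?c t) * f (x - ?a (T n)) + ?c t * (f (x - ?a (T n)) - f (x - ?a t)))" for x
      unfolding boost_def cis_mult[symmetric] by (simp only: ring_distribs mult.assoc) simp
    have "L2_norm (\<lambda>x. boost \<xi> (T n) f x - boost \<xi> t f x) =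
      L2_norm (\<lambda>x. (?c (T n) - ?c t) * f (x - ?a (T n)) + ?c t * (f (x - ?a (T n)) - f (x - ?a t)))"
      unfolding split by (rule L2_norm_cong) (simp add: norm_mult)
    also have "\<dots> \<le> L2_norm (\<lambda>x. (?c (T n) - ?c t) * f (x - ?a (T n))) + L2_norm (\<lambda>x. ?c t * (f (x - ?a (T n)) - f (x - ?a t)))"
      by (rule L2_norm_triangle[OF L2_cmult[OF fs(1)] L2_cmult[OF L2_diff[OF fs(1) fs(1)]]])
    also have "L2_norm (\<lambda>x. (?c (T n) - ?c t) * f (x - ?a (T n))) = norm (?c (T n) - ?c t) * L2_norm f"
      unfolding L2_norm_cmult fs(2) ..
    also have "L2_norm (\<lambda>x. ?c t * (f (x - ?a (T n)) - f (x - ?a t))) = L2_norm (\<lambda>x. f (x - ?a (T n)) - f (x - ?a t))"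
      unfolding L2_norm_cmult by simp
    also have "\<dots> = L2_norm (\<lambda>x. f (x + ?a t - ?a (T n)) - f (x + ?a t - ?a t))"
      by (rule L2_norm_shift[symmetric]) measurable
    finally show "norm (L2_norm (\<lambda>x. boost \<xi> (T n) f x - boost \<xi> t f x)) \<le> ?b n"
      by (simp add: add_diff_eq)
  qed
  have "(\<lambda>n. norm (?c (T n) - ?c t)) \<longlonglongrightarrow> norm (?c t - ?c t)"
    unfolding cis_conv_exp by (intro tendsto_intros T)
  moreover have "(\<lambda>n. ?a t - ?a (T n)) \<longlonglongrightarrow> ?a t - ?a t"
    by (intro tendsto_intros T)
  ultimately have "?b \<longlonglongrightarrow> 0 * L2_norm f + 0"
    by (intro tendsto_add tendsto_mult tendsto_const L2_shift_tendsto[OF f]) auto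
  then show "?b \<longlonglongrightarrow> 0" by simp
qed

text \<open>Since boosts are isometries, replacing the moving argument \<open>a s\<close> by
  \<open>a t\<close> costs exactly their distance.\<close>

lemma L2_norm_boost_path_tendsto:
  assumes a: "\<And>s. 0 \<le> s \<Longrightarrow> a s \<in> L2" and t: "0 \<le> t"
    and lim: "((\<lambda>s. L2_dist (a s) (a t)) \<longlongrightarrow> 0) (at t within {0..})"
  shows "((\<lambda>s. L2_norm (\<lambda>x. boost \<xi> s (a s) x - boost \<xi> t (a t) x)) \<longlongrightarrow> 0) (at t within {0..})"
proof (rule Lim_null_comparison)
  have "((\<lambda>s. L2_norm (\<lambda>x. boost \<xi> s (a t) x - boost \<xi> t (a t) x)) \<longlongrightarrow> 0) (at t within {0..})"
    unfolding tendsto_at_iff_sequentially comp_def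
    by (intro allI impI L2_norm_boost_diff_tendsto a t)
  from tendsto_add[OF lim this]
  show "((\<lambda>s. L2_dist (a s) (a t) + L2_norm (\<lambda>x. boost \<xi> s (a t) x - boost \<xi> t (a t) x)) \<longlongrightarrow> 0) (at t within {0..})"
    by simp
  have "L2_norm (\<lambda>x. boost \<xi> s (a s) x - boost \<xi> t (a t) x) \<le>
     L2_dist (a s) (a t) + L2_norm (\<lambda>x. boost \<xi> s (a t) x - boost \<xi> t (a t) x)" if s: "0 \<le> s" for s
  proof -
    have "L2_norm (\<lambda>x. boost \<xi> s (a s) x - boost \<xi> t (a t) x) \<le>
      L2_norm (\<lambda>x. boost \<xi> s (a s) x - boost \<xi> s (a t) x) + L2_norm (\<lambda>x. boost \<xi> s (a t) x - boost \<xi> t (a t) x)"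
      by (intro L2_norm_triangle_diff boost_L2 a s t)
    also have "(\<lambda>x. boost \<xi> s (a s) x - boost \<xi> s (a t) x) = boost \<xi> s (\<lambda>x. a s x - a t x)"
      by (simp add: boost_def fun_eq_iff right_diff_distrib)
    also have "L2_norm \<dots> = L2_dist (a s) (a t)"
      by (intro L2_norm_boost L2_diff a s t)
    finally show ?thesis .
  qed
  then show "\<forall>\<^sub>F s in at t within {0..}. norm (L2_norm (\<lambda>x. boost \<xi> s (a s) x - boost \<xi> t (a t) x)) \<le>
      L2_dist (a s) (a t) + L2_norm (\<lambda>x. boost \<xi> s (a t) x - boost \<xi> t (a t) x)"
    by (auto simp: eventually_at_filter)
qed

lemma H1_norm_bounds:
  shows "L2_norm f \<le> H1_norm f" "L2_norm (grad f) \<le> H1_norm f" "H1_norm f \<le> L2_norm f + L2_norm (grad f)"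
    and "0 \<le> H1_norm f"
proof -
  show "L2_norm f \<le> H1_norm f" "L2_norm (grad f) \<le> H1_norm f"
    unfolding H1_norm_def by (rule real_le_rsqrt; simp)+
  show "H1_norm f \<le> L2_norm f + L2_norm (grad f)"
    unfolding H1_norm_def by (rule real_le_lsqrt) (auto simp: power2_sum)
  show "0 \<le> H1_norm f" by (simp add: H1_norm_def)
qed

text \<open>Component j of the gradient of a boost is the boost of \<open>?p j\<close>, the j-th
  derivative plus i \<xi>_j u. Each \<open>?p j\<close> is continuous in L2, so u and all
  derivatives fall under \<open>L2_norm_boost_path_tendsto\<close>.\<close>

lemma continuous_in_H1_boost:
  assumes "continuous_in_H1 {0..} u"
  shows "continuous_in_H1 {0..} (\<lambda>t. boost \<xi> t (u t))"
  unfolding continuous_in_H1_def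
proof (intro conjI ballI)
  have u: "u t \<in> H1" if "0 \<le> t" for t using assms that by (simp add: continuous_in_H1_def)
  then show "boost \<xi> t (u t) \<in> H1" if "t \<in> {0..}" for t using that by (auto intro: boost_H1)
  fix t :: real assume "t \<in> {0..}"
  then have t: "0 \<le> t" by simp
  have lim: "((\<lambda>s. H1_norm (\<lambda>x. u s x - u t x)) \<longlongrightarrow> 0) (at t within {0..})"
    using assms t by (simp add: continuous_in_H1_def)
  have ev: "\<forall>\<^sub>F s in at t within {0..}. 0 \<le> s" by (auto simp: eventually_at_filter)
  let ?p = "\<lambda>j s x. grad (u s) x $ j + \<i> * of_real (\<xi> $ j) * u s x"
  have pL2: "?p j s \<in> L2" if "0 \<le> s" for j s
    by (intro L2_add L2_nth L2_cmult grad_L2 H1_L2 u that)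
  have p_le: "L2_norm (\<lambda>x. ?p j s x - ?p j t x) \<le> (1 + \<bar>\<xi> $ j\<bar>) * H1_norm (\<lambda>x. u s x - u t x)" if s: "0 \<le> s" for j s
  proof -
    note D = H1_diff[OF u[OF s] u[OF t]]
    have "L2_norm (\<lambda>x. ?p j s x - ?p j t x) = L2_norm (\<lambda>x. grad (\<lambda>x. u s x - u t x) x $ j + \<i> * of_real (\<xi> $ j) * (u s x - u t x))"
    proof (rule L2_norm_cong_AE)
      show "(\<lambda>x. ?p j s x - ?p j t x) \<in> borel_measurable borel"
        by (rule L2_measurable[OF L2_diff[OF pL2[OF s] pL2[OF t]]])
      show "(\<lambda>x. grad (\<lambda>x. u s x - u t x) x $ j + \<i> * of_real (\<xi> $ j) * (u s x - u t x)) \<in> borel_measurable borel"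
        by (rule L2_measurable[OF L2_add[OF L2_nth[OF grad_L2[OF D]] L2_cmult[OF H1_L2[OF D]]]])
      show "AE x in lborel. norm (?p j s x - ?p j t x) = norm (grad (\<lambda>x. u s x - u t x) x $ j + \<i> * of_real (\<xi> $ j) * (u s x - u t x))"
        using grad_diff[OF u[OF s] u[OF t]]
      proof eventually_elim
        case (elim x)
        show ?case unfolding elim by (simp add: algebra_simps)
      qed
    qed
    also have "\<dots> \<le> L2_norm (\<lambda>x. grad (\<lambda>x. u s x - u t x) x $ j) + L2_norm (\<lambda>x. \<i> * of_real (\<xi> $ j) * (u s x - u t x))"
      by (rule L2_norm_triangle[OF L2_nth[OF grad_L2[OF D]] L2_cmult[OF H1_L2[OF D]]])
    also have "L2_norm (\<lambda>x. \<i> * of_real (\<xi> $ j) * (u s x - u t x)) = \<bar>\<xi> $ j\<bar> * L2_dist (u s) (u t)"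
      unfolding L2_norm_cmult by (simp add: norm_mult)
    also have "L2_norm (\<lambda>x. grad (\<lambda>x. u s x - u t x) x $ j) + \<bar>\<xi> $ j\<bar> * L2_dist (u s) (u t) \<le>
      H1_norm (\<lambda>x. u s x - u t x) + \<bar>\<xi> $ j\<bar> * H1_norm (\<lambda>x. u s x - u t x)"
      using order_trans[OF L2_norm_vec_le(2)[OF grad_L2[OF D], of j] H1_norm_bounds(2)]
      by (intro add_mono mult_left_mono H1_norm_bounds) auto
    finally show ?thesis by (simp add: distrib_right)
  qed
  have lim_u: "((\<lambda>s. L2_norm (\<lambda>x. boost \<xi> s (u s) x - boost \<xi> t (u t) x)) \<longlongrightarrow> 0) (at t within {0..})"
  proof (rule L2_norm_boost_path_tendsto[OF H1_L2[OF u] t])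
    show "((\<lambda>s. L2_dist (u s) (u t)) \<longlongrightarrow> 0) (at t within {0..})"
      by (rule Lim_null_comparison[OF _ lim]) (auto intro: H1_norm_bounds always_eventually)
  qed
  have lim_p: "((\<lambda>s. L2_norm (\<lambda>x. boost \<xi> s (?p j s) x - boost \<xi> t (?p j t) x)) \<longlongrightarrow> 0) (at t within {0..})" for j
  proof (rule L2_norm_boost_path_tendsto[OF pL2 t])
    show "((\<lambda>s. L2_norm (\<lambda>x. ?p j s x - ?p j t x)) \<longlongrightarrow> 0) (at t within {0..})"
    proof (rule Lim_null_comparison)
      show "((\<lambda>s. (1 + \<bar>\<xi> $ j\<bar>) * H1_norm (\<lambda>x. u s x - u t x)) \<longlongrightarrow> 0) (at t within {0..})"
        using tendsto_mult_left[OF lim, of "1 + \<bar>\<xi> $ j\<bar>"] by simp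
      show "\<forall>\<^sub>F s in at t within {0..}. norm (L2_norm (\<lambda>x. ?p j s x - ?p j t x)) \<le> (1 + \<bar>\<xi> $ j\<bar>) * H1_norm (\<lambda>x. u s x - u t x)"
        using ev by eventually_elim (use p_le in auto)
    qed
  qed
  let ?w = "\<lambda>s x. boost \<xi> s (u s) x - boost \<xi> t (u t) x"
  show "((\<lambda>s. H1_norm (?w s)) \<longlongrightarrow> 0) (at t within {0..})"
  proof (rule Lim_null_comparison)
    have "((\<lambda>s. \<Sum>j\<in>UNIV. L2_norm (\<lambda>x. boost \<xi> s (?p j s) x - boost \<xi> t (?p j t) x)) \<longlongrightarrow> (\<Sum>j\<in>(UNIV :: 3 set). 0)) (at t within {0..})"
      by (intro tendsto_sum lim_p)
    from tendsto_add[OF lim_u this]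
    show "((\<lambda>s. L2_norm (?w s) + (\<Sum>j\<in>UNIV. L2_norm (\<lambda>x. boost \<xi> s (?p j s) x - boost \<xi> t (?p j t) x))) \<longlongrightarrow> 0) (at t within {0..})"
      by simp
    have "H1_norm (?w s) \<le> L2_norm (?w s) + (\<Sum>j\<in>UNIV. L2_norm (\<lambda>x. boost \<xi> s (?p j s) x - boost \<xi> t (?p j t) x))" if s: "0 \<le> s" for s
    proof -
      note bs = boost_H1[OF u[OF s], of \<xi> s] and bt = boost_H1[OF u[OF t], of \<xi> t]
      note D = H1_diff[OF bs bt]
      have "L2_norm (\<lambda>x. grad (?w s) x $ j) = L2_norm (\<lambda>x. boost \<xi> s (?p j s) x - boost \<xi> t (?p j t) x)" for j
      proof (rule L2_norm_cong_AE)
        show "(\<lambda>x. grad (?w s) x $ j) \<in> borel_measurable borel" by (rule L2_measurable[OF L2_nth[OF grad_L2[OF D]]])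
        show "(\<lambda>x. boost \<xi> s (?p j s) x - boost \<xi> t (?p j t) x) \<in> borel_measurable borel"
          by (rule L2_measurable[OF L2_diff[OF boost_L2[OF pL2[OF s]] boost_L2[OF pL2[OF t]]]])
        show "AE x in lborel. norm (grad (?w s) x $ j) = norm (boost \<xi> s (?p j s) x - boost \<xi> t (?p j t) x)"
          using grad_diff[OF bs bt] grad_boost[OF u[OF s], of \<xi> s j] grad_boost[OF u[OF t], of \<xi> t j]
          by eventually_elim simp
      qed
      then show ?thesis
        using H1_norm_bounds(3)[of "?w s"] L2_norm_vec_le(1)[OF grad_L2[OF D]] by simp
    qed
    then show "\<forall>\<^sub>F s in at t within {0..}. norm (H1_norm (?w s)) \<le>
        L2_norm (?w s) + (\<Sum>j\<in>UNIV. L2_norm (\<lambda>x. boost \<xi> s (?p j s) x - boost \<xi> t (?p j t) x))"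
      using ev by (auto simp: H1_norm_bounds elim!: eventually_mono)
  qed
qed

theorem global_solution_boost:
  assumes "global_solution u0 u"
  shows "global_solution (boost \<xi> 0 u0) (\<lambda>t. boost \<xi> t (u t))"
  unfolding global_solution_def
proof (intro conjI allI impI)
  show "boost \<xi> 0 u0 \<in> H1" using assms by (auto simp: global_solution_def intro: boost_H1)
  show "continuous_in_H1 {0..} (\<lambda>t. boost \<xi> t (u t))"
    using assms by (intro continuous_in_H1_boost) (simp add: global_solution_def)
  show "AE x in lborel. boost \<xi> 0 (u 0) x = boost \<xi> 0 u0 x"
    using assms by (intro AE_boost) (simp add: global_solution_def)
  fix t :: real assume "0 \<le> t"
  then obtain g G V where g: "free_evolution t u0 g"
    and G: "\<And>s. s \<in> {0..t} \<Longrightarrow> free_evolution (t - s) (cubic (u s)) (G s)"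
    and V: "has_L2_integral G 0 t V"
    and eq: "AE x in lborel. u t x = g x + \<i> * V x"
    using assms unfolding global_solution_def by blast
  show "\<exists>g G V. free_evolution t (boost \<xi> 0 u0) g \<and>
        (\<forall>s\<in>{0..t}. free_evolution (t - s) (\<lambda>x. of_real (norm (boost \<xi> s (u s) x) ^ 2) * boost \<xi> s (u s) x) (G s)) \<and>
        has_L2_integral G 0 t V \<and>
        (AE x in lborel. boost \<xi> t (u t) x = g x + \<i> * V x)"
  proof (intro exI conjI ballI)
    show "free_evolution t (boost \<xi> 0 u0) (boost \<xi> t g)"
      using free_evolution_boost[OF g, of \<xi> 0] by simp
    show "has_L2_integral (\<lambda>s. boost \<xi> t (G s)) 0 t (boost \<xi> t V)" by (rule has_L2_integral_boost[OF V])
    show "AE x in lborel. boost \<xi> t (u t) x = boost \<xi> t g x + \<i> * boost \<xi> t V x"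
      using AE_boost[OF eq, of \<xi> t] by eventually_elim (simp add: boost_def algebra_simps)
    fix s assume s: "s \<in> {0..t}"
    \<comment> \<open>Gauge invariance: |u|^2 ignores the phase, so the cubic nonlinearity commutes
      with the boost.\<close>
    have "(\<lambda>x. of_real (norm (boost \<xi> s (u s) x) ^ 2) * boost \<xi> s (u s) x) = boost \<xi> s (cubic (u s))"
      by (simp add: norm_boost fun_eq_iff) (simp add: boost_def)
    then show "free_evolution (t - s) (\<lambda>x. of_real (norm (boost \<xi> s (u s) x) ^ 2) * boost \<xi> s (u s) x) (boost \<xi> t (G s))"
      using free_evolution_boost[OF G[OF s], of \<xi> s] by simp
  qed
qed

section \<open>Gradient norm, mass and energy of boosted data\<close>

text \<open>The cross term in the square of |grad f + i \<xi> f| is 2 \<xi> . Im (cnj f grad f),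
  which integrates to the momentum. At time 0 the boost shifts nothing, so the expansion holds
  pointwise almost everywhere in x.\<close>

lemma L2_norm_grad_boost:
  assumes f: "f \<in> H1"
  shows "L2_norm (grad (boost \<xi> 0 f)) ^ 2 = L2_norm (grad f) ^ 2 + norm \<xi> ^ 2 * mass f + 2 * (\<xi> \<bullet> momentum f)"
proof -
  note g = grad_L2[OF f] and fL2 = H1_L2[OF f]
  have ex: "AE x in lborel. norm (grad (boost \<xi> 0 f) x) ^ 2 =
    norm (grad f x) ^ 2 + norm \<xi> ^ 2 * norm (f x) ^ 2 + 2 * (\<Sum>j\<in>UNIV. \<xi> $ j * Im (cnj (f x) * grad f x $ j))"
  proof -
    have "AE x in lborel. \<forall>j. grad (boost \<xi> 0 f) x $ j = boost \<xi> 0 (\<lambda>x. grad f x $ j + \<i> * of_real (\<xi> $ j) * f x) x"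
      by (simp add: AE_all_countable grad_boost[OF f])
    then show ?thesis
    proof eventually_elim
      case (elim x)
      have sq: "norm (v :: ('b::real_normed_vector) ^ 3) ^ 2 = (\<Sum>j\<in>UNIV. norm (v $ j) ^ 2)" for v
        by (simp add: norm_vec_def L2_set_def sum_nonneg)
      have "norm (z + \<i> * of_real y * w) ^ 2 = norm z ^ 2 + y ^ 2 * norm w ^ 2 + 2 * (y * Im (cnj w * z))" for z w :: complex and y :: real
        unfolding cmod_power2 by (simp add: power2_eq_square algebra_simps)
      then have "norm (grad (boost \<xi> 0 f) x) ^ 2 =
        (\<Sum>j\<in>UNIV. norm (grad f x $ j) ^ 2 + (\<xi> $ j) ^ 2 * norm (f x) ^ 2 + 2 * (\<xi> $ j * Im (cnj (f x) * grad f x $ j)))"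
        unfolding sq[of "grad (boost \<xi> 0 f) x"] elim[rule_format] norm_boost by simp
      also have "\<dots> = (\<Sum>j\<in>UNIV. norm (grad f x $ j) ^ 2) + (\<Sum>j\<in>UNIV. norm (\<xi> $ j) ^ 2) * norm (f x) ^ 2 + 2 * (\<Sum>j\<in>UNIV. \<xi> $ j * Im (cnj (f x) * grad f x $ j))"
        by (simp only: sum.distrib sum_distrib_left sum_distrib_right real_norm_def power2_abs)
      finally show ?case unfolding sq by simp
    qed
  qed
  have i: "integrable lborel (\<lambda>x. cnj (f x) * grad f x $ j)" for j
    using L2_integrable_mult[OF L2_cnj[OF fL2] L2_nth[OF g]] .
  have m: "(LINT x|lborel. Im (cnj (f x) * grad f x $ j)) = momentum f $ j" for j
    using integral_Im[OF i] by (simp add: momentum_def)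
  have "L2_norm (grad (boost \<xi> 0 f)) ^ 2 = (LINT x|lborel. norm (grad f x) ^ 2 + norm \<xi> ^ 2 * norm (f x) ^ 2 + 2 * (\<Sum>j\<in>UNIV. \<xi> $ j * Im (cnj (f x) * grad f x $ j)))"
    unfolding L2_norm_square
  proof (rule integral_cong_AE)
    show "(\<lambda>x. norm (grad f x) ^ 2 + norm \<xi> ^ 2 * norm (f x) ^ 2 + 2 * (\<Sum>j\<in>UNIV. \<xi> $ j * Im (cnj (f x) * grad f x $ j))) \<in> borel_measurable lborel"
      using L2_measurable[OF g] L2_measurable[OF fL2] borel_measurable_integrable[OF integrable_Im[OF i]] by measurable
    show "(\<lambda>x. norm (grad (boost \<xi> 0 f) x) ^ 2) \<in> borel_measurable lborel"
      using L2_measurable[OF grad_L2[OF boost_H1[OF f]], of \<xi> 0] by measurable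
  qed (rule ex)
  also have "\<dots> = L2_norm (grad f) ^ 2 + norm \<xi> ^ 2 * mass f + 2 * (\<Sum>j\<in>UNIV. \<xi> $ j * momentum f $ j)"
    using L2_integrable_norm[OF g] L2_integrable_norm[OF fL2] integrable_Im[OF i]
    by (simp add: L2_norm_square mass_def m del: times_complex.sel)
  finally show ?thesis by (simp add: inner_vec_def)
qed

lemma mass_boost: "f \<in> L2 \<Longrightarrow> mass (boost \<xi> t f) = mass f"
  using L2_norm_boost[of f \<xi> t] by (simp add: mass_def L2_norm_square[symmetric])

lemma energy_boost:
  assumes f: "f \<in> H1"
  shows "energy (boost \<xi> 0 f) = energy f + 1 / 2 * norm \<xi> ^ 2 * mass f + \<xi> \<bullet> momentum f"
  using L2_norm_grad_boost[OF f, of \<xi>] by (simp add: energy_def L2_norm_square norm_boost)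

section \<open>Invariance of the scattering norm\<close>

text \<open>The infinite exponent is excluded because \<open>esssup\<close> tests measurability,
  which a change on a null set can destroy.\<close>

lemma Lp_enorm_cong_AE:
  assumes "p \<noteq> \<infinity>" "AE x in M. f x = g x"
  shows "Lp_enorm M p f = Lp_enorm M p g"
proof -
  have "(\<integral>\<^sup>+ x. ennpowr (f x) (real_of_ereal p) \<partial>M) = (\<integral>\<^sup>+ x. ennpowr (g x) (real_of_ereal p) \<partial>M)"
    by (rule nn_integral_cong_AE) (use assms(2) in auto)
  with assms(1) show ?thesis by (simp add: Lp_enorm_def)
qed

text \<open>Equality at every point preserves measurability too, so the infinite exponent, which
  occurs in time, is covered.\<close>

lemma Lp_enorm_cong:
  assumes "\<And>x. x \<in> space M \<Longrightarrow> f x = g x"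
  shows "Lp_enorm M p f = Lp_enorm M p g"
proof (cases "p = \<infinity>")
  case True
  have "f \<in> borel_measurable M \<longleftrightarrow> g \<in> borel_measurable M" using assms by (rule measurable_cong)
  moreover have "Limsup (ae_filter M) f = Limsup (ae_filter M) g" using assms by (intro Limsup_eq AE_I2)
  ultimately show ?thesis using True by (simp add: Lp_enorm_def esssup_def)
qed (use assms in \<open>auto intro: Lp_enorm_cong_AE\<close>)

lemma ennpowr_measurable [measurable]: "(\<lambda>x. ennpowr x p) \<in> borel_measurable borel"
  unfolding ennpowr_def by measurable

lemma Lp_enorm_shift:
  fixes f :: "real ^ 3 \<Rightarrow> complex"
  assumes "p \<noteq> \<infinity>" and [measurable]: "f \<in> borel_measurable borel"
  shows "Lp_enorm lborel p (\<lambda>x. ennreal (norm (f (x - a)))) = Lp_enorm lborel p (\<lambda>x. ennreal (norm (f x)))"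
  using nn_integral_lborel_shift[of "\<lambda>x. ennpowr (ennreal (norm (f x))) (real_of_ereal p)" "- a"] assms(1)
  by (simp add: Lp_enorm_def)

text \<open>The bound of r by the real \<open>r6\<close> keeps the spatial exponents finite, while
  the time exponent may be infinite. Hence spatial norms are compared at every single t \<ge> 0 and
  not merely at almost every t.\<close>

lemma S_norm_cong:
  assumes "\<And>t r. 0 \<le> t \<Longrightarrow> r \<noteq> \<infinity> \<Longrightarrow> Lp_enorm lborel r (\<lambda>x. ennreal (norm (u t x))) = Lp_enorm lborel r (\<lambda>x. ennreal (norm (v t x)))"
  shows "S_norm r6 q4 u = S_norm r6 q4 v"
  unfolding S_norm_def
proof (rule SUP_cong[OF refl], clarify)
  fix q r assume "r \<le> ereal r6"
  then have r: "r \<noteq> \<infinity>" by auto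
  show "mixed_norm q r u = mixed_norm q r v"
    unfolding mixed_norm_def by (rule Lp_enorm_cong) (auto simp: space_restrict_space intro!: assms r)
qed

lemma S_norm_boost:
  assumes "\<And>t. 0 \<le> t \<Longrightarrow> u t \<in> borel_measurable borel"
  shows "S_norm r6 q4 (\<lambda>t. boost \<xi> t (u t)) = S_norm r6 q4 u"
  by (rule S_norm_cong) (simp add: norm_boost Lp_enorm_shift assms)

lemma S_norm_cong_AE:
  assumes "\<And>t. 0 \<le> t \<Longrightarrow> AE x in lborel. u t x = v t x"
  shows "S_norm r6 q4 u = S_norm r6 q4 v"
proof (rule S_norm_cong)
  fix t :: real and r :: ereal assume "0 \<le> t" "r \<noteq> \<infinity>"
  then show "Lp_enorm lborel r (\<lambda>x. ennreal (norm (u t x))) = Lp_enorm lborel r (\<lambda>x. ennreal (norm (v t x)))"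
    using assms[OF \<open>0 \<le> t\<close>] by (intro Lp_enorm_cong_AE) auto
qed

section \<open>Contradiction for a critical solution of nonzero momentum\<close>

theorem proposition4p1:
  fixes r6 q4 :: real
    and Q uc0 :: "real ^ 3 \<Rightarrow> complex"
    and uc :: "real \<Rightarrow> real ^ 3 \<Rightarrow> complex"
  assumes "r6 < 6" and "4 < q4"
    and "ground_state Q"
    and "ME_crit r6 q4 Q < ereal (mass Q * energy Q)"
    and "uc0 \<in> H1"
    and "global_solution uc0 uc"
    and "L2_norm uc0 = 1"
    and "ereal (energy uc0) = ME_crit r6 q4 Q"
    and "\<forall>t\<ge>0. L2_norm (grad (uc t)) < L2_norm Q * L2_norm (grad Q)"
    and "S_norm r6 q4 uc = \<infinity>"
  shows "\<forall>t\<ge>0. momentum (uc t) = 0"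
proof -
  note sol = assms(6) and H1 = assms(5)
  have uc: "uc t \<in> H1" if "0 \<le> t" for t by (rule global_solution_H1[OF sol that])
  have init: "AE x in lborel. uc 0 x = uc0 x" using sol by (simp add: global_solution_def)
  have mass: "mass uc0 = 1" using assms(7) L2_norm_square[of uc0] by (simp add: mass_def)
  define P where "P = momentum uc0"
  have "P = 0"
  proof (rule ccontr)
    assume "P \<noteq> 0"
    then have P: "0 < norm P ^ 2" by simp
    \<comment> \<open>For mass 1 a boost by \<xi> changes the energy by |\<xi>|^2 / 2 + \<xi> . P,
      and - P is the minimiser.\<close>
    define w0 where "w0 = boost (- P) 0 uc0"
    define w where "w = (\<lambda>t. boost (- P) t (uc t))"
    have w: "global_solution w0 w" unfolding w0_def w_def by (rule global_solution_boost[OF sol])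
    have PP: "P \<bullet> momentum uc0 = norm P ^ 2" by (simp add: P_def power2_norm_eq_inner)
    have "energy w0 = energy uc0 - 1 / 2 * norm P ^ 2"
      using energy_boost[OF H1, of "- P"] by (simp add: w0_def mass PP)
    then have "ereal (energy w0) < ME_crit r6 q4 Q" using P by (simp flip: assms(8))
    \<comment> \<open>Strictly below the supremum there is room for an admissible \<delta> above the
      energy of w0. As w0 has mass 1, this energy is the product of mass and energy in
      \<open>S_set\<close>.\<close>
    then obtain \<delta> where \<delta>: "energy w0 < \<delta>" "\<forall>u0\<in>S_set Q \<delta>. SC r6 q4 u0"
      by (auto simp: ME_crit_def less_Sup_iff)
    have "w0 \<in> S_set Q \<delta>"
    proof -
      \<comment> \<open>The mass term contributes |P|^2 and the momentum term - 2 |P|^2, a net loss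
        of |P|^2.\<close>
      have "L2_norm (grad w0) ^ 2 \<le> L2_norm (grad uc0) ^ 2"
        using L2_norm_grad_boost[OF H1, of "- P"] by (simp add: w0_def mass PP)
      then have "L2_norm (grad w0) \<le> L2_norm (grad uc0)" by (rule power2_le_imp_le) simp
      \<comment> \<open>The gradient bound is assumed along the flow, whose value at time 0 agrees
        with the data only almost everywhere.\<close>
      also have "\<dots> = L2_norm (grad (uc 0))"
        using grad_cong_AE[OF uc[of 0] H1 init]
        by (intro L2_norm_cong_AE L2_measurable grad_L2 H1 uc) auto
      also have "\<dots> < L2_norm Q * L2_norm (grad Q)" using assms(9) by simp
      finally have "L2_norm (grad w0) < L2_norm Q * L2_norm (grad Q)" .
      moreover have "L2_norm w0 = 1" unfolding w0_def using L2_norm_boost[OF H1_L2[OF H1]] assms(7) by simp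
      moreover have "mass w0 = 1" unfolding w0_def using mass_boost[OF H1_L2[OF H1]] mass by simp
      moreover have "w0 \<in> H1" unfolding w0_def by (rule boost_H1[OF H1])
      ultimately show ?thesis using \<delta>(1) by (simp add: S_set_def)
    qed
    with \<delta>(2) have "SC r6 q4 w0" by blast
    \<comment> \<open>The uniqueness clause in \<open>SC\<close> identifies the scattering solution
      v with the boosted solution w, up to null sets at each time.\<close>
    then obtain v where v: "\<forall>v'. global_solution w0 v' \<longrightarrow> (\<forall>t\<ge>0. AE x in lborel. v' t x = v t x)" "S_norm r6 q4 v < \<infinity>"
      unfolding SC_def by blast
    have "S_norm r6 q4 uc = S_norm r6 q4 w"
      unfolding w_def by (rule S_norm_boost[symmetric]) (rule L2_measurable[OF H1_L2[OF uc]])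
    also have "\<dots> = S_norm r6 q4 v" using v(1) w by (intro S_norm_cong_AE) blast
    finally show False using v(2) assms(10) by simp
  qed
  \<comment> \<open>The contradiction concerns the data alone; conservation carries the vanishing
    momentum to all later times.\<close>
  then show ?thesis
    using momentum_conserved[OF sol] momentum_cong_AE[OF uc[of 0] H1 init] by (simp add: P_def)
qed

end
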